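(* Let $(\vartheta_0,k)$ be one of the pairs $(0.729,2)$, $(0.616,3)$, $(0.554,4)$, $(0.515,5)$, and suppose that some $\vartheta>\vartheta_0$ satisfies both conditions (A) and (B) below. Let $\mathcal H=\{h_i\}_{i=1}^k$ be an admissible $k$-tuple and let $r\ne 0$ be a fixed integer with $r\notin\mathcal H$. Then there are infinitely many integers $n$ such that either (i) $n+\mathcal H=\{n+h_i\}_{i=1}^k$ contains at least two primes, or (ii) $n+h_i$ is prime for some $h_i\in\mathcal H$ and $\lambda(n+r)=-1$.
   Context: A $k$-tuple $\mathcal H=\{h_i\}_{i=1}^k$ of integers $0\le h_1<\dots<h_k$ is admissible if for every prime $p$ its elements do not occupy all residue classes modulo $p$. $\Omega(n)$ is the number of prime factors of $n$ counted with multiplicity and $\lambda(n)=(-1)^{\Omega(n)}$. Condition (A) (level of distribution $\vartheta$ of primes): for every $\varepsilon>0$, $A>0$, $\sum_{q\le N^{\vartheta-\varepsilon}}\max_{a:(a,q)=1}\bigl|\sum_{p\le N,\,p\equiv a\ (\mathrm{mod}\ q)}\log p-\frac{N}{\varphi(q)}\bigr|\ll_{\varepsilon,A}\frac{N}{(\log N)^A}$ ($p$ ranging over primes). Condition (B): for every $\varepsilon>0$, $A>0$, $\sum_{q\le N^{\vartheta-\varepsilon}}\max_{y\le N}\max_a\bigl|\sum_{n\le y,\,n\equiv a\ (\mathrm{mod}\ q)}\lambda(n)\bigr|\ll_{\varepsilon,A}\frac{N}{(\log N)^A}$. *)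

theory Defs
  imports "HOL-Analysis.Analysis" "HOL-Number_Theory.Number_Theory" "HOL-Library.Landau_Symbols"
begin

definition bigOmega :: "int \<Rightarrow> nat" where
  "bigOmega n = size (prime_factorization n)"

definition liouville :: "int \<Rightarrow> int" where
  "liouville n = (-1) ^ bigOmega n"

definition admissible_tuple :: "nat \<Rightarrow> int set \<Rightarrow> bool" where
  "admissible_tuple k H \<longleftrightarrow> finite H \<and> card H = k \<and> (\<forall>h\<in>H. 0 \<le> h) \<and>
     (\<forall>p::int. prime p \<longrightarrow> (\<exists>c. \<forall>h\<in>H. \<not> [h = c] (mod p)))"

definition condA :: "real \<Rightarrow> bool" where
  "condA \<theta> \<longleftrightarrow> (\<forall>\<epsilon>>0. \<forall>A>0.
     (\<lambda>N::nat. \<Sum>q\<in>{1..nat \<lfloor>real N powr (\<theta> - \<epsilon>)\<rfloor>}.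
        Max ((\<lambda>a. \<bar>(\<Sum>p\<in>{p. prime p \<and> p \<le> N \<and> [p = a] (mod q)}. ln (real p))
                    - real N / real (totient q)\<bar>) ` {a. a < q \<and> coprime a q}))
     \<in> O(\<lambda>N. real N / ln (real N) powr A))"

definition condB :: "real \<Rightarrow> bool" where
  "condB \<theta> \<longleftrightarrow> (\<forall>\<epsilon>>0. \<forall>A>0.
     (\<lambda>N::nat. \<Sum>q\<in>{1..nat \<lfloor>real N powr (\<theta> - \<epsilon>)\<rfloor>}.
        Max ((\<lambda>(y, a). \<bar>real_of_int (\<Sum>n\<in>{n. 1 \<le> n \<and> n \<le> y \<and> [n = a] (mod q)}.
                    liouville (int n))\<bar>) ` ({0..N} \<times> {..<q})))
     \<in> O(\<lambda>N. real N / ln (real N) powr A))"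

end

theory Submission
  imports Defs "HOL-Real_Asymp.Real_Asymp"
begin

text \<open>
  Suppose that from some point on \<open>n + H\<close> contains at most one prime and that
  \<open>\<lambda>(n + r) = 1\<close> whenever it contains one. Then
  \<open>\<Sum>\<^sub>h 1\<^bsub>prime\<^esub>(n + h) \<le> (1 + \<lambda>(n + r)) / 2\<close> for all large \<open>n\<close>. Sum this against
  a Goldston-Pintz-Yildirim weight \<open>(\<Sum>\<^bsub>d dvd \<Prod>(n + h)\<^esub> c\<^sub>d)\<^sup>2\<close> over \<open>N < n \<le> 2 N\<close>, with
  \<open>d \<le> R = N\<^bsup>\<eta>/2\<^esup>\<close>. By condition (B) the contribution of \<open>\<lambda>(n + r)\<close> is negligible, so the
  expected number of primes with respect to the weight would be at most \<open>1/2\<close>, whereas condition (A)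
  shows that it exceeds \<open>1/2\<close>.

  Both quadratic forms are diagonalised exactly. Fixing the diagonal variables of the first one as
  \<open>f(log r / log R)\<close> with \<open>f(u) = 1 + b (1 - u)\<close>, the two main terms become
  \<open>\<Sum>\<^sub>s a(s) f\<^sup>2\<close> and \<open>\<Sum>\<^sub>s \<alpha>(s) (s / \<phi>(s)) (\<Sum>\<^sub>t f / \<phi>(t))\<^sup>2\<close>. One of the two inner
  factors is bounded below by the elementary inequality
  \<open>\<Sum>\<^bsub>t \<le> y, (t, q) = 1\<^esub> \<mu>\<^sup>2(t) / \<phi>(t) \<ge> (\<phi>(q) / q) log y\<close>, after which both main terms are averages
  with respect to the same measure on pairs \<open>(s, t)\<close>. The moments of this measure satisfy a
  recursion, obtained by pulling out one prime factor and applying Mertens' theorem, so that no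
  asymptotic formula for its total mass is needed.
\<close>

section \<open>Diagonalisation of the sieve quadratic form\<close>

text \<open>The singular series never appears. Fixing \<open>n\<close> in a class modulo the product
  of all primes up to a constant \<open>B\<close>, so that no \<open>n + h\<close> has a small prime
  factor, leaves the sieve only primes \<open>p > B\<close>, which exceed \<open>2 * k\<close> and
  every \<open>h\<close>; the factor \<open>N / \<Prod>Z\<close> is then common to both main terms.
  The mass of the measure on pairs cancels from the comparison as well. It is needed only for error
  terms, where the contribution 1 of the pair of empty sets suffices. The moments found are those of
  the Dirichlet law with parameters \<open>k - 1\<close>, 1, 1 for the logarithmic shares of
  \<open>s\<close>, of \<open>t\<close> and of the room left over; with \<open>m1\<close>,
  \<open>m2\<close>, \<open>m3\<close> the first moments of that room, the assumption leads to
  \<open>k * \<eta> * (2 * m1 + 3 * b * m2 + b^2 * m3) \<le> 1 + 2 * b * m1 + b^2 * m2\<close> for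
  every \<open>b \<ge> 0\<close>. The argument is by contradiction, so a lower bound for the prime
  sum is all that is required, and this is why an inequality can replace the asymptotics of an inner
  sum. For each of the four pairs some integer \<open>b\<close> violates the final inequality
  already at \<open>\<eta> = \<theta>0\<close>; the excess of \<open>\<theta>\<close> over
  \<open>\<theta>0\<close> pays for the fixed modulus.\<close>

lemma prod_one_plus_Pow:
  fixes f :: "'a \<Rightarrow> 'b :: comm_ring_1"
  assumes "finite A"
  shows "(\<Prod>x\<in>A. 1 + f x) = (\<Sum>X\<in>Pow A. prod f X)"
  using prod_add[OF assms, of f "\<lambda>_. 1"] by (simp add: add.commute)

text \<open>A multiplicative form of Moebius inversion: for \<open>f = -1\<close> the right side
  vanishes unless \<open>S = Q\<close>.\<close>

lemma sum_prod_between: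
  fixes f :: "'a \<Rightarrow> 'b :: comm_ring_1"
  assumes "finite Q" "S \<subseteq> Q"
  shows "(\<Sum>D\<in>{D. S \<subseteq> D \<and> D \<subseteq> Q}. prod f D) = prod f S * (\<Prod>x\<in>Q - S. 1 + f x)"
proof -
  have "(\<Sum>D\<in>{D. S \<subseteq> D \<and> D \<subseteq> Q}. prod f D) = (\<Sum>X\<in>Pow (Q - S). prod f (S \<union> X))"
    by (rule sum.reindex_bij_witness[of _ "\<lambda>X. S \<union> X" "\<lambda>D. D - S"])
       (use assms in \<open>auto simp: Un_absorb1\<close>)
  also have "\<dots> = (\<Sum>X\<in>Pow (Q - S). prod f S * prod f X)"
  proof (rule sum.cong[OF refl])
    fix X assume "X \<in> Pow (Q - S)"
    then show "prod f (S \<union> X) = prod f S * prod f X"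
      by (intro prod.union_disjoint) (use assms in \<open>auto intro: finite_subset\<close>)
  qed
  finally show ?thesis
    using assms by (simp add: prod_one_plus_Pow sum_distrib_left)
qed

text \<open>Models the squarefree \<open>d \<le> R\<close> with prescribed prime factors. Closure
  under divisors is the arithmetic input of the diagonalisation.\<close>

locale divisor_family =
  fixes F :: "'a set set"
  assumes finite_family: "finite F"
    and finite_member: "S \<in> F \<Longrightarrow> finite S"
    and down_closed: "S \<in> F \<Longrightarrow> T \<subseteq> S \<Longrightarrow> T \<in> F"
begin

text \<open>After exchanging the sums, each \<open>Q\<close> carries a sum over
  \<open>S \<subseteq> D \<subseteq> Q\<close> that factors by \<open>sum_prod_between\<close>; what
  remains is indexed by \<open>T = Q - S\<close>. For \<open>\<gamma> = 1\<close> only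
  \<open>T = {}\<close> survives, which is Moebius inversion; another \<open>\<gamma>\<close>
  measures the mismatch between two densities.\<close>

lemma sum_multiples_eq:
  fixes \<gamma> a :: "'a \<Rightarrow> real" and z :: "'a set \<Rightarrow> real"
  assumes S: "S \<in> F"
  shows "(\<Sum>D | D \<in> F \<and> S \<subseteq> D. prod (\<lambda>p. - \<gamma> p) D * (\<Sum>Q | Q \<in> F \<and> D \<subseteq> Q. prod a Q * z Q))
       = prod (\<lambda>p. - \<gamma> p) S * prod a S *
         (\<Sum>T | S \<inter> T = {} \<and> S \<union> T \<in> F. prod (\<lambda>p. a p * (1 - \<gamma> p)) T * z (S \<union> T))"
proof -
  let ?m = "\<lambda>p. - \<gamma> p"
  have "(\<Sum>D | D \<in> F \<and> S \<subseteq> D. prod ?m D * (\<Sum>Q | Q \<in> F \<and> D \<subseteq> Q. prod a Q * z Q))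
      = (\<Sum>D\<in>{D \<in> F. S \<subseteq> D}. \<Sum>Q | Q \<in> F \<and> D \<subseteq> Q. prod ?m D * (prod a Q * z Q))"
    by (simp add: sum_distrib_left)
  also have "\<dots> = (\<Sum>Q\<in>F. \<Sum>D | D \<in> {D \<in> F. S \<subseteq> D} \<and> D \<subseteq> Q. prod ?m D * (prod a Q * z Q))"
    by (rule sum.swap_restrict) (simp_all add: finite_family)
  also have "\<dots> = (\<Sum>Q\<in>F. (\<Sum>D | S \<subseteq> D \<and> D \<subseteq> Q. prod ?m D) * (prod a Q * z Q))"
    unfolding sum_distrib_right
    by (intro sum.cong) (auto intro: down_closed)
  also have "\<dots> = (\<Sum>Q | Q \<in> F \<and> S \<subseteq> Q. (\<Sum>D | S \<subseteq> D \<and> D \<subseteq> Q. prod ?m D) * (prod a Q * z Q))"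
  proof (rule sum.mono_neutral_right)
    show "\<forall>i\<in>F - {Q \<in> F. S \<subseteq> Q}. sum (prod ?m) {D. S \<subseteq> D \<and> D \<subseteq> i} * (prod a i * z i) = 0"
    proof
      fix i assume "i \<in> F - {Q \<in> F. S \<subseteq> Q}"
      then have e: "{D. S \<subseteq> D \<and> D \<subseteq> i} = {}" by auto
      show "sum (prod ?m) {D. S \<subseteq> D \<and> D \<subseteq> i} * (prod a i * z i) = 0"
        unfolding e by simp
    qed
  qed (auto simp: finite_family)
  also have "\<dots> = (\<Sum>Q | Q \<in> F \<and> S \<subseteq> Q. prod ?m S * (\<Prod>x\<in>Q - S. 1 - \<gamma> x) * (prod a Q * z Q))"
    by (intro sum.cong refl) (auto simp: sum_prod_between finite_member)
  also have "\<dots> = (\<Sum>T | S \<inter> T = {} \<and> S \<union> T \<in> F. prod ?m S * prod a S *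
         (prod (\<lambda>p. a p * (1 - \<gamma> p)) T * z (S \<union> T)))"
  proof (rule sum.reindex_bij_witness[of _ "\<lambda>T. S \<union> T" "\<lambda>Q. Q - S"], goal_cases)
    case (5 Q)
    then have Q: "Q \<in> F" "S \<subseteq> Q" by auto
    have "finite Q" using Q finite_member by auto
    then have "prod a Q = prod a S * prod a (Q - S)"
      using Q by (metis prod.subset_diff mult.commute)
    moreover have "S \<union> (Q - S) = Q" using Q by auto
    ultimately show ?case by (simp add: prod.distrib)
  qed (auto simp: Un_absorb1)
  finally show ?thesis by (simp add: sum_distrib_left)
qed

text \<open>Selberg's diagonalisation: \<open>prod g (D \<union> E)\<close> is
  \<open>prod g D * prod g E / prod g (D \<inter> E)\<close>, and \<open>1 + h = 1 / g\<close>
  expands the reciprocal of the last factor into a sum over subsets \<open>S\<close> of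
  \<open>D \<inter> E\<close>. Exchanging the sums then separates \<open>D\<close> from
  \<open>E\<close>.\<close>

lemma quadratic_form_diagonal:
  fixes g h :: "'a \<Rightarrow> real" and x :: "'a set \<Rightarrow> real"
  assumes nz: "\<And>p S. S \<in> F \<Longrightarrow> p \<in> S \<Longrightarrow> g p \<noteq> 0"
    and h: "\<And>p S. S \<in> F \<Longrightarrow> p \<in> S \<Longrightarrow> h p = 1 / g p - 1"
  shows "(\<Sum>D\<in>F. \<Sum>E\<in>F. x D * x E * prod g (D \<union> E))
       = (\<Sum>S\<in>F. prod h S * (\<Sum>D | D \<in> F \<and> S \<subseteq> D. x D * prod g D)\<^sup>2)"
proof -
  have gU: "prod g (D \<union> E) = prod g D * prod g E * (\<Sum>S | S \<in> F \<and> S \<subseteq> D \<and> S \<subseteq> E. prod h S)"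
    if D: "D \<in> F" and E: "E \<in> F" for D E
  proof -
    have fin: "finite D" "finite E" using D E finite_member by auto
    have nz': "prod g (D \<inter> E) \<noteq> 0" using nz[OF D] fin by auto
    have "(\<Sum>S | S \<in> F \<and> S \<subseteq> D \<and> S \<subseteq> E. prod h S) = (\<Sum>S\<in>Pow (D \<inter> E). prod h S)"
      by (intro sum.cong) (auto intro: down_closed[OF D])
    also have "\<dots> = (\<Prod>p\<in>D \<inter> E. 1 + h p)"
      using fin by (simp add: prod_one_plus_Pow)
    also have "\<dots> = (\<Prod>p\<in>D \<inter> E. 1 / g p)"
      by (intro prod.cong) (auto simp: h[OF D])
    also have "\<dots> = 1 / prod g (D \<inter> E)"
      by (simp add: prod_dividef)
    finally have sum_eq: "(\<Sum>S | S \<in> F \<and> S \<subseteq> D \<and> S \<subseteq> E. prod h S) = 1 / prod g (D \<inter> E)" .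
    show ?thesis
      unfolding sum_eq using prod.union_inter[OF fin, of g] nz' by (simp add: field_simps)
  qed
  have "(\<Sum>D\<in>F. \<Sum>E\<in>F. x D * x E * prod g (D \<union> E))
      = (\<Sum>(D, E)\<in>F \<times> F. \<Sum>S | S \<in> F \<and> S \<subseteq> D \<and> S \<subseteq> E. prod h S * (x D * prod g D) * (x E * prod g E))"
    unfolding sum.cartesian_product
    by (intro sum.cong refl) (auto simp: gU sum_distrib_left sum_distrib_right mult_ac)
  also have "\<dots> = (\<Sum>y\<in>F \<times> F. \<Sum>S | S \<in> F \<and> (S \<subseteq> fst y \<and> S \<subseteq> snd y).
      prod h S * (x (fst y) * prod g (fst y)) * (x (snd y) * prod g (snd y)))"
    by (simp add: case_prod_beta)
  also have "\<dots> = (\<Sum>S\<in>F. \<Sum>y | y \<in> F \<times> F \<and> (S \<subseteq> fst y \<and> S \<subseteq> snd y).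
      prod h S * (x (fst y) * prod g (fst y)) * (x (snd y) * prod g (snd y)))"
    by (rule sum.swap_restrict) (simp_all add: finite_family)
  also have "\<dots> = (\<Sum>S\<in>F. prod h S * (\<Sum>D | D \<in> F \<and> S \<subseteq> D. x D * prod g D)\<^sup>2)"
  proof (rule sum.cong[OF refl])
    fix S assume "S \<in> F"
    have eq: "{y. y \<in> F \<times> F \<and> (S \<subseteq> fst y \<and> S \<subseteq> snd y)} = {D \<in> F. S \<subseteq> D} \<times> {D \<in> F. S \<subseteq> D}"
      by auto
    show "(\<Sum>y | y \<in> F \<times> F \<and> (S \<subseteq> fst y \<and> S \<subseteq> snd y).
      prod h S * (x (fst y) * prod g (fst y)) * (x (snd y) * prod g (snd y)))
      = prod h S * (\<Sum>D | D \<in> F \<and> S \<subseteq> D. x D * prod g D)\<^sup>2"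
      unfolding eq power2_eq_square
      by (simp add: sum_product sum.cartesian_product sum_distrib_left case_prod_beta mult_ac)
  qed
  finally show ?thesis .
qed

text \<open>Built by Moebius inversion: multiplied by \<open>prod g D\<close> it is the signed sum
  of \<open>prod a Q * z Q\<close> over multiples \<open>Q\<close> of \<open>D\<close>, so that
  \<open>z\<close>, up to the factor \<open>a\<close>, is a free choice of the diagonal variables
  for the density \<open>g\<close>.\<close>

definition sieve_weight :: "('a \<Rightarrow> real) \<Rightarrow> ('a \<Rightarrow> real) \<Rightarrow> ('a set \<Rightarrow> real) \<Rightarrow> 'a set \<Rightarrow> real" where
  "sieve_weight g a z D = (\<Prod>p\<in>D. - 1 / g p) * (\<Sum>Q | Q \<in> F \<and> D \<subseteq> Q. prod a Q * z Q)"

text \<open>One weight is tested against a second density \<open>g * \<gamma>\<close>. Taking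
  \<open>\<gamma> = 1\<close> gives the count of integers, another \<open>\<gamma>\<close> the count
  of primes, both in the same variables \<open>z\<close>.\<close>

lemma sieve_weight_quadratic_form:
  fixes g \<gamma> a h :: "'a \<Rightarrow> real"
  assumes nz: "\<And>p S. S \<in> F \<Longrightarrow> p \<in> S \<Longrightarrow> g p \<noteq> 0 \<and> \<gamma> p \<noteq> 0"
    and h: "\<And>p S. S \<in> F \<Longrightarrow> p \<in> S \<Longrightarrow> h p = 1 / (g p * \<gamma> p) - 1"
  shows "(\<Sum>D\<in>F. \<Sum>E\<in>F. sieve_weight g a z D * sieve_weight g a z E * prod (\<lambda>p. g p * \<gamma> p) (D \<union> E))
    = (\<Sum>S\<in>F. (\<Prod>p\<in>S. h p * (\<gamma> p * a p)\<^sup>2) *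
        (\<Sum>T | S \<inter> T = {} \<and> S \<union> T \<in> F. prod (\<lambda>p. a p * (1 - \<gamma> p)) T * z (S \<union> T))\<^sup>2)"
proof -
  have "(\<Sum>D\<in>F. \<Sum>E\<in>F. sieve_weight g a z D * sieve_weight g a z E * prod (\<lambda>p. g p * \<gamma> p) (D \<union> E))
     = (\<Sum>S\<in>F. prod h S * (\<Sum>D | D \<in> F \<and> S \<subseteq> D. sieve_weight g a z D * prod (\<lambda>p. g p * \<gamma> p) D)\<^sup>2)"
    by (rule quadratic_form_diagonal) (use nz h in auto)
  also have "\<dots> = (\<Sum>S\<in>F. prod h S * (prod (\<lambda>p. - \<gamma> p) S * prod a S *
         (\<Sum>T | S \<inter> T = {} \<and> S \<union> T \<in> F. prod (\<lambda>p. a p * (1 - \<gamma> p)) T * z (S \<union> T)))\<^sup>2)"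
  proof (rule sum.cong[OF refl])
    fix S assume S: "S \<in> F"
    have "(\<Sum>D | D \<in> F \<and> S \<subseteq> D. sieve_weight g a z D * prod (\<lambda>p. g p * \<gamma> p) D)
       = (\<Sum>D | D \<in> F \<and> S \<subseteq> D. prod (\<lambda>p. - \<gamma> p) D * (\<Sum>Q | Q \<in> F \<and> D \<subseteq> Q. prod a Q * z Q))"
    proof (rule sum.cong[OF refl], goal_cases)
      case (1 D)
      have "(\<Prod>p\<in>D. - 1 / g p) * prod (\<lambda>p. g p * \<gamma> p) D = prod (\<lambda>p. - \<gamma> p) D"
        unfolding prod.distrib[symmetric] by (intro prod.cong) (use nz 1 in auto)
      then show ?case unfolding sieve_weight_def by (simp add: mult_ac)
    qed
    then show "prod h S * (\<Sum>D | D \<in> F \<and> S \<subseteq> D. sieve_weight g a z D * prod (\<lambda>p. g p * \<gamma> p) D)\<^sup>2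
      = prod h S * (prod (\<lambda>p. - \<gamma> p) S * prod a S *
         (\<Sum>T | S \<inter> T = {} \<and> S \<union> T \<in> F. prod (\<lambda>p. a p * (1 - \<gamma> p)) T * z (S \<union> T)))\<^sup>2"
      using sum_multiples_eq[OF S, of \<gamma> a z] by simp
  qed
  also have "\<dots> = (\<Sum>S\<in>F. (\<Prod>p\<in>S. h p * (\<gamma> p * a p)\<^sup>2) *
        (\<Sum>T | S \<inter> T = {} \<and> S \<union> T \<in> F. prod (\<lambda>p. a p * (1 - \<gamma> p)) T * z (S \<union> T))\<^sup>2)"
  proof (rule sum.cong[OF refl], goal_cases)
    case (1 S)
    have "prod h S * (prod (\<lambda>p. - \<gamma> p) S * prod a S)\<^sup>2 = (\<Prod>p\<in>S. h p * (\<gamma> p * a p)\<^sup>2)"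
      by (simp add: prod.distrib[symmetric] prod_power_distrib power_mult_distrib)
    then show ?case by (simp add: power_mult_distrib mult.assoc)
  qed
  finally show ?thesis .
qed

end

section \<open>Squarefree numbers as sets of primes\<close>

text \<open>A squarefree number all of whose prime factors exceed \<open>B\<close> is represented by the set of these
  factors, so that divisibility, gcd and lcm become inclusion, intersection and union; sizes are
  measured on the logarithmic scale, \<open>L = log R\<close>.\<close>

definition lnsum :: "nat set \<Rightarrow> real" where
  "lnsum S = (\<Sum>p\<in>S. ln (real p))"

definition prime_sets :: "nat \<Rightarrow> real \<Rightarrow> nat set set" where
  "prime_sets B L = {S. finite S \<and> (\<forall>p\<in>S. prime p \<and> B < p) \<and> lnsum S \<le> L}"

definition prime_pairs :: "nat \<Rightarrow> real \<Rightarrow> (nat set \<times> nat set) set" where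
  "prime_pairs B L = {(S, T). S \<inter> T = {} \<and> S \<union> T \<in> prime_sets B L}"

definition new_primes :: "nat \<Rightarrow> real \<Rightarrow> nat set \<Rightarrow> nat set" where
  "new_primes B L U = {p. prime p \<and> B < p \<and> p \<notin> U \<and> ln (real p) \<le> L - lnsum U}"

lemma lnsum_empty [simp]: "lnsum {} = 0"
  by (simp add: lnsum_def)

lemma lnsum_insert: "finite S \<Longrightarrow> p \<notin> S \<Longrightarrow> lnsum (insert p S) = ln (real p) + lnsum S"
  by (simp add: lnsum_def)

lemma lnsum_Un: "finite S \<Longrightarrow> finite T \<Longrightarrow> S \<inter> T = {} \<Longrightarrow> lnsum (S \<union> T) = lnsum S + lnsum T"
  by (simp add: lnsum_def sum.union_disjoint)

lemma prime_ln_pos: "prime p \<Longrightarrow> 0 < ln (real p)"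
  using prime_gt_1_nat[of p] by simp

lemma lnsum_nonneg: "(\<And>p. p \<in> S \<Longrightarrow> prime p) \<Longrightarrow> 0 \<le> lnsum S"
  unfolding lnsum_def by (intro sum_nonneg) (simp add: prime_ln_pos less_imp_le)

lemma lnsum_mono: "finite S \<Longrightarrow> (\<And>p. p \<in> S \<Longrightarrow> prime p) \<Longrightarrow> T \<subseteq> S \<Longrightarrow> lnsum T \<le> lnsum S"
  unfolding lnsum_def by (rule sum_mono2) (auto simp: prime_ln_pos less_imp_le)

lemma prime_setsD:
  assumes "S \<in> prime_sets B L"
  shows "finite S" "\<And>p. p \<in> S \<Longrightarrow> prime p" "\<And>p. p \<in> S \<Longrightarrow> B < p" "lnsum S \<le> L" "0 \<le> lnsum S"
  using assms lnsum_nonneg[of S] by (auto simp: prime_sets_def)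

lemma prime_sets_subset: "S \<in> prime_sets B L \<Longrightarrow> T \<subseteq> S \<Longrightarrow> T \<in> prime_sets B L"
  using lnsum_mono[of S T] by (auto simp: prime_sets_def intro: finite_subset)

lemma empty_in_prime_sets [simp]: "{} \<in> prime_sets B L \<longleftrightarrow> 0 \<le> L"
  by (simp add: prime_sets_def)

lemma ln_le_imp_le_nat_floor_exp: "prime p \<Longrightarrow> ln (real p) \<le> L \<Longrightarrow> p \<le> nat \<lfloor>exp L\<rfloor>"
proof -
  assume p: "prime p" "ln (real p) \<le> L"
  then have "real p \<le> exp L" using prime_gt_0_nat[of p]
    by (metis exp_le_cancel_iff exp_ln of_nat_0_less_iff)
  then show ?thesis by linarith
qed

lemma finite_primes_ln_le: "finite {p. prime p \<and> ln (real p) \<le> L}"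
  by (rule finite_subset[of _ "{..nat \<lfloor>exp L\<rfloor>}"]) (auto intro: ln_le_imp_le_nat_floor_exp)

lemma finite_prime_sets: "finite (prime_sets B L)"
proof (rule finite_subset)
  show "prime_sets B L \<subseteq> Pow {p. prime p \<and> ln (real p) \<le> L}"
  proof
    fix S assume S: "S \<in> prime_sets B L"
    note D = prime_setsD[OF S]
    have "ln (real p) \<le> L" if "p \<in> S" for p
      using lnsum_mono[of S "{p}"] D that by (simp add: lnsum_def)
    then show "S \<in> Pow {p. prime p \<and> ln (real p) \<le> L}" using D by auto
  qed
qed (simp add: finite_primes_ln_le)

lemma finite_prime_pairs: "finite (prime_pairs B L)"
proof (rule finite_subset)
  show "prime_pairs B L \<subseteq> prime_sets B L \<times> prime_sets B L"
    by (auto simp: prime_pairs_def intro: prime_sets_subset)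
qed (simp add: finite_prime_sets)

lemma finite_new_primes: "finite (new_primes B L U)"
  by (rule finite_subset[OF _ finite_primes_ln_le[of "L - lnsum U"]]) (auto simp: new_primes_def)

lemma prime_pairsD:
  assumes "(S, T) \<in> prime_pairs B L"
  shows "finite S" "finite T" "\<And>p. p \<in> S \<Longrightarrow> prime p \<and> B < p" "\<And>p. p \<in> T \<Longrightarrow> prime p \<and> B < p"
    "S \<inter> T = {}" "lnsum S + lnsum T \<le> L" "0 \<le> lnsum S" "0 \<le> lnsum T"
    "lnsum (S \<union> T) = lnsum S + lnsum T"
proof -
  have "S \<union> T \<in> prime_sets B L" "S \<inter> T = {}" using assms by (auto simp: prime_pairs_def)
  note D = prime_setsD[OF this(1)] and this
  then show "finite S" "finite T" "\<And>p. p \<in> S \<Longrightarrow> prime p \<and> B < p"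
    "\<And>p. p \<in> T \<Longrightarrow> prime p \<and> B < p" "S \<inter> T = {}"
    by auto
  then show "lnsum (S \<union> T) = lnsum S + lnsum T" by (simp add: lnsum_Un)
  then show "lnsum S + lnsum T \<le> L" using D by simp
  show "0 \<le> lnsum S" "0 \<le> lnsum T" by (rule lnsum_nonneg; use D in auto)+
qed

text \<open>Identifies \<open>new_primes\<close> as the primes by which a component can be enlarged
  within the support, so that deleting and inserting a prime are inverse operations.\<close>

lemma insert_prime_pairs_iff:
  assumes "p \<notin> T"
  shows "(S, insert p T) \<in> prime_pairs B L \<longleftrightarrow>
    (S, T) \<in> prime_pairs B L \<and> p \<in> new_primes B L (S \<union> T)" (is "?A \<longleftrightarrow> ?B")
proof
  assume A: ?A
  then have *: "S \<inter> insert p T = {}" "insert p (S \<union> T) \<in> prime_sets B L"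
    by (auto simp: prime_pairs_def)
  then have "S \<union> T \<in> prime_sets B L" by (blast intro: prime_sets_subset)
  moreover have "p \<notin> S \<union> T" using * assms by auto
  moreover have "ln (real p) + lnsum (S \<union> T) \<le> L"
    using prime_setsD[OF *(2)] lnsum_insert[of "S \<union> T" p] \<open>p \<notin> S \<union> T\<close> by simp
  ultimately show ?B using * prime_setsD[OF *(2)]
    by (auto simp: prime_pairs_def new_primes_def)
next
  assume B: ?B
  then have "S \<union> T \<in> prime_sets B L" "S \<inter> T = {}" "p \<notin> S \<union> T"
    by (auto simp: prime_pairs_def new_primes_def)
  with B prime_setsD[OF this(1)] show ?A
    by (auto simp: prime_pairs_def new_primes_def prime_sets_def lnsum_insert)
qed

lemma sum_pairs_swap:
  "(\<Sum>x\<in>prime_pairs B L. f (fst x) (snd x)) = (\<Sum>x\<in>prime_pairs B L. f (snd x) (fst x))"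
  by (rule sum.reindex_bij_witness[of _ prod.swap prod.swap])
     (auto simp: prime_pairs_def Un_commute Int_commute)

text \<open>Double counting of pairs with a marked prime \<open>p\<close> in the second component:
  deleting \<open>p\<close> leaves a pair that has \<open>p\<close> among its
  \<open>new_primes\<close>, and the factor \<open>\<beta> p\<close> leaves the product.\<close>

lemma sum_pull_prime:
  fixes \<alpha> \<beta> c :: "nat \<Rightarrow> real"
  shows "(\<Sum>x\<in>prime_pairs B L. prod \<alpha> (fst x) * prod \<beta> (snd x) * ((\<Sum>p\<in>snd x. c p) * F (fst x) (snd x)))
    = (\<Sum>x\<in>prime_pairs B L. prod \<alpha> (fst x) * prod \<beta> (snd x) *
        (\<Sum>p\<in>new_primes B L (fst x \<union> snd x). \<beta> p * c p * F (fst x) (insert p (snd x))))"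
proof -
  have "(\<Sum>x\<in>prime_pairs B L. prod \<alpha> (fst x) * prod \<beta> (snd x) * ((\<Sum>p\<in>snd x. c p) * F (fst x) (snd x)))
    = (\<Sum>x\<in>prime_pairs B L. \<Sum>p\<in>snd x. prod \<alpha> (fst x) * prod \<beta> (snd x) * (c p * F (fst x) (snd x)))"
    by (simp add: sum_distrib_left sum_distrib_right)
  also have "\<dots> = (\<Sum>(x, p)\<in>Sigma (prime_pairs B L) snd.
      prod \<alpha> (fst x) * prod \<beta> (snd x) * (c p * F (fst x) (snd x)))"
    by (rule sum.Sigma) (auto simp: finite_prime_pairs dest: prime_pairsD)
  also have "\<dots> = (\<Sum>(x, p)\<in>Sigma (prime_pairs B L) (\<lambda>x. new_primes B L (fst x \<union> snd x)).
      prod \<alpha> (fst x) * prod \<beta> (snd x) * (\<beta> p * c p * F (fst x) (insert p (snd x))))"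
  proof (rule sum.reindex_bij_witness[of _
      "\<lambda>(x, p). ((fst x, insert p (snd x)), p)" "\<lambda>(x, p). ((fst x, snd x - {p}), p)"], goal_cases)
    case (2 y)
    then obtain S T p where y: "y = ((S, T), p)" "(S, T) \<in> prime_pairs B L" "p \<in> T" by auto
    then have "insert p (T - {p}) = T" by auto
    then have "(S, T - {p}) \<in> prime_pairs B L \<and> p \<in> new_primes B L (S \<union> (T - {p}))"
      using insert_prime_pairs_iff[of p "T - {p}" S B L] y by simp
    then show ?case using y by simp
  next
    case (4 y)
    then obtain S T p where y: "y = ((S, T), p)" "(S, T) \<in> prime_pairs B L" "p \<in> new_primes B L (S \<union> T)"
      by auto
    then have "p \<notin> T" by (simp add: new_primes_def)
    then show ?case using insert_prime_pairs_iff[of p T S B L] y by simp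
  next
    case (5 y)
    then obtain S T p where y: "y = ((S, T), p)" "(S, T) \<in> prime_pairs B L" "p \<in> T" by auto
    have "prod \<beta> T = \<beta> p * prod \<beta> (T - {p})"
      using y prime_pairsD[OF y(2)] by (simp add: prod.remove)
    moreover have "insert p (T - {p}) = T" using y by auto
    ultimately show ?case using y by (simp add: mult_ac)
  qed (auto simp: new_primes_def)
  also have "\<dots> = (\<Sum>x\<in>prime_pairs B L. \<Sum>p\<in>new_primes B L (fst x \<union> snd x).
      prod \<alpha> (fst x) * prod \<beta> (snd x) * (\<beta> p * c p * F (fst x) (insert p (snd x))))"
    by (rule sum.Sigma[symmetric]) (auto simp: finite_prime_pairs finite_new_primes)
  finally show ?thesis by (simp add: sum_distrib_left)
qed

lemma sum_pull_prime_fst: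
  fixes \<alpha> \<beta> c :: "nat \<Rightarrow> real"
  shows "(\<Sum>x\<in>prime_pairs B L. prod \<alpha> (fst x) * prod \<beta> (snd x) * ((\<Sum>p\<in>fst x. c p) * F (fst x) (snd x)))
    = (\<Sum>x\<in>prime_pairs B L. prod \<alpha> (fst x) * prod \<beta> (snd x) *
        (\<Sum>p\<in>new_primes B L (fst x \<union> snd x). \<alpha> p * c p * F (insert p (fst x)) (snd x)))"
proof -
  have "(\<Sum>x\<in>prime_pairs B L. prod \<alpha> (fst x) * prod \<beta> (snd x) * ((\<Sum>p\<in>fst x. c p) * F (fst x) (snd x)))
      = (\<Sum>x\<in>prime_pairs B L. prod \<beta> (fst x) * prod \<alpha> (snd x) * ((\<Sum>p\<in>snd x. c p) * F (snd x) (fst x)))"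
    by (subst sum_pairs_swap) (simp add: mult_ac)
  also have "\<dots> = (\<Sum>x\<in>prime_pairs B L. prod \<beta> (fst x) * prod \<alpha> (snd x) *
        (\<Sum>p\<in>new_primes B L (fst x \<union> snd x). \<alpha> p * c p * F (insert p (snd x)) (fst x)))"
    by (rule sum_pull_prime[where F = "\<lambda>S T. F T S"])
  also have "\<dots> = (\<Sum>x\<in>prime_pairs B L. prod \<alpha> (fst x) * prod \<beta> (snd x) *
        (\<Sum>p\<in>new_primes B L (fst x \<union> snd x). \<alpha> p * c p * F (insert p (fst x)) (snd x)))"
    by (subst sum_pairs_swap) (simp add: mult_ac Un_commute)
  finally show ?thesis .
qed

section \<open>Partial summation by repeated integration\<close>

lemma has_integral_truncated_power:
  fixes l V :: real
  assumes "0 \<le> l" "l \<le> V"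
  shows "((\<lambda>s. if l \<le> s then (s - l) ^ j else 0) has_integral (V - l) ^ Suc j / real (Suc j)) {0..V}"
proof -
  have "((\<lambda>s. (s - l) ^ j) has_integral ((V - l) ^ Suc j / real (Suc j) - (l - l) ^ Suc j / real (Suc j))) {l..V}"
  proof (rule fundamental_theorem_of_calculus[OF assms(2)])
    fix x assume "x \<in> {l..V}"
    have "((\<lambda>s. (s - l) ^ Suc j / real (Suc j)) has_real_derivative (x - l) ^ j) (at x within {l..V})"
      by (auto intro!: derivative_eq_intros simp del: power_Suc)
    then show "((\<lambda>s. (s - l) ^ Suc j / real (Suc j)) has_vector_derivative (x - l) ^ j) (at x within {l..V})"
      by (rule has_real_derivative_iff_has_vector_derivative[THEN iffD1])
  qed
  then have "((\<lambda>s. (s - l) ^ j) has_integral (V - l) ^ Suc j / real (Suc j)) {l..V}" by simp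
  then have "((\<lambda>s. if s \<in> {l..V} then (s - l) ^ j else 0) has_integral (V - l) ^ Suc j / real (Suc j)) {0..V}"
    by (subst has_integral_restrict) (use assms in auto)
  then show ?thesis
    by (rule has_integral_eq[rotated]) auto
qed

text \<open>Integrating the estimate for the exponent \<open>j\<close> over \<open>0..V\<close>
  raises the exponent by one, by \<open>has_integral_truncated_power\<close>. Main term, sum and
  bound all acquire the same factor \<open>1 / (j + 1)\<close>, so one constant \<open>D\<close>
  serves every \<open>j\<close>.\<close>

lemma sum_power_weight_bound:
  fixes c l :: "nat \<Rightarrow> real"
  assumes fin: "\<And>V. finite {p \<in> P. l p \<le> V}"
    and pos: "\<And>p. p \<in> P \<Longrightarrow> 0 \<le> l p"
    and D: "\<And>V. 0 \<le> V \<Longrightarrow> V \<le> V0 \<Longrightarrow> \<bar>(\<Sum>p | p \<in> P \<and> l p \<le> V. c p) - \<kappa> * V\<bar> \<le> D"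
  shows "0 \<le> V \<Longrightarrow> V \<le> V0 \<Longrightarrow>
    \<bar>(\<Sum>p | p \<in> P \<and> l p \<le> V. c p * (V - l p) ^ j) - \<kappa> * V ^ Suc j / real (Suc j)\<bar> \<le> D * V ^ j"
proof (induction j arbitrary: V)
  case 0
  then show ?case using D by simp
next
  case (Suc j)
  define S where "S = (\<lambda>s. \<Sum>p | p \<in> P \<and> l p \<le> s. c p * (s - l p) ^ j)"
  have I1: "(S has_integral (\<Sum>p | p \<in> P \<and> l p \<le> V. c p * ((V - l p) ^ Suc j / real (Suc j)))) {0..V}"
  proof (rule has_integral_eq[rotated])
    show "((\<lambda>s. \<Sum>p | p \<in> P \<and> l p \<le> V. c p * (if l p \<le> s then (s - l p) ^ j else 0)) has_integral
       (\<Sum>p | p \<in> P \<and> l p \<le> V. c p * ((V - l p) ^ Suc j / real (Suc j)))) {0..V}"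
      by (intro has_integral_sum has_integral_mult_right has_integral_truncated_power)
         (auto simp: fin pos)
  next
    fix s assume s: "s \<in> {0..V}"
    have "(\<Sum>p | p \<in> P \<and> l p \<le> V. c p * (if l p \<le> s then (s - l p) ^ j else 0))
        = (\<Sum>p | p \<in> P \<and> l p \<le> V. if l p \<le> s then c p * (s - l p) ^ j else 0)"
      by (intro sum.cong) auto
    also have "\<dots> = S s"
      unfolding S_def using s fin[of V]
      by (subst sum.inter_filter[symmetric]) (auto intro!: sum.cong)
    finally show "(\<Sum>p | p \<in> P \<and> l p \<le> V. c p * (if l p \<le> s then (s - l p) ^ j else 0)) = S s" .
  qed
  have pw: "((\<lambda>s. s ^ n) has_integral V ^ Suc n / real (Suc n)) {0..V}" for n
  proof (rule has_integral_eq)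
    show "((\<lambda>s. if 0 \<le> s then (s - 0) ^ n else 0) has_integral V ^ Suc n / real (Suc n)) {0..V}"
      using has_integral_truncated_power[of 0 V n] Suc.prems by simp
  qed auto
  have I2: "((\<lambda>s. \<kappa> * (s ^ Suc j / real (Suc j))) has_integral
      \<kappa> * (V ^ Suc (Suc j) / real (Suc (Suc j)) / real (Suc j))) {0..V}"
    by (intro has_integral_mult_right has_integral_divide pw)
  have I3: "((\<lambda>s. D * s ^ j) has_integral D * (V ^ Suc j / real (Suc j))) {0..V}"
    by (intro has_integral_mult_right pw)
  have "norm (integral {0..V} (\<lambda>s. S s - \<kappa> * (s ^ Suc j / real (Suc j)))) \<le> integral {0..V} (\<lambda>s. D * s ^ j)"
  proof (rule integral_norm_bound_integral)
    show "(\<lambda>s. S s - \<kappa> * (s ^ Suc j / real (Suc j))) integrable_on {0..V}"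
      using has_integral_diff[OF I1 I2] by blast
    show "(\<lambda>s. D * s ^ j) integrable_on {0..V}" using I3 by blast
    show "norm (S s - \<kappa> * (s ^ Suc j / real (Suc j))) \<le> D * s ^ j" if "s \<in> {0..V}" for s
      using Suc.IH[of s] that Suc.prems unfolding S_def by simp
  qed
  then have *: "\<bar>(\<Sum>p | p \<in> P \<and> l p \<le> V. c p * ((V - l p) ^ Suc j / real (Suc j)))
      - \<kappa> * (V ^ Suc (Suc j) / real (Suc (Suc j)) / real (Suc j))\<bar> \<le> D * (V ^ Suc j / real (Suc j))"
    using integral_unique[OF has_integral_diff[OF I1 I2]] integral_unique[OF I3] by simp
  define X where "X = (\<Sum>p | p \<in> P \<and> l p \<le> V. c p * (V - l p) ^ Suc j) - \<kappa> * V ^ Suc (Suc j) / real (Suc (Suc j))"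
  have "(\<Sum>p | p \<in> P \<and> l p \<le> V. c p * ((V - l p) ^ Suc j / real (Suc j)))
      - \<kappa> * (V ^ Suc (Suc j) / real (Suc (Suc j)) / real (Suc j)) = X / real (Suc j)"
    unfolding X_def by (simp only: sum_divide_distrib times_divide_eq_right diff_divide_distrib)
  with * have "\<bar>X\<bar> / real (Suc j) \<le> D * V ^ Suc j / real (Suc j)"
    by (simp only: abs_divide times_divide_eq_right abs_of_nat)
  then have "\<bar>X\<bar> \<le> D * V ^ Suc j"
    by (subst (asm) divide_le_cancel) simp
  then show ?case unfolding X_def .
qed

section \<open>Moments of the measure on pairs\<close>

lemma ln_le_2_sqrt:
  fixes x :: real assumes "0 < x" shows "ln x \<le> 2 * sqrt x"
proof -
  have "ln x = 2 * ln (sqrt x)" using assms by (simp add: ln_sqrt)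
  also have "\<dots> \<le> 2 * sqrt x" using ln_le_minus_one[of "sqrt x"] assms by simp
  finally show ?thesis .
qed

lemma sum_ln_over_square_bounded:
  obtains C :: real where "0 < C" "\<And>A. finite A \<Longrightarrow> (\<Sum>n\<in>A. ln (real n) / real n ^ 2) \<le> C"
proof -
  have s: "summable (\<lambda>n. 2 * real n powr (-(3/2)))"
    by (intro summable_mult) (simp add: summable_real_powr_iff)
  have le: "ln (real n) / real n ^ 2 \<le> 2 * real n powr (-(3/2))" for n
  proof (cases "n = 0")
    case False
    then have n: "0 < real n" by simp
    have "ln (real n) / real n ^ 2 \<le> 2 * sqrt (real n) / real n ^ 2"
      by (intro divide_right_mono ln_le_2_sqrt n) simp
    also have "\<dots> = 2 * (real n powr (1/2) / real n powr 2)"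
      using n by (simp add: powr_half_sqrt)
    also have "real n powr (1/2) / real n powr 2 = real n powr (-(3/2))"
      by (subst powr_diff[symmetric]) simp
    finally show ?thesis .
  qed auto
  have "(\<Sum>n\<in>A. ln (real n) / real n ^ 2) \<le> suminf (\<lambda>n. 2 * real n powr (-(3/2))) + 1" if "finite A" for A
  proof -
    have "(\<Sum>n\<in>A. ln (real n) / real n ^ 2) \<le> (\<Sum>n\<in>A. 2 * real n powr (-(3/2)))"
      by (intro sum_mono le)
    also have "\<dots> \<le> suminf (\<lambda>n. 2 * real n powr (-(3/2)))"
      by (rule sum_le_suminf[OF s that]) auto
    finally show ?thesis by simp
  qed
  moreover have "0 \<le> suminf (\<lambda>n. 2 * real n powr (-(3/2)))"
    by (rule suminf_nonneg[OF s]) auto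
  ultimately show ?thesis using that[of "suminf (\<lambda>n. 2 * real n powr (-(3/2))) + 1"] by auto
qed

lemma ln_over_nonneg: "0 \<le> ln (real n) / real n"
  by (cases "n = 0") auto

text \<open>Mertens' first theorem, on the logarithmic scale and with a weaker error term that already
  follows from the prime number theorem.\<close>

definition mertens :: bool where
  "mertens \<longleftrightarrow> (\<forall>\<epsilon>>0. \<exists>C. \<forall>x\<ge>0.
     \<bar>(\<Sum>p | prime p \<and> ln (real p) \<le> x. ln (real p) / real p) - x\<bar> \<le> \<epsilon> * x + C)"

text \<open>\<open>\<kappa>\<close> is the sieve dimension of \<open>b\<close>. The quadratic error
  is small enough to sum to a bounded amount even after weighting by \<open>ln p\<close>.\<close>

definition density :: "nat \<Rightarrow> (nat \<Rightarrow> real) \<Rightarrow> real \<Rightarrow> bool" where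
  "density B b \<kappa> \<longleftrightarrow> 0 \<le> \<kappa> \<and> (\<forall>p. prime p \<and> B < p \<longrightarrow> 0 \<le> b p) \<and>
     (\<exists>C\<ge>0. \<forall>p. prime p \<and> B < p \<longrightarrow> \<bar>b p - \<kappa> / real p\<bar> \<le> C / real p ^ 2)"

lemma density_le:
  assumes "density B b \<kappa>"
  obtains C where "0 \<le> C" "\<And>p. prime p \<Longrightarrow> B < p \<Longrightarrow> b p \<le> C / real p"
proof -
  obtain C where C: "0 \<le> C" "\<And>p. prime p \<Longrightarrow> B < p \<Longrightarrow> \<bar>b p - \<kappa> / real p\<bar> \<le> C / real p ^ 2"
    and k: "0 \<le> \<kappa>"
    using assms unfolding density_def by blast
  have "b p \<le> (\<kappa> + C) / real p" if p: "prime p" "B < p" for p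
  proof -
    have "1 \<le> real p" using prime_ge_1_nat[OF p(1)] by simp
    then have "real p * 1 \<le> real p * real p" by (intro mult_left_mono) auto
    then have "C / real p ^ 2 \<le> C / real p"
      using C(1) \<open>1 \<le> real p\<close> by (intro divide_left_mono) (auto simp: power2_eq_square)
    then show ?thesis using C(2)[OF p] by (simp add: add_divide_distrib)
  qed
  then show ?thesis using that[of "\<kappa> + C"] C k by auto
qed

lemma density_prime_sum:
  assumes M: mertens and d: "density B b \<kappa>" and \<epsilon>: "0 < \<epsilon>"
  shows "\<exists>C\<ge>0. \<forall>x\<ge>0. \<bar>(\<Sum>p | prime p \<and> B < p \<and> ln (real p) \<le> x. b p * ln (real p)) - \<kappa> * x\<bar> \<le> \<epsilon> * x + C"
proof -
  obtain C1 where k: "0 \<le> \<kappa>" and C1: "0 \<le> C1" "\<And>p. prime p \<Longrightarrow> B < p \<Longrightarrow> \<bar>b p - \<kappa> / real p\<bar> \<le> C1 / real p ^ 2"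
    using d unfolding density_def by blast
  obtain C2 where C2: "0 < C2" "\<And>A. finite A \<Longrightarrow> (\<Sum>n\<in>A. ln (real n) / real n ^ 2) \<le> C2"
    using sum_ln_over_square_bounded by blast
  \<comment> \<open>The tolerance is divided by \<open>\<kappa> + 1\<close> so that it stays below
    \<open>\<epsilon>\<close> after multiplication by \<open>\<kappa>\<close>, with
    \<open>\<kappa> = 0\<close> included.\<close>
  obtain C3 where C3: "\<And>x. 0 \<le> x \<Longrightarrow>
     \<bar>(\<Sum>p | prime p \<and> ln (real p) \<le> x. ln (real p) / real p) - x\<bar> \<le> \<epsilon> / (\<kappa> + 1) * x + C3"
    using M \<epsilon> k unfolding mertens_def by (metis add_nonneg_pos divide_pos_pos less_numeral_extra(1))
  have C3': "0 \<le> C3" using C3[of 0] by linarith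
  define C4 where "C4 = (\<Sum>p\<in>{..B}. ln (real p) / real p)"
  have "\<bar>(\<Sum>p | prime p \<and> B < p \<and> ln (real p) \<le> x. b p * ln (real p)) - \<kappa> * x\<bar>
      \<le> \<epsilon> * x + (C1 * C2 + \<kappa> * C3 + \<kappa> * C4)" if x: "0 \<le> x" for x
  proof -
    define P where "P = {p. prime p \<and> ln (real p) \<le> x}"
    define P1 where "P1 = {p. prime p \<and> B < p \<and> ln (real p) \<le> x}"
    have fin: "finite P" "finite P1" "P1 \<subseteq> P"
      unfolding P_def P1_def using finite_primes_ln_le[of x] by (auto elim: rev_finite_subset)
    have e1: "\<bar>(\<Sum>p\<in>P1. b p * ln (real p)) - \<kappa> * (\<Sum>p\<in>P1. ln (real p) / real p)\<bar> \<le> C1 * C2"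
    proof -
      have "(\<Sum>p\<in>P1. b p * ln (real p)) - \<kappa> * (\<Sum>p\<in>P1. ln (real p) / real p)
         = (\<Sum>p\<in>P1. (b p - \<kappa> / real p) * ln (real p))"
        by (simp add: sum_distrib_left sum_subtractf left_diff_distrib)
      also have "\<bar>\<dots>\<bar> \<le> (\<Sum>p\<in>P1. \<bar>(b p - \<kappa> / real p) * ln (real p)\<bar>)" by (rule sum_abs)
      also have "\<dots> \<le> (\<Sum>p\<in>P1. C1 * (ln (real p) / real p ^ 2))"
      proof (rule sum_mono)
        fix p assume "p \<in> P1"
        then have p: "prime p" "B < p" by (auto simp: P1_def)
        have "\<bar>(b p - \<kappa> / real p) * ln (real p)\<bar> = \<bar>b p - \<kappa> / real p\<bar> * ln (real p)"
          using prime_ln_pos[OF p(1)] by (simp add: abs_mult)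
        also have "\<dots> \<le> C1 / real p ^ 2 * ln (real p)"
          by (intro mult_right_mono C1(2) p) (use prime_ln_pos[OF p(1)] in auto)
        finally show "\<bar>(b p - \<kappa> / real p) * ln (real p)\<bar> \<le> C1 * (ln (real p) / real p ^ 2)" by simp
      qed
      also have "\<dots> \<le> C1 * C2"
        unfolding sum_distrib_left[symmetric] by (intro mult_left_mono C2(2) fin C1(1))
      finally show ?thesis .
    qed
    have e2: "\<bar>(\<Sum>p\<in>P1. ln (real p) / real p) - (\<Sum>p\<in>P. ln (real p) / real p)\<bar> \<le> C4"
    proof -
      have "(\<Sum>p\<in>P. ln (real p) / real p) = (\<Sum>p\<in>P - P1. ln (real p) / real p) + (\<Sum>p\<in>P1. ln (real p) / real p)"
        using fin by (metis sum.subset_diff)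
      moreover have "(\<Sum>p\<in>P - P1. ln (real p) / real p) \<le> C4"
        unfolding C4_def by (rule sum_mono2) (auto simp: P_def P1_def simp del: zero_le_divide_iff intro: ln_over_nonneg)
      moreover have "0 \<le> (\<Sum>p\<in>P - P1. ln (real p) / real p)"
        by (rule sum_nonneg) (auto simp: P_def dest: prime_ln_pos)
      ultimately show ?thesis by linarith
    qed
    have e3: "\<bar>(\<Sum>p\<in>P. ln (real p) / real p) - x\<bar> \<le> \<epsilon> / (\<kappa> + 1) * x + C3"
      unfolding P_def by (rule C3[OF x])
    have "\<bar>(\<Sum>p\<in>P1. ln (real p) / real p) - x\<bar> \<le> \<epsilon> / (\<kappa> + 1) * x + C3 + C4"
      using e2 e3 by linarith
    then have "\<kappa> * \<bar>(\<Sum>p\<in>P1. ln (real p) / real p) - x\<bar> \<le> \<kappa> * (\<epsilon> / (\<kappa> + 1) * x + C3 + C4)"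
      by (rule mult_left_mono[OF _ k])
    also have "\<dots> \<le> \<epsilon> * x + \<kappa> * C3 + \<kappa> * C4"
    proof -
      have "\<kappa> / (\<kappa> + 1) * (\<epsilon> * x) \<le> 1 * (\<epsilon> * x)"
        using k x \<epsilon> by (intro mult_right_mono) (auto simp: field_simps)
      then show ?thesis by (simp add: algebra_simps)
    qed
    finally have "\<bar>\<kappa> * (\<Sum>p\<in>P1. ln (real p) / real p) - \<kappa> * x\<bar> \<le> \<epsilon> * x + \<kappa> * C3 + \<kappa> * C4"
      using k by (simp add: abs_mult[of \<kappa>, symmetric, unfolded abs_of_nonneg] right_diff_distrib[symmetric] abs_mult)
    then show ?thesis using e1 unfolding P1_def by linarith
  qed
  moreover have "0 \<le> C4" unfolding C4_def
    by (intro sum_nonneg ln_over_nonneg)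
  ultimately show ?thesis using C1 C2 C3' k
    by (intro exI[of _ "C1 * C2 + \<kappa> * C3 + \<kappa> * C4"]) (auto intro!: add_nonneg_nonneg mult_nonneg_nonneg)
qed

section \<open>Averages over pairs of coprime squarefree numbers\<close>

locale pair_moments =
  fixes B :: nat and \<alpha> \<beta> :: "nat \<Rightarrow> real" and \<kappa>\<^sub>\<alpha> \<kappa>\<^sub>\<beta> :: real
  assumes dens_\<alpha>: "density B \<alpha> \<kappa>\<^sub>\<alpha>" and dens_\<beta>: "density B \<beta> \<kappa>\<^sub>\<beta>" and M: mertens
begin

definition wt :: "nat set \<times> nat set \<Rightarrow> real" where
  "wt x = prod \<alpha> (fst x) * prod \<beta> (snd x)"

definition mass :: "real \<Rightarrow> real" where
  "mass L = (\<Sum>x\<in>prime_pairs B L. wt x)"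

definition avg :: "real \<Rightarrow> (nat set \<times> nat set \<Rightarrow> real) \<Rightarrow> real" where
  "avg L f = (\<Sum>x\<in>prime_pairs B L. wt x * f x) / mass L"

text \<open>The share of the logarithmic budget \<open>L\<close> that is still free; together with
  \<open>spart\<close> and \<open>tpart\<close> it makes up 1, which drives the moment
  recursion.\<close>

definition vpart :: "real \<Rightarrow> nat set \<times> nat set \<Rightarrow> real" where
  "vpart L x = (L - lnsum (fst x \<union> snd x)) / L"

definition tpart :: "real \<Rightarrow> nat set \<times> nat set \<Rightarrow> real" where
  "tpart L x = lnsum (snd x) / L"

definition spart :: "real \<Rightarrow> nat set \<times> nat set \<Rightarrow> real" where
  "spart L x = lnsum (fst x) / L"

lemma nonneg: "prime p \<Longrightarrow> B < p \<Longrightarrow> 0 \<le> \<alpha> p" "prime p \<Longrightarrow> B < p \<Longrightarrow> 0 \<le> \<beta> p"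
  using dens_\<alpha> dens_\<beta> by (auto simp: density_def)

lemma wt_nonneg: "x \<in> prime_pairs B L \<Longrightarrow> 0 \<le> wt x"
proof -
  assume x: "x \<in> prime_pairs B L"
  then have "(fst x, snd x) \<in> prime_pairs B L" by simp
  note D = prime_pairsD[OF this]
  show ?thesis unfolding wt_def
    by (intro mult_nonneg_nonneg prod_nonneg) (use D nonneg in auto)
qed

text \<open>The pair of empty sets alone contributes 1. This makes \<open>avg\<close> a genuine
  average and later keeps the sieve errors small after division by the mass.\<close>

lemma mass_ge_1: "0 \<le> L \<Longrightarrow> 1 \<le> mass L"
proof -
  assume L: "0 \<le> L"
  have "wt ({}, {}) \<le> mass L" unfolding mass_def
    by (rule member_le_sum) (use L in \<open>auto simp: wt_nonneg finite_prime_pairs, auto simp: prime_pairs_def\<close>)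
  then show ?thesis by (simp add: wt_def)
qed

lemma avg_add: "avg L (\<lambda>x. f x + g x) = avg L f + avg L g"
  by (simp add: avg_def distrib_left sum.distrib add_divide_distrib)

lemma avg_diff: "avg L (\<lambda>x. f x - g x) = avg L f - avg L g"
  by (simp add: avg_def right_diff_distrib sum_subtractf diff_divide_distrib)

lemma avg_cmult: "avg L (\<lambda>x. c * f x) = c * avg L f"
  by (simp add: avg_def sum_distrib_left mult_ac)

lemma avg_cong: "(\<And>x. x \<in> prime_pairs B L \<Longrightarrow> f x = g x) \<Longrightarrow> avg L f = avg L g"
  by (simp add: avg_def)

lemma avg_const: "0 \<le> L \<Longrightarrow> avg L (\<lambda>x. c) = c"
  using mass_ge_1[of L] by (simp add: avg_def mass_def sum_distrib_right[symmetric])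

lemma avg_mono: "0 \<le> L \<Longrightarrow> (\<And>x. x \<in> prime_pairs B L \<Longrightarrow> f x \<le> g x) \<Longrightarrow> avg L f \<le> avg L g"
  using mass_ge_1[of L] unfolding avg_def
  by (intro divide_right_mono sum_mono mult_left_mono) (auto simp: wt_nonneg)

lemma avg_abs_le: "0 \<le> L \<Longrightarrow> (\<And>x. x \<in> prime_pairs B L \<Longrightarrow> \<bar>f x\<bar> \<le> g x) \<Longrightarrow> \<bar>avg L f\<bar> \<le> avg L g"
proof -
  assume L: "0 \<le> L" and le: "\<And>x. x \<in> prime_pairs B L \<Longrightarrow> \<bar>f x\<bar> \<le> g x"
  have "avg L f \<le> avg L g" by (rule avg_mono[OF L]) (use le in force)
  moreover have "avg L (\<lambda>x. -1 * f x) \<le> avg L g" by (rule avg_mono[OF L]) (use le in force)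
  ultimately show ?thesis unfolding avg_cmult by linarith
qed

text \<open>Two factors of order \<open>1 / p\<close> leave the convergent series of
  \<open>ln p / p^2\<close>, hence a bound uniform in \<open>L\<close> and \<open>U\<close>.\<close>

lemma new_primes_sum_le:
  assumes "density B b \<kappa>" "density B c \<kappa>'"
  obtains C where "0 \<le> C"
    "\<And>L U. (\<Sum>p\<in>new_primes B L U. b p * (c p * ln (real p))) \<le> C"
proof -
  obtain C1 where C1: "0 \<le> C1" "\<And>p. prime p \<Longrightarrow> B < p \<Longrightarrow> b p \<le> C1 / real p"
    using density_le[OF assms(1)] by blast
  obtain C2 where C2: "0 \<le> C2" "\<And>p. prime p \<Longrightarrow> B < p \<Longrightarrow> c p \<le> C2 / real p"
    using density_le[OF assms(2)] by blast
  obtain C3 where C3: "0 < C3" "\<And>A. finite A \<Longrightarrow> (\<Sum>n\<in>A. ln (real n) / real n ^ 2) \<le> C3"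
    using sum_ln_over_square_bounded by blast
  have "(\<Sum>p\<in>new_primes B L U. b p * (c p * ln (real p))) \<le> C1 * C2 * C3" for L U
  proof -
    have "(\<Sum>p\<in>new_primes B L U. b p * (c p * ln (real p)))
       \<le> (\<Sum>p\<in>new_primes B L U. C1 * C2 * (ln (real p) / real p ^ 2))"
    proof (rule sum_mono)
      fix p assume "p \<in> new_primes B L U"
      then have p: "prime p" "B < p" by (auto simp: new_primes_def)
      have "b p * (c p * ln (real p)) \<le> C1 / real p * (C2 / real p * ln (real p))"
        using assms p C1 C2 prime_ln_pos[OF p(1)] unfolding density_def
        by (intro mult_mono mult_nonneg_nonneg) auto
      then show "b p * (c p * ln (real p)) \<le> C1 * C2 * (ln (real p) / real p ^ 2)"
        by (simp add: power2_eq_square)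
    qed
    also have "\<dots> \<le> C1 * C2 * C3"
      unfolding sum_distrib_left[symmetric]
      by (intro mult_left_mono C3(2) finite_new_primes mult_nonneg_nonneg C1 C2)
    finally show ?thesis .
  qed
  then show ?thesis using that[of "C1 * C2 * C3"] C1 C2 C3 by auto
qed

text \<open>Controls the primes that \<open>new_primes\<close> omits because they already occur in
  the pair. Such a sum need not be bounded uniformly over pairs, but on average it is: pulling the
  prime out supplies a second factor of order \<open>1 / p\<close>.\<close>

lemma avg_repeated_prime_le:
  obtains C where "0 \<le> C"
    "\<And>L. 0 \<le> L \<Longrightarrow> avg L (\<lambda>x. \<Sum>p\<in>fst x \<union> snd x. \<beta> p * ln (real p)) \<le> C"
proof -
  obtain C1 where C1: "0 \<le> C1" "\<And>L U. (\<Sum>p\<in>new_primes B L U. \<alpha> p * (\<beta> p * ln (real p))) \<le> C1"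
    using new_primes_sum_le[OF dens_\<alpha> dens_\<beta>] by blast
  obtain C2 where C2: "0 \<le> C2" "\<And>L U. (\<Sum>p\<in>new_primes B L U. \<beta> p * (\<beta> p * ln (real p))) \<le> C2"
    using new_primes_sum_le[OF dens_\<beta> dens_\<beta>] by blast
  have "avg L (\<lambda>x. \<Sum>p\<in>fst x \<union> snd x. \<beta> p * ln (real p)) \<le> C1 + C2" if L: "0 \<le> L" for L
  proof -
    have "avg L (\<lambda>x. \<Sum>p\<in>fst x \<union> snd x. \<beta> p * ln (real p))
        = avg L (\<lambda>x. (\<Sum>p\<in>fst x. \<beta> p * ln (real p)) * 1 + (\<Sum>p\<in>snd x. \<beta> p * ln (real p)) * 1)"
    proof (rule avg_cong)
      fix x assume "x \<in> prime_pairs B L"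
      then have "(fst x, snd x) \<in> prime_pairs B L" by simp
      note D = prime_pairsD[OF this]
      show "(\<Sum>p\<in>fst x \<union> snd x. \<beta> p * ln (real p)) =
        (\<Sum>p\<in>fst x. \<beta> p * ln (real p)) * 1 + (\<Sum>p\<in>snd x. \<beta> p * ln (real p)) * 1"
        using D by (simp add: sum.union_disjoint)
    qed
    also have "\<dots> = avg L (\<lambda>x. \<Sum>p\<in>new_primes B L (fst x \<union> snd x). \<alpha> p * (\<beta> p * ln (real p)) * 1)
                 + avg L (\<lambda>x. \<Sum>p\<in>new_primes B L (fst x \<union> snd x). \<beta> p * (\<beta> p * ln (real p)) * 1)"
      unfolding avg_add unfolding avg_def wt_def
      using sum_pull_prime[of \<alpha> \<beta> "\<lambda>p. \<beta> p * ln (real p)" "\<lambda>_ _. 1" B L]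
        sum_pull_prime_fst[of \<alpha> \<beta> "\<lambda>p. \<beta> p * ln (real p)" "\<lambda>_ _. 1" B L]
      by simp
    also have "\<dots> \<le> avg L (\<lambda>_. C1) + avg L (\<lambda>_. C2)"
      by (intro add_mono avg_mono L) (use C1 C2 in auto)
    finally show ?thesis by (simp add: avg_const L)
  qed
  then show ?thesis using that[of "C1 + C2"] C1 C2 by auto
qed

lemma part_bounds:
  assumes "x \<in> prime_pairs B L" "0 < L"
  shows "0 \<le> spart L x" "0 \<le> tpart L x" "0 \<le> vpart L x" "spart L x + tpart L x + vpart L x = 1"
proof -
  have "(fst x, snd x) \<in> prime_pairs B L" using assms by simp
  note D = prime_pairsD[OF this]
  show "0 \<le> spart L x" "0 \<le> tpart L x" "0 \<le> vpart L x" "spart L x + tpart L x + vpart L x = 1"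
    using D assms(2) by (auto simp: spart_def tpart_def vpart_def field_simps)
qed

text \<open>What a factor \<open>tpart\<close> turns into after one prime is pulled out: inserting
  \<open>p\<close> lowers the free share by \<open>ln p / L\<close>.\<close>

definition newsum :: "real \<Rightarrow> nat \<Rightarrow> nat set \<times> nat set \<Rightarrow> real" where
  "newsum L j x = (\<Sum>p\<in>new_primes B L (fst x \<union> snd x). \<beta> p * (ln (real p) / L) * (vpart L x - ln (real p) / L) ^ j)"

text \<open>For a fixed pair, the sum over all primes within the free room is evaluated by
  \<open>sum_power_weight_bound\<close>; discarding the primes already present in the pair costs the
  last error term.\<close>

lemma newsum_approx:
  assumes \<epsilon>: "0 < \<epsilon>"
  shows "\<exists>C\<ge>0. \<forall>L>0. \<forall>x\<in>prime_pairs B L.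
    \<bar>newsum L j x - \<kappa>\<^sub>\<beta> / real (Suc j) * vpart L x ^ Suc j\<bar>
      \<le> \<epsilon> + C / L + (\<Sum>p\<in>fst x \<union> snd x. \<beta> p * ln (real p)) / L"
proof -
  obtain C where C: "0 \<le> C" "\<And>x. 0 \<le> x \<Longrightarrow> \<bar>(\<Sum>p | prime p \<and> B < p \<and> ln (real p) \<le> x. \<beta> p * ln (real p)) - \<kappa>\<^sub>\<beta> * x\<bar> \<le> \<epsilon> * x + C"
    using density_prime_sum[OF M dens_\<beta> \<epsilon>] by blast
  have "\<bar>newsum L j x - \<kappa>\<^sub>\<beta> / real (Suc j) * vpart L x ^ Suc j\<bar>
      \<le> \<epsilon> + C / L + (\<Sum>p\<in>fst x \<union> snd x. \<beta> p * ln (real p)) / L"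
    if L: "0 < L" and x: "x \<in> prime_pairs B L" for L x
  proof -
    have "(fst x, snd x) \<in> prime_pairs B L" using x by simp
    note D = prime_pairsD[OF this]
    define U where "U = fst x \<union> snd x"
    define V where "V = L - lnsum U"
    have V: "0 \<le> V" "V \<le> L" using D by (auto simp: V_def U_def)
    have v: "vpart L x = V / L" by (simp add: vpart_def V_def U_def)
    define Q where "Q = {p. prime p \<and> B < p}"
    have fin: "finite {p \<in> Q. ln (real p) \<le> y}" for y
      by (rule finite_subset[OF _ finite_primes_ln_le[of y]]) (auto simp: Q_def)
    have main: "\<bar>(\<Sum>p | p \<in> Q \<and> ln (real p) \<le> V. \<beta> p * ln (real p) * (V - ln (real p)) ^ j)
        - \<kappa>\<^sub>\<beta> * V ^ Suc j / real (Suc j)\<bar> \<le> (\<epsilon> * L + C) * V ^ j"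
    \<comment> \<open>The error \<open>\<epsilon> * V' + C\<close> is frozen at its largest value,
      for \<open>V' = L\<close>, because a bound independent of \<open>V'\<close> is required; after
      division by powers of \<open>L\<close> it becomes \<open>\<epsilon> + C / L\<close>.\<close>
    proof (rule sum_power_weight_bound[OF fin, where ?V0.0 = L])
      show "0 \<le> ln (real p)" if "p \<in> Q" for p using that prime_ln_pos[of p] by (auto simp: Q_def)
      show "\<bar>(\<Sum>p | p \<in> Q \<and> ln (real p) \<le> V'. \<beta> p * ln (real p)) - \<kappa>\<^sub>\<beta> * V'\<bar> \<le> \<epsilon> * L + C"
        if "0 \<le> V'" "V' \<le> L" for V'
      proof -
        have "\<epsilon> * V' \<le> \<epsilon> * L" using that \<epsilon> by simp
        then show ?thesis using C(2)[OF that(1)] by (simp add: Q_def conj_assoc)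
      qed
    qed (use V in auto)
    have split: "(\<Sum>p | p \<in> Q \<and> ln (real p) \<le> V. \<beta> p * ln (real p) * (V - ln (real p)) ^ j)
      = (\<Sum>p\<in>new_primes B L U. \<beta> p * ln (real p) * (V - ln (real p)) ^ j)
        + (\<Sum>p | p \<in> Q \<and> ln (real p) \<le> V \<and> p \<in> U. \<beta> p * ln (real p) * (V - ln (real p)) ^ j)"
      by (subst sum.union_disjoint[symmetric])
         (auto simp: finite_new_primes new_primes_def Q_def V_def intro!: sum.cong
           finite_subset[OF _ finite_primes_ln_le[of "L - lnsum U"]])
    have ex: "\<bar>\<Sum>p | p \<in> Q \<and> ln (real p) \<le> V \<and> p \<in> U. \<beta> p * ln (real p) * (V - ln (real p)) ^ j\<bar>
        \<le> (\<Sum>p\<in>U. \<beta> p * ln (real p)) * V ^ j"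
    proof -
      have "\<bar>\<Sum>p | p \<in> Q \<and> ln (real p) \<le> V \<and> p \<in> U. \<beta> p * ln (real p) * (V - ln (real p)) ^ j\<bar>
         \<le> (\<Sum>p | p \<in> Q \<and> ln (real p) \<le> V \<and> p \<in> U. \<bar>\<beta> p * ln (real p) * (V - ln (real p)) ^ j\<bar>)"
        by (rule sum_abs)
      also have "\<dots> \<le> (\<Sum>p | p \<in> Q \<and> ln (real p) \<le> V \<and> p \<in> U. \<beta> p * ln (real p) * V ^ j)"
      proof (rule sum_mono)
        fix p assume "p \<in> {p. p \<in> Q \<and> ln (real p) \<le> V \<and> p \<in> U}"
        then have p: "prime p" "B < p" "ln (real p) \<le> V" by (auto simp: Q_def)
        then have "0 \<le> ln (real p)" using prime_ln_pos[of p] by simp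
        then have "(V - ln (real p)) ^ j \<le> V ^ j" "0 \<le> (V - ln (real p)) ^ j" "0 \<le> \<beta> p * ln (real p)"
          using p nonneg(2)[of p] by (auto intro!: power_mono)
        then show "\<bar>\<beta> p * ln (real p) * (V - ln (real p)) ^ j\<bar> \<le> \<beta> p * ln (real p) * V ^ j"
          by (metis abs_of_nonneg mult_left_mono mult_nonneg_nonneg)
      qed
      also have "\<dots> \<le> (\<Sum>p\<in>U. \<beta> p * ln (real p) * V ^ j)"
      proof (rule sum_mono2)
        show "finite U" using D by (simp add: U_def)
        fix p assume "p \<in> U - {p \<in> Q. ln (real p) \<le> V \<and> p \<in> U}"
        then have "prime p" "B < p" using D by (auto simp: U_def)
        then show "0 \<le> \<beta> p * ln (real p) * V ^ j"
          using nonneg(2)[of p] prime_ln_pos[of p] V by (intro mult_nonneg_nonneg) auto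
      qed auto
      finally show ?thesis by (simp add: sum_distrib_right)
    qed
    have U0: "0 \<le> (\<Sum>p\<in>U. \<beta> p * ln (real p))"
    proof (rule sum_nonneg)
      fix p assume "p \<in> U"
      then have "prime p" "B < p" using D by (auto simp: U_def)
      then show "0 \<le> \<beta> p * ln (real p)" using nonneg(2)[of p] prime_ln_pos[of p] by simp
    qed
    have "\<bar>(\<Sum>p\<in>new_primes B L U. \<beta> p * ln (real p) * (V - ln (real p)) ^ j) - \<kappa>\<^sub>\<beta> * V ^ Suc j / real (Suc j)\<bar>
        \<le> (\<epsilon> * L + C + (\<Sum>p\<in>U. \<beta> p * ln (real p))) * V ^ j"
      using main ex unfolding split distrib_right by linarith
    also have "\<dots> \<le> (\<epsilon> * L + C + (\<Sum>p\<in>U. \<beta> p * ln (real p))) * L ^ j"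
      using V U0 C(1) \<epsilon> L by (intro mult_left_mono power_mono add_nonneg_nonneg) auto
    finally have *: "\<bar>(\<Sum>p\<in>new_primes B L U. \<beta> p * ln (real p) * (V - ln (real p)) ^ j) - \<kappa>\<^sub>\<beta> * V ^ Suc j / real (Suc j)\<bar>
        / L ^ Suc j \<le> (\<epsilon> * L + C + (\<Sum>p\<in>U. \<beta> p * ln (real p))) * L ^ j / L ^ Suc j"
      using L by (intro divide_right_mono) auto
    have "newsum L j x = (\<Sum>p\<in>new_primes B L U. \<beta> p * ln (real p) * (V - ln (real p)) ^ j) / L ^ Suc j"
      unfolding newsum_def v U_def[symmetric] sum_divide_distrib
      using L by (intro sum.cong refl) (simp add: diff_divide_distrib[symmetric] power_divide)
    then have "newsum L j x - \<kappa>\<^sub>\<beta> / real (Suc j) * vpart L x ^ Suc j =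
       ((\<Sum>p\<in>new_primes B L U. \<beta> p * ln (real p) * (V - ln (real p)) ^ j) - \<kappa>\<^sub>\<beta> * V ^ Suc j / real (Suc j)) / L ^ Suc j"
      unfolding v power_divide diff_divide_distrib by simp
    then have "\<bar>newsum L j x - \<kappa>\<^sub>\<beta> / real (Suc j) * vpart L x ^ Suc j\<bar> =
       \<bar>(\<Sum>p\<in>new_primes B L U. \<beta> p * ln (real p) * (V - ln (real p)) ^ j) - \<kappa>\<^sub>\<beta> * V ^ Suc j / real (Suc j)\<bar> / L ^ Suc j"
      using L by (simp only: abs_divide) simp
    also have "\<dots> \<le> (\<epsilon> * L + C + (\<Sum>p\<in>U. \<beta> p * ln (real p))) * L ^ j / L ^ Suc j" by (rule *)
    also have "\<dots> = \<epsilon> + C / L + (\<Sum>p\<in>U. \<beta> p * ln (real p)) / L"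
      using L by (simp add: add_divide_distrib)
    finally show ?thesis by (simp add: U_def)
  qed
  then show ?thesis using C(1) by blast
qed

text \<open>The bounded test function \<open>K\<close> allows the same limit to be used for
  \<open>K = 1\<close> and for \<open>K = t + v\<close>.\<close>

lemma avg_newsum_tendsto:
  assumes K: "\<And>L x. 0 < L \<Longrightarrow> x \<in> prime_pairs B L \<Longrightarrow> \<bar>K L x\<bar> \<le> 1"
  shows "((\<lambda>L. avg L (\<lambda>x. K L x * newsum L j x) - \<kappa>\<^sub>\<beta> / real (Suc j) * avg L (\<lambda>x. K L x * vpart L x ^ Suc j)) \<longlongrightarrow> 0) at_top"
proof (rule tendstoI)
  fix e :: real assume e: "0 < e"
  obtain C1 where C1: "0 \<le> C1"
    "\<And>L. 0 \<le> L \<Longrightarrow> avg L (\<lambda>x. \<Sum>p\<in>fst x \<union> snd x. \<beta> p * ln (real p)) \<le> C1"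
    using avg_repeated_prime_le by blast
  obtain C2 where C2: "0 \<le> C2" "\<And>L x. 0 < L \<Longrightarrow> x \<in> prime_pairs B L \<Longrightarrow>
    \<bar>newsum L j x - \<kappa>\<^sub>\<beta> / real (Suc j) * vpart L x ^ Suc j\<bar>
      \<le> e / 3 + C2 / L + (\<Sum>p\<in>fst x \<union> snd x. \<beta> p * ln (real p)) / L"
    using newsum_approx[of "e / 3" j] e by (auto simp del: power_Suc of_nat_Suc)
  have "eventually (\<lambda>L. 3 * (C1 + C2 + 1) / e \<le> L \<and> 0 < L) at_top"
    by (intro eventually_conj eventually_ge_at_top eventually_gt_at_top)
  then show "eventually (\<lambda>L. dist (avg L (\<lambda>x. K L x * newsum L j x)
      - \<kappa>\<^sub>\<beta> / real (Suc j) * avg L (\<lambda>x. K L x * vpart L x ^ Suc j)) 0 < e) at_top"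
  proof eventually_elim
    case (elim L)
    then have L: "0 < L" "0 \<le> L" by auto
    have "\<bar>avg L (\<lambda>x. K L x * newsum L j x - \<kappa>\<^sub>\<beta> / real (Suc j) * (K L x * vpart L x ^ Suc j))\<bar>
      \<le> avg L (\<lambda>x. e / 3 + C2 / L + 1 / L * (\<Sum>p\<in>fst x \<union> snd x. \<beta> p * ln (real p)))"
    proof (rule avg_abs_le[OF L(2)])
      fix x assume x: "x \<in> prime_pairs B L"
      have "\<bar>K L x * newsum L j x - \<kappa>\<^sub>\<beta> / real (Suc j) * (K L x * vpart L x ^ Suc j)\<bar>
         = \<bar>K L x\<bar> * \<bar>newsum L j x - \<kappa>\<^sub>\<beta> / real (Suc j) * vpart L x ^ Suc j\<bar>"
        unfolding abs_mult[symmetric] right_diff_distrib by (simp only: mult_ac)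
      also have "\<dots> \<le> 1 * \<bar>newsum L j x - \<kappa>\<^sub>\<beta> / real (Suc j) * vpart L x ^ Suc j\<bar>"
        by (intro mult_right_mono K L x) auto
      finally show "\<bar>K L x * newsum L j x - \<kappa>\<^sub>\<beta> / real (Suc j) * (K L x * vpart L x ^ Suc j)\<bar>
        \<le> e / 3 + C2 / L + 1 / L * (\<Sum>p\<in>fst x \<union> snd x. \<beta> p * ln (real p))"
        using C2(2)[OF L(1) x] by simp
    qed
    also have "\<dots> \<le> e / 3 + C2 / L + 1 / L * C1"
      unfolding avg_add avg_cmult avg_const[OF L(2)] using L C1 by (intro add_left_mono mult_left_mono) auto
    also have "\<dots> = e / 3 + (C1 + C2) / L" by (simp add: add_divide_distrib)
    also have "\<dots> < e"
    proof -
      have "3 * (C1 + C2 + 1) \<le> L * e" using elim e by (simp add: field_simps)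
      then have "(C1 + C2) / L \<le> e / 3" using L by (simp add: field_simps)
      then show ?thesis using e by linarith
    qed
    finally show ?case unfolding avg_diff avg_cmult dist_real_def by simp
  qed
qed

end

section \<open>The moment recursion\<close>

context pair_moments
begin

lemma avg_tpart_mult:
  "avg L (\<lambda>x. tpart L x * F x) =
   avg L (\<lambda>x. \<Sum>p\<in>new_primes B L (fst x \<union> snd x). \<beta> p * (ln (real p) / L) * F (fst x, insert p (snd x)))"
  using sum_pull_prime[of \<alpha> \<beta> "\<lambda>p. ln (real p) / L" "\<lambda>S T. F (S, T)" B L]
  by (simp add: avg_def wt_def tpart_def lnsum_def sum_divide_distrib)

lemma parts_insert_new:
  assumes x: "x \<in> prime_pairs B L" and p: "p \<in> new_primes B L (fst x \<union> snd x)"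
  shows "vpart L (fst x, insert p (snd x)) = vpart L x - ln (real p) / L"
    "tpart L (fst x, insert p (snd x)) = tpart L x + ln (real p) / L"
proof -
  have "(fst x, snd x) \<in> prime_pairs B L" using x by simp
  note D = prime_pairsD[OF this]
  have "p \<notin> fst x \<union> snd x" using p by (simp add: new_primes_def)
  then show "vpart L (fst x, insert p (snd x)) = vpart L x - ln (real p) / L"
    "tpart L (fst x, insert p (snd x)) = tpart L x + ln (real p) / L"
    using D by (simp_all add: vpart_def tpart_def lnsum_insert diff_divide_distrib add_divide_distrib)
qed

lemma avg_t_v: "avg L (\<lambda>x. tpart L x * vpart L x ^ j) = avg L (newsum L j)"
  unfolding avg_tpart_mult newsum_def
  by (intro avg_cong sum.cong refl) (simp add: parts_insert_new)

text \<open>Inserting \<open>p\<close> with \<open>u = ln p / L\<close> turns the second factor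
  \<open>t\<close> into \<open>t + u\<close>, rewritten as \<open>(t + v) - (v - u)\<close>: the
  first part does not depend on \<open>p\<close>, the second raises the exponent of
  \<open>v - u\<close> by one.\<close>

lemma avg_tt_v: "avg L (\<lambda>x. tpart L x * (tpart L x * vpart L x ^ j)) =
    avg L (\<lambda>x. (tpart L x + vpart L x) * newsum L j x) - avg L (newsum L (Suc j))"
  unfolding avg_tpart_mult avg_diff[symmetric] newsum_def sum_distrib_left sum_subtractf[symmetric]
  by (intro avg_cong sum.cong refl) (simp add: parts_insert_new algebra_simps add_divide_distrib)

lemma avg_t_v_tendsto:
  "((\<lambda>L. avg L (\<lambda>x. tpart L x * vpart L x ^ j) - \<kappa>\<^sub>\<beta> / real (Suc j) * avg L (\<lambda>x. vpart L x ^ Suc j)) \<longlongrightarrow> 0) at_top"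
  using avg_newsum_tendsto[of "\<lambda>_ _. 1" j] by (simp add: avg_t_v)

lemma avg_tt_v_tendsto:
  "((\<lambda>L. avg L (\<lambda>x. tpart L x * (tpart L x * vpart L x ^ j))
     - (\<kappa>\<^sub>\<beta> / real (Suc j) * (avg L (\<lambda>x. tpart L x * vpart L x ^ Suc j) + avg L (\<lambda>x. vpart L x ^ Suc (Suc j)))
        - \<kappa>\<^sub>\<beta> / real (Suc (Suc j)) * avg L (\<lambda>x. vpart L x ^ Suc (Suc j)))) \<longlongrightarrow> 0) at_top"
proof -
  have 1: "((\<lambda>L. avg L (\<lambda>x. (tpart L x + vpart L x) * newsum L j x) -
     \<kappa>\<^sub>\<beta> / real (Suc j) * avg L (\<lambda>x. (tpart L x + vpart L x) * vpart L x ^ Suc j)) \<longlongrightarrow> 0) at_top"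
  proof (rule avg_newsum_tendsto)
    fix L :: real and x assume "0 < L" "x \<in> prime_pairs B L"
    from part_bounds[OF this(2,1)] show "\<bar>tpart L x + vpart L x\<bar> \<le> 1" by linarith
  qed
  have 2: "((\<lambda>L. avg L (newsum L (Suc j)) -
     \<kappa>\<^sub>\<beta> / real (Suc (Suc j)) * avg L (\<lambda>x. vpart L x ^ Suc (Suc j))) \<longlongrightarrow> 0) at_top"
    using avg_newsum_tendsto[of "\<lambda>_ _. 1" "Suc j"] by simp
  have 3: "avg L (\<lambda>x. (tpart L x + vpart L x) * vpart L x ^ Suc j) =
     avg L (\<lambda>x. tpart L x * vpart L x ^ Suc j) + avg L (\<lambda>x. vpart L x ^ Suc (Suc j))" for L
    unfolding avg_add[symmetric] by (simp add: distrib_right)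
  show ?thesis
    using tendsto_diff[OF 1 2] unfolding avg_tt_v 3 by (simp add: algebra_simps)
qed

text \<open>Exchanging the two components preserves the set of pairs and interchanges
  \<open>\<alpha>\<close> with \<open>\<beta>\<close>, so this is \<open>avg_t_v_tendsto\<close> for
  the swapped instance.\<close>

lemma avg_s_v_tendsto:
  "((\<lambda>L. avg L (\<lambda>x. spart L x * vpart L x ^ j) - \<kappa>\<^sub>\<alpha> / real (Suc j) * avg L (\<lambda>x. vpart L x ^ Suc j)) \<longlongrightarrow> 0) at_top"
proof -
  interpret sw: pair_moments B \<beta> \<alpha> \<kappa>\<^sub>\<beta> \<kappa>\<^sub>\<alpha>
    by unfold_locales (fact dens_\<beta> dens_\<alpha> M)+
  have sum: "(\<Sum>x\<in>prime_pairs B L. sw.wt x * f x) = (\<Sum>x\<in>prime_pairs B L. wt x * f (prod.swap x))" for L f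
    using sum_pairs_swap[of "\<lambda>S T. sw.wt (S, T) * f (S, T)" B L]
    by (simp add: sw.wt_def wt_def prod.swap_def mult_ac)
  have mass: "sw.mass L = mass L" for L
    using sum[where L = L and f = "\<lambda>_. 1"] by (simp add: sw.mass_def mass_def)
  have avg: "sw.avg L f = avg L (\<lambda>x. f (prod.swap x))" for L f
    by (simp add: sw.avg_def avg_def sum mass)
  have "sw.tpart L (prod.swap x) = spart L x" "sw.vpart L (prod.swap x) = vpart L x" for L x
    by (auto simp: sw.tpart_def spart_def sw.vpart_def vpart_def Un_commute)
  then show ?thesis using sw.avg_t_v_tendsto[of j] by (simp add: avg)
qed

text \<open>For a positive sum of dimensions, the moments of the Beta law with parameters 1 and
  \<open>\<kappa>\<^sub>\<alpha> + \<kappa>\<^sub>\<beta>\<close>.\<close>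

fun vmom :: "nat \<Rightarrow> real" where
  "vmom 0 = 1"
| "vmom (Suc j) = vmom j / (1 + (\<kappa>\<^sub>\<alpha> + \<kappa>\<^sub>\<beta>) / real (Suc j))"

text \<open>Averaging \<open>v ^ j = (s + t + v) * v ^ j\<close> and replacing the averages with
  \<open>s\<close> and \<open>t\<close> by multiples of the next moment shows that the
  \<open>j\<close>-th moment is asymptotically \<open>K\<close> times the next one. As
  \<open>K\<close> is nonzero, this yields existence and value of the next limit at once.\<close>

lemma avg_v_tendsto: "((\<lambda>L. avg L (\<lambda>x. vpart L x ^ j)) \<longlongrightarrow> vmom j) at_top"
proof (induction j)
  case 0
  have "eventually (\<lambda>L. avg L (\<lambda>x. vpart L x ^ 0) = 1) at_top"
    using eventually_ge_at_top[of 0] by eventually_elim (simp add: avg_const)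
  then show ?case by (simp add: tendsto_eventually)
next
  case (Suc j)
  define K where "K = 1 + (\<kappa>\<^sub>\<alpha> + \<kappa>\<^sub>\<beta>) / real (Suc j)"
  have "0 \<le> \<kappa>\<^sub>\<alpha>" "0 \<le> \<kappa>\<^sub>\<beta>" using dens_\<alpha> dens_\<beta> by (auto simp: density_def)
  then have K: "K \<noteq> 0" unfolding K_def by (smt (verit) divide_nonneg_nonneg of_nat_0_le_iff)
  \<comment> \<open>The next moment already solved for: a convergent term minus two differences that
    tend to 0, divided by \<open>K\<close>.\<close>
  have lim: "((\<lambda>L. (avg L (\<lambda>x. vpart L x ^ j)
      - ((avg L (\<lambda>x. spart L x * vpart L x ^ j) - \<kappa>\<^sub>\<alpha> / real (Suc j) * avg L (\<lambda>x. vpart L x ^ Suc j))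
      + (avg L (\<lambda>x. tpart L x * vpart L x ^ j) - \<kappa>\<^sub>\<beta> / real (Suc j) * avg L (\<lambda>x. vpart L x ^ Suc j)))) / K)
      \<longlongrightarrow> (vmom j - (0 + 0)) / K) at_top"
    by (intro tendsto_intros Suc.IH avg_s_v_tendsto avg_t_v_tendsto K)
  have "eventually (\<lambda>L. (avg L (\<lambda>x. vpart L x ^ j)
      - ((avg L (\<lambda>x. spart L x * vpart L x ^ j) - \<kappa>\<^sub>\<alpha> / real (Suc j) * avg L (\<lambda>x. vpart L x ^ Suc j))
      + (avg L (\<lambda>x. tpart L x * vpart L x ^ j) - \<kappa>\<^sub>\<beta> / real (Suc j) * avg L (\<lambda>x. vpart L x ^ Suc j)))) / K
      = avg L (\<lambda>x. vpart L x ^ Suc j)) at_top"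
    using eventually_gt_at_top[of 0]
  proof eventually_elim
    case (elim L)
    have "avg L (\<lambda>x. vpart L x ^ j) = avg L (\<lambda>x. spart L x * vpart L x ^ j + tpart L x * vpart L x ^ j + vpart L x ^ Suc j)"
    proof (rule avg_cong)
      fix x assume x: "x \<in> prime_pairs B L"
      have "spart L x * vpart L x ^ j + tpart L x * vpart L x ^ j + vpart L x ^ Suc j
          = (spart L x + tpart L x + vpart L x) * vpart L x ^ j"
        by (simp add: distrib_right)
      then show "vpart L x ^ j = spart L x * vpart L x ^ j + tpart L x * vpart L x ^ j + vpart L x ^ Suc j"
        using part_bounds[OF x elim] by simp
    qed
    then have "avg L (\<lambda>x. vpart L x ^ j) = avg L (\<lambda>x. spart L x * vpart L x ^ j)
        + avg L (\<lambda>x. tpart L x * vpart L x ^ j) + avg L (\<lambda>x. vpart L x ^ Suc j)"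
      by (simp only: avg_add)
    then have "avg L (\<lambda>x. vpart L x ^ j)
      - ((avg L (\<lambda>x. spart L x * vpart L x ^ j) - \<kappa>\<^sub>\<alpha> / real (Suc j) * avg L (\<lambda>x. vpart L x ^ Suc j))
      + (avg L (\<lambda>x. tpart L x * vpart L x ^ j) - \<kappa>\<^sub>\<beta> / real (Suc j) * avg L (\<lambda>x. vpart L x ^ Suc j)))
      = avg L (\<lambda>x. vpart L x ^ Suc j) * K"
      unfolding K_def add_divide_distrib ring_distribs by (simp add: mult.commute del: power_Suc of_nat_Suc)
    then show ?case using K by simp
  qed
  from Lim_transform_eventually[OF lim this] show ?case by (simp add: K_def)
qed

lemma tendsto_of_diff:
  fixes f g :: "real \<Rightarrow> real"
  assumes "((\<lambda>L. f L - g L) \<longlongrightarrow> 0) F" "(g \<longlongrightarrow> l) F"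
  shows "(f \<longlongrightarrow> l) F"
  using tendsto_add[OF assms] by simp

lemma avg_square_tendsto:
  "((\<lambda>L. avg L (\<lambda>x. (1 + b * vpart L x)\<^sup>2)) \<longlongrightarrow> 1 + 2 * b * vmom 1 + b\<^sup>2 * vmom 2) at_top"
proof -
  have "((\<lambda>L. avg L (\<lambda>x. vpart L x ^ 0) + 2 * b * avg L (\<lambda>x. vpart L x ^ 1) + b\<^sup>2 * avg L (\<lambda>x. vpart L x ^ 2))
     \<longlongrightarrow> vmom 0 + 2 * b * vmom 1 + b\<^sup>2 * vmom 2) at_top"
    by (intro tendsto_intros avg_v_tendsto)
  moreover have "avg L (\<lambda>x. (1 + b * vpart L x)\<^sup>2) =
      avg L (\<lambda>x. vpart L x ^ 0) + 2 * b * avg L (\<lambda>x. vpart L x ^ 1) + b\<^sup>2 * avg L (\<lambda>x. vpart L x ^ 2)" for L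
    unfolding avg_cmult[symmetric] avg_add[symmetric]
    by (intro avg_cong) (simp add: power2_eq_square algebra_simps)
  ultimately show ?thesis by simp
qed

text \<open>With \<open>u = t + v\<close>, the second factor \<open>u + b * u^2 / 2\<close> is the
  antiderivative of \<open>1 + b * u\<close>; it is what the inner sum is bounded below by. The
  expansion contains at most two factors \<open>t\<close>, so \<open>avg_t_v_tendsto\<close> and
  \<open>avg_tt_v_tendsto\<close> cover every monomial.\<close>

lemma avg_product_tendsto:
  assumes \<kappa>: "\<kappa>\<^sub>\<beta> = 1"
  shows "((\<lambda>L. avg L (\<lambda>x. (1 + b * vpart L x) *
      ((tpart L x + vpart L x) + b * (tpart L x + vpart L x)\<^sup>2 / 2)))
     \<longlongrightarrow> 2 * vmom 1 + 3 * b * vmom 2 + b\<^sup>2 * vmom 3) at_top"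
proof -
  have v: "((\<lambda>L. avg L (\<lambda>x. vpart L x ^ j)) \<longlongrightarrow> vmom j) at_top" for j
    by (rule avg_v_tendsto)
  have t: "((\<lambda>L. avg L (\<lambda>x. tpart L x * vpart L x ^ j)) \<longlongrightarrow> 1 / real (Suc j) * vmom (Suc j)) at_top" for j
    by (rule tendsto_of_diff[OF avg_t_v_tendsto[unfolded \<kappa>]]) (intro tendsto_intros v)
  have tt: "((\<lambda>L. avg L (\<lambda>x. tpart L x * (tpart L x * vpart L x ^ j))) \<longlongrightarrow>
      1 / real (Suc j) * (1 / real (Suc (Suc j)) * vmom (Suc (Suc j)) + vmom (Suc (Suc j)))
        - 1 / real (Suc (Suc j)) * vmom (Suc (Suc j))) at_top" for j
    by (rule tendsto_of_diff[OF avg_tt_v_tendsto[unfolded \<kappa>]]) (intro tendsto_intros v t)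
  have eq: "avg L (\<lambda>x. (1 + b * vpart L x) * ((tpart L x + vpart L x) + b * (tpart L x + vpart L x)\<^sup>2 / 2))
    = avg L (\<lambda>x. tpart L x * vpart L x ^ 0) + avg L (\<lambda>x. vpart L x ^ 1)
      + b / 2 * avg L (\<lambda>x. tpart L x * (tpart L x * vpart L x ^ 0))
      + 2 * b * avg L (\<lambda>x. tpart L x * vpart L x ^ 1)
      + 3 * b / 2 * avg L (\<lambda>x. vpart L x ^ 2)
      + b\<^sup>2 / 2 * avg L (\<lambda>x. tpart L x * (tpart L x * vpart L x ^ 1))
      + b\<^sup>2 * avg L (\<lambda>x. tpart L x * vpart L x ^ 2)
      + b\<^sup>2 / 2 * avg L (\<lambda>x. vpart L x ^ 3)" for L
    unfolding avg_cmult[symmetric] avg_add[symmetric]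
    by (intro avg_cong) (simp add: power2_eq_square power3_eq_cube field_simps)
  have "((\<lambda>L. avg L (\<lambda>x. tpart L x * vpart L x ^ 0) + avg L (\<lambda>x. vpart L x ^ 1)
      + b / 2 * avg L (\<lambda>x. tpart L x * (tpart L x * vpart L x ^ 0))
      + 2 * b * avg L (\<lambda>x. tpart L x * vpart L x ^ 1)
      + 3 * b / 2 * avg L (\<lambda>x. vpart L x ^ 2)
      + b\<^sup>2 / 2 * avg L (\<lambda>x. tpart L x * (tpart L x * vpart L x ^ 1))
      + b\<^sup>2 * avg L (\<lambda>x. tpart L x * vpart L x ^ 2)
      + b\<^sup>2 / 2 * avg L (\<lambda>x. vpart L x ^ 3)) \<longlongrightarrow>
      1 / real (Suc 0) * vmom (Suc 0) + vmom 1
      + b / 2 * (1 / real (Suc 0) * (1 / real (Suc (Suc 0)) * vmom (Suc (Suc 0)) + vmom (Suc (Suc 0)))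
        - 1 / real (Suc (Suc 0)) * vmom (Suc (Suc 0)))
      + 2 * b * (1 / real (Suc 1) * vmom (Suc 1))
      + 3 * b / 2 * vmom 2
      + b\<^sup>2 / 2 * (1 / real (Suc 1) * (1 / real (Suc (Suc 1)) * vmom (Suc (Suc 1)) + vmom (Suc (Suc 1)))
        - 1 / real (Suc (Suc 1)) * vmom (Suc (Suc 1)))
      + b\<^sup>2 * (1 / real (Suc 2) * vmom (Suc 2))
      + b\<^sup>2 / 2 * vmom 3) at_top"
    by (intro tendsto_add tendsto_mult tendsto_const v t tt)
  moreover have "1 / real (Suc 0) * vmom (Suc 0) + vmom 1
      + b / 2 * (1 / real (Suc 0) * (1 / real (Suc (Suc 0)) * vmom (Suc (Suc 0)) + vmom (Suc (Suc 0)))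
        - 1 / real (Suc (Suc 0)) * vmom (Suc (Suc 0)))
      + 2 * b * (1 / real (Suc 1) * vmom (Suc 1))
      + 3 * b / 2 * vmom 2
      + b\<^sup>2 / 2 * (1 / real (Suc 1) * (1 / real (Suc (Suc 1)) * vmom (Suc (Suc 1)) + vmom (Suc (Suc 1)))
        - 1 / real (Suc (Suc 1)) * vmom (Suc (Suc 1)))
      + b\<^sup>2 * (1 / real (Suc 2) * vmom (Suc 2))
      + b\<^sup>2 / 2 * vmom 3 = 2 * vmom 1 + 3 * b * vmom 2 + b\<^sup>2 * vmom 3"
  proof -
    have "Suc 0 = 1" "Suc 1 = 2" "Suc 2 = 3" "real 1 = 1" "real 2 = 2" "real 3 = 3" by auto
    then show ?thesis by (simp only:) (simp add: field_simps del: vmom.simps)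
  qed
  ultimately show ?thesis unfolding eq by (simp only:)
qed

end

section \<open>The lower bound for the inner sums\<close>

text \<open>Product of the geometric series of \<open>1 / p ^ e\<close> over
  \<open>e \<ge> 1\<close>, each equal to \<open>1 / (p - 1)\<close>; truncation at \<open>N\<close>
  only loses terms.\<close>

lemma sum_inverse_same_prime_factors:
  assumes "finite A" "\<And>p. p \<in> A \<Longrightarrow> prime (p::nat)"
  shows "(\<Sum>n | n \<in> {1..N} \<and> prime_factors n = A. 1 / real n) \<le> (\<Prod>p\<in>A. 1 / (real p - 1))"
  using assms
proof (induction A rule: finite_induct)
  case empty
  have "(\<Sum>n | n \<in> {1..N} \<and> prime_factors n = {}. 1 / real n) \<le> (\<Sum>n\<in>{1}. 1 / real n)"
    by (rule sum_mono2) (auto simp: prime_factorization_empty_iff)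
  then show ?case by simp
next
  case (insert p A)
  define X where "X = {n. n \<in> {1..N} \<and> prime_factors n = insert p A}"
  define Y where "Y = {n. n \<in> {1..N} \<and> prime_factors n = A}"
  have p: "prime p" "1 < real p" using insert.prems prime_gt_1_nat[of p] by auto
  \<comment> \<open>Splitting off the full power of \<open>p\<close> is injective and leaves a
    number whose prime factors are exactly \<open>A\<close>.\<close>
  define f where "f = (\<lambda>n. (multiplicity p n, n div p ^ multiplicity p n))"
  have dec: "n = p ^ multiplicity p n * (n div p ^ multiplicity p n)" for n
    by (simp add: multiplicity_dvd)
  have f: "f n \<in> {1..N} \<times> Y" if n: "n \<in> X" for n
  proof -
    define e m where "e = multiplicity p n" and "m = n div p ^ e"
    have n': "1 \<le> n" "n \<le> N" "prime_factors n = insert p A" using n by (auto simp: X_def)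
    have nm: "n = p ^ e * m" using dec[of n] by (simp add: e_def m_def)
    have "p dvd n" using n' by (metis insertI1 in_prime_factors_iff)
    then have e1: "1 \<le> e" using p n' by (simp add: e_def Suc_le_eq prime_multiplicity_gt_zero_iff)
    \<comment> \<open>A crude bound that keeps the exponent in the finite range
      \<open>1..N\<close>.\<close>
    have "e < p ^ e" using p(1) prime_gt_1_nat by (simp add: power_gt_expt)
    also have "p ^ e \<le> n" using nm n' by (metis dvd_imp_le dvd_triv_left less_le_trans zero_less_one)
    finally have e2: "e \<le> N" using n' by simp
    have m0: "m \<noteq> 0" using nm n' by (metis mult_0_right not_one_le_zero)
    have "m \<le> n" unfolding m_def by simp
    have "\<not> p dvd m"
      using multiplicity_decompose[of n p] p n' prime_gt_1_nat[OF p(1)] unfolding m_def e_def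
      by (metis not_one_le_zero not_prime_unit)
    have "prime_factors n = insert p (prime_factors m)"
      using nm m0 e1 p by (simp add: prime_factors_product prime_factors_power prime_prime_factors prime_gt_0_nat)
    moreover have "p \<notin> prime_factors m" using \<open>\<not> p dvd m\<close> by (simp add: in_prime_factors_iff)
    ultimately have "prime_factors m = A" using n'(3) insert.hyps(2) by (metis Diff_insert_absorb)
    then show ?thesis using e1 e2 m0 \<open>m \<le> n\<close> n' unfolding f_def Y_def e_def[symmetric] m_def[symmetric] by auto
  qed
  have inj: "inj_on f X"
  proof (rule inj_onI)
    fix a b assume "f a = f b"
    then have "multiplicity p a = multiplicity p b" "a div p ^ multiplicity p a = b div p ^ multiplicity p b"
      by (auto simp: f_def)
    then show "a = b" using dec[of a] dec[of b] by metis
  qed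
  have "(\<Sum>n\<in>X. 1 / real n) = (\<Sum>n\<in>X. (\<lambda>(e, m). (1 / real p) ^ e * (1 / real m)) (f n))"
  proof (rule sum.cong[OF refl])
    fix n assume "n \<in> X"
    have "real n = real p ^ multiplicity p n * real (n div p ^ multiplicity p n)"
      by (subst dec[of n]) simp
    then show "1 / real n = (\<lambda>(e, m). (1 / real p) ^ e * (1 / real m)) (f n)"
      by (simp add: f_def power_one_over)
  qed
  also have "\<dots> = (\<Sum>y\<in>f ` X. (\<lambda>(e, m). (1 / real p) ^ e * (1 / real m)) y)"
    by (simp add: sum.reindex[OF inj])
  also have "\<dots> \<le> (\<Sum>y\<in>{1..N} \<times> Y. (\<lambda>(e, m). (1 / real p) ^ e * (1 / real m)) y)"
  proof (rule sum_mono2)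
    show "f ` X \<subseteq> {1..N} \<times> Y" by (rule image_subsetI) (rule f)
  qed (auto simp: Y_def)
  also have "\<dots> = (\<Sum>e\<in>{1..N}. (1 / real p) ^ e) * (\<Sum>m\<in>Y. 1 / real m)"
    by (simp add: sum_product sum.cartesian_product)
  also have "\<dots> \<le> (1 / (real p - 1)) * (\<Prod>p\<in>A. 1 / (real p - 1))"
  proof (rule mult_mono)
    have "(\<Sum>e\<in>{1..N}. (1 / real p) ^ e) = (\<Sum>e<N. (1 / real p) ^ Suc e)"
      by (rule sum.reindex_bij_witness[of _ Suc "\<lambda>e. e - 1"]) auto
    also have "\<dots> = 1 / real p * (\<Sum>e<N. (1 / real p) ^ e)" by (simp add: sum_distrib_left)
    also have "\<dots> \<le> 1 / real p * (1 / (1 - 1 / real p))"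
    proof (intro mult_left_mono)
      have "(\<Sum>e<N. (1 / real p) ^ e) \<le> suminf (\<lambda>e. (1 / real p) ^ e)"
        by (rule sum_le_suminf) (use p in \<open>auto intro: summable_geometric\<close>)
      also have "\<dots> = 1 / (1 - 1 / real p)" by (rule suminf_geometric) (use p in simp)
      finally show "(\<Sum>e<N. (1 / real p) ^ e) \<le> 1 / (1 - 1 / real p)" .
    qed simp
    also have "\<dots> = 1 / (real p - 1)" using p by (simp add: field_simps)
    finally show "(\<Sum>e\<in>{1..N}. (1 / real p) ^ e) \<le> 1 / (real p - 1)" .
    show "(\<Sum>m\<in>Y. 1 / real m) \<le> (\<Prod>p\<in>A. 1 / (real p - 1))"
      unfolding Y_def by (rule insert.IH) (use insert.prems in auto)
  qed (use p in \<open>auto intro!: sum_nonneg\<close>)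
  finally show ?case using insert.hyps by (simp add: X_def)
qed

text \<open>The product of the distinct prime factors divides \<open>n\<close>.\<close>

lemma lnsum_prime_factors_le:
  assumes "1 \<le> n" shows "lnsum (prime_factors n) \<le> ln (real n)"
proof -
  have "lnsum (prime_factors n) = ln (real (\<Prod>p\<in>prime_factors n. p))"
    unfolding lnsum_def of_nat_prod by (subst ln_prod) (auto simp: in_prime_factors_iff prime_gt_0_nat)
  moreover have "(\<Prod>p\<in>prime_factors n. p) dvd n"
  proof -
    have "(\<Prod>p\<in>prime_factors n. p) dvd (\<Prod>p\<in>prime_factors n. p ^ multiplicity p n)"
      by (intro prod_dvd_prod dvd_power) (auto simp: prime_factors_multiplicity)
    also have "\<dots> = n" using assms by (simp add: prod_prime_factors)
    finally show ?thesis .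
  qed
  moreover from this have "(\<Prod>p\<in>prime_factors n. p) \<le> n" using assms by (auto intro: dvd_imp_le)
  moreover have "0 < (\<Prod>p\<in>prime_factors n. p)"
    by (rule prod_pos) (auto simp: in_prime_factors_iff prime_gt_0_nat)
  ultimately show ?thesis
    by (metis ln_mono of_nat_0_less_iff of_nat_mono)
qed

text \<open>Integers are grouped by the set \<open>T\<close> of their prime factors outside
  \<open>Z\<close>. The product of \<open>T\<close> is at most \<open>n\<close> and
  \<open>\<psi>\<close> decreases, so \<open>ln n\<close> may be replaced by \<open>lnsum T\<close>;
  higher powers and the primes of \<open>Z\<close> sum to Euler factors. With
  \<open>\<psi> = 1\<close> this contains the classical lower bound for the sum of
  \<open>1 / \<phi>(t)\<close> over squarefree \<open>t\<close> coprime to \<open>q\<close>.\<close>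

lemma sum_antimono_over_integers_le:
  fixes \<psi> :: "real \<Rightarrow> real"
  assumes Z: "finite Z" "\<And>p. p \<in> Z \<Longrightarrow> prime p"
    and anti: "\<And>s t. 0 \<le> s \<Longrightarrow> s \<le> t \<Longrightarrow> t \<le> Y \<Longrightarrow> \<psi> t \<le> \<psi> s"
    and pos: "\<And>s. 0 \<le> s \<Longrightarrow> s \<le> Y \<Longrightarrow> 0 \<le> \<psi> s"
  shows "(\<Sum>n | 1 \<le> n \<and> ln (real n) \<le> Y. \<psi> (ln (real n)) / real n)
    \<le> (\<Prod>p\<in>Z. real p / (real p - 1)) *
       (\<Sum>T | T \<in> prime_sets 0 Y \<and> T \<inter> Z = {}. (\<Prod>p\<in>T. 1 / (real p - 1)) * \<psi> (lnsum T))"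
proof -
  define NN where "NN = {n::nat. 1 \<le> n \<and> ln (real n) \<le> Y}"
  define TT where "TT = {T. T \<in> prime_sets 0 Y \<and> T \<inter> Z = {}}"
  define \<tau> where "\<tau> = (\<lambda>n. prime_factors n - Z)"
  have NNle: "NN \<subseteq> {1..nat \<lfloor>exp Y\<rfloor>}"
  proof
    fix n assume n: "n \<in> NN"
    then have "real n \<le> exp Y" unfolding NN_def
      by (metis (mono_tags, lifting) exp_le_cancel_iff exp_ln mem_Collect_eq of_nat_0_less_iff less_le_trans zero_less_one)
    then have "n \<le> nat \<lfloor>exp Y\<rfloor>" by linarith
    then show "n \<in> {1..nat \<lfloor>exp Y\<rfloor>}" using n by (simp add: NN_def)
  qed
  have finN: "finite NN" by (rule finite_subset[OF NNle]) simp
  have finT: "finite TT" by (rule finite_subset[OF _ finite_prime_sets[of 0 Y]]) (auto simp: TT_def)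
  have ln\<tau>: "lnsum (\<tau> n) \<le> ln (real n)" if "n \<in> NN" for n
  proof -
    have "lnsum (\<tau> n) \<le> lnsum (prime_factors n)" unfolding \<tau>_def
      by (rule lnsum_mono) (auto simp: in_prime_factors_iff)
    then show ?thesis using lnsum_prime_factors_le[of n] that by (auto simp: NN_def)
  qed
  have \<tau>: "\<tau> n \<in> TT" if "n \<in> NN" for n
    using ln\<tau>[OF that] that
    by (auto simp: TT_def NN_def prime_sets_def \<tau>_def in_prime_factors_iff prime_gt_0_nat)
  \<comment> \<open>In one fibre the prime factors inside \<open>Z\<close> form an arbitrary subset
    \<open>W\<close>; summing over \<open>W\<close> gives the product of
    \<open>1 + 1 / (p - 1)\<close>.\<close>
  have fib: "(\<Sum>n\<in>{n\<in>NN. \<tau> n = T}. 1 / real n) \<le> (\<Prod>p\<in>T. 1 / (real p - 1)) * (\<Prod>p\<in>Z. real p / (real p - 1))"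
    if T: "T \<in> TT" for T
  proof -
    have Tf: "finite T" "\<And>p. p \<in> T \<Longrightarrow> prime p" "T \<inter> Z = {}"
      using T prime_setsD[of T 0 Y] by (auto simp: TT_def)
    have "(\<Sum>n\<in>{n\<in>NN. \<tau> n = T}. 1 / real n)
       \<le> (\<Sum>n\<in>(\<Union>W\<in>Pow Z. {n. n \<in> {1..nat \<lfloor>exp Y\<rfloor>} \<and> prime_factors n = T \<union> W}). 1 / real n)"
    proof (rule sum_mono2)
      show "{n \<in> NN. \<tau> n = T} \<subseteq> (\<Union>W\<in>Pow Z. {n. n \<in> {1..nat \<lfloor>exp Y\<rfloor>} \<and> prime_factors n = T \<union> W})"
      proof
        fix n assume n: "n \<in> {n \<in> NN. \<tau> n = T}"
        then have "prime_factors n = T \<union> (prime_factors n \<inter> Z)" by (auto simp: \<tau>_def)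
        then show "n \<in> (\<Union>W\<in>Pow Z. {n. n \<in> {1..nat \<lfloor>exp Y\<rfloor>} \<and> prime_factors n = T \<union> W})"
          using n NNle by blast
      qed
    qed (use Z in auto)
    also have "\<dots> = (\<Sum>W\<in>Pow Z. \<Sum>n | n \<in> {1..nat \<lfloor>exp Y\<rfloor>} \<and> prime_factors n = T \<union> W. 1 / real n)"
    proof (rule sum.UNION_disjoint)
      show "\<forall>W\<in>Pow Z. \<forall>W'\<in>Pow Z. W \<noteq> W' \<longrightarrow> {n \<in> {1..nat \<lfloor>exp Y\<rfloor>}. prime_factors n = T \<union> W} \<inter>
          {n \<in> {1..nat \<lfloor>exp Y\<rfloor>}. prime_factors n = T \<union> W'} = {}"
      proof (intro ballI impI)
        fix W W' assume W: "W \<in> Pow Z" "W' \<in> Pow Z" "W \<noteq> W'"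
        have "W = (T \<union> W) \<inter> Z" "W' = (T \<union> W') \<inter> Z" using W Tf(3) by auto
        then have "T \<union> W \<noteq> T \<union> W'" using W(3) by metis
        then show "{n \<in> {1..nat \<lfloor>exp Y\<rfloor>}. prime_factors n = T \<union> W} \<inter>
          {n \<in> {1..nat \<lfloor>exp Y\<rfloor>}. prime_factors n = T \<union> W'} = {}" by auto
      qed
    qed (use Z in auto)
    also have "\<dots> \<le> (\<Sum>W\<in>Pow Z. \<Prod>p\<in>T \<union> W. 1 / (real p - 1))"
      by (intro sum_mono sum_inverse_same_prime_factors) (use Z Tf in \<open>auto intro: finite_subset\<close>)
    also have "\<dots> = (\<Sum>W\<in>Pow Z. (\<Prod>p\<in>T. 1 / (real p - 1)) * (\<Prod>p\<in>W. 1 / (real p - 1)))"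
      by (intro sum.cong refl prod.union_disjoint) (use Z Tf in \<open>auto intro: finite_subset\<close>)
    also have "\<dots> = (\<Prod>p\<in>T. 1 / (real p - 1)) * (\<Prod>p\<in>Z. 1 + 1 / (real p - 1))"
      by (simp add: prod_one_plus_Pow[OF Z(1)] sum_distrib_left)
    also have "(\<Prod>p\<in>Z. 1 + 1 / (real p - 1)) = (\<Prod>p\<in>Z. real p / (real p - 1))"
    proof (rule prod.cong[OF refl])
      fix p assume "p \<in> Z"
      then have "1 < real p" using prime_gt_1_nat[OF Z(2)] by simp
      then show "1 + 1 / (real p - 1) = real p / (real p - 1)" by (simp add: field_simps)
    qed
    finally show ?thesis .
  qed
  have "(\<Sum>n\<in>NN. \<psi> (ln (real n)) / real n) \<le> (\<Sum>n\<in>NN. \<psi> (lnsum (\<tau> n)) * (1 / real n))"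
  proof (rule sum_mono)
    fix n assume n: "n \<in> NN"
    have "0 \<le> lnsum (\<tau> n)" by (rule lnsum_nonneg) (auto simp: \<tau>_def in_prime_factors_iff)
    then have "\<psi> (ln (real n)) \<le> \<psi> (lnsum (\<tau> n))"
      using ln\<tau>[OF n] n by (intro anti) (auto simp: NN_def)
    then show "\<psi> (ln (real n)) / real n \<le> \<psi> (lnsum (\<tau> n)) * (1 / real n)"
      by (simp add: divide_right_mono)
  qed
  also have "\<dots> = (\<Sum>T\<in>TT. \<Sum>n\<in>{n\<in>NN. \<tau> n = T}. \<psi> (lnsum (\<tau> n)) * (1 / real n))"
    by (rule sum.group[symmetric]) (use finN finT \<tau> in auto)
  also have "\<dots> = (\<Sum>T\<in>TT. \<psi> (lnsum T) * (\<Sum>n\<in>{n\<in>NN. \<tau> n = T}. 1 / real n))"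
    unfolding sum_distrib_left by (intro sum.cong) auto
  also have "\<dots> \<le> (\<Sum>T\<in>TT. \<psi> (lnsum T) * ((\<Prod>p\<in>T. 1 / (real p - 1)) * (\<Prod>p\<in>Z. real p / (real p - 1))))"
  proof (intro sum_mono mult_left_mono fib)
    fix T assume "T \<in> TT"
    then show "0 \<le> \<psi> (lnsum T)" using prime_setsD[of T 0 Y] by (intro pos) (auto simp: TT_def)
  qed
  finally show ?thesis
    unfolding NN_def TT_def by (simp add: sum_distrib_left mult_ac)
qed

text \<open>Comparison with the integral of \<open>1 + c * u\<close>, with antiderivative
  \<open>G\<close>, along the points \<open>u = Y - ln n\<close>: neighbouring points are at most
  \<open>1 / n\<close> apart and the integrand is bounded by its value at the point of index
  \<open>n\<close>. Hence no error term.\<close>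

lemma sum_linear_log_ge:
  fixes c Y :: real
  assumes c: "0 \<le> c" and Y: "0 \<le> Y"
  shows "Y + c * Y\<^sup>2 / 2 \<le> (\<Sum>n | 1 \<le> n \<and> ln (real n) \<le> Y. (1 + c * (Y - ln (real n))) / real n)"
proof -
  define G where "G = (\<lambda>u::real. u + c * u\<^sup>2 / 2)"
  define N where "N = nat \<lfloor>exp Y\<rfloor>"
  have N: "1 \<le> N" "real N \<le> exp Y" "exp Y < real N + 1"
  proof -
    have "1 \<le> exp Y" using Y by simp
    then have "1 \<le> \<lfloor>exp Y\<rfloor>" by (simp add: le_floor_iff)
    then show "1 \<le> N" unfolding N_def by linarith
    show "real N \<le> exp Y" "exp Y < real N + 1" unfolding N_def using \<open>1 \<le> \<lfloor>exp Y\<rfloor>\<close> by linarith+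
  qed
  have set: "{n. 1 \<le> n \<and> ln (real n) \<le> Y} = {1..N}"
  proof (intro equalityI subsetI)
    fix n assume "n \<in> {n. 1 \<le> n \<and> ln (real n) \<le> Y}"
    then have n: "1 \<le> n" "ln (real n) \<le> Y" by auto
    then have "real n \<le> exp Y" by (metis exp_le_cancel_iff exp_ln of_nat_0_less_iff less_le_trans zero_less_one)
    then show "n \<in> {1..N}" using n N by auto
  next
    fix n assume "n \<in> {1..N}"
    then have n: "1 \<le> n" "real n \<le> exp Y" using N by auto
    then have "ln (real n) \<le> Y" by (metis ln_exp ln_mono of_nat_0_less_iff less_le_trans zero_less_one)
    then show "n \<in> {n. 1 \<le> n \<and> ln (real n) \<le> Y}" using n by simp
  qed
  have lnY: "ln (real n) \<le> Y" if "1 \<le> n" "n \<le> N" for n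
    using equalityD2[OF set] that by auto
  have G: "G u - G (u - d) \<le> (1 + c * u) / m" if "0 \<le> d" "d \<le> 1 / m" "0 \<le> u" for u d m :: real
  proof -
    have "G u - G (u - d) = d * (1 + c * u) - c * d\<^sup>2 / 2"
      by (simp add: G_def power2_eq_square field_simps)
    also have "\<dots> \<le> d * (1 + c * u)" using c by simp
    also have "\<dots> \<le> 1 / m * (1 + c * u)" using that c by (intro mult_right_mono) auto
    finally show ?thesis by simp
  qed
  have ind: "m \<le> N \<Longrightarrow> G Y - G (Y - ln (real m)) \<le> (\<Sum>n\<in>{1..<m}. (1 + c * (Y - ln (real n))) / real n)" if "1 \<le> m" for m
    using that
  proof (induction m rule: dec_induct)
    case base
    then show ?case by simp
  next
    case (step m)
    have m: "1 \<le> m" "Suc m \<le> N" using step.hyps step.prems by auto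
    then have "ln (real m) \<le> Y" by (intro lnY) auto
    have d: "ln (real (Suc m)) - ln (real m) \<le> 1 / real m"
    proof -
      have "ln (real (Suc m)) - ln (real m) = ln (1 + 1 / real m)"
        using m ln_div[of "real (Suc m)" "real m"] by (simp add: add_divide_distrib add.commute)
      also have "\<dots> \<le> 1 / real m" by (rule ln_add_one_self_le_self) simp
      finally show ?thesis .
    qed
    have "G (Y - ln (real m)) - G (Y - ln (real m) - (ln (real (Suc m)) - ln (real m))) \<le> (1 + c * (Y - ln (real m))) / real m"
      by (rule G) (use m d \<open>ln (real m) \<le> Y\<close> in auto)
    moreover have "G Y - G (Y - ln (real m)) \<le> (\<Sum>n\<in>{1..<m}. (1 + c * (Y - ln (real n))) / real n)"
      by (rule step.IH) (use m in simp)
    ultimately show ?case using m by (simp add: sum.atLeastLessThan_Suc)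
  qed
  \<comment> \<open>The last, incomplete step: \<open>exp Y < N + 1\<close> keeps the gap between
    \<open>ln N\<close> and \<open>Y\<close> below \<open>1 / N\<close>.\<close>
  have last: "G (Y - ln (real N)) - G 0 \<le> (1 + c * (Y - ln (real N))) / real N"
  proof -
    have le: "ln (real N) \<le> Y" using N by (intro lnY) auto
    have "Y \<le> ln (real N + 1)" using ln_mono[of "exp Y" "real N + 1"] N by simp
    also have "\<dots> = ln (real N) + ln (1 + 1 / real N)"
      using N ln_div[of "real N + 1" "real N"] by (simp add: add_divide_distrib add.commute)
    also have "\<dots> \<le> ln (real N) + 1 / real N" using ln_add_one_self_le_self[of "1 / real N"] by simp
    finally have "Y - ln (real N) \<le> 1 / real N" by simp
    then show ?thesis using G[of "Y - ln (real N)" "real N" "Y - ln (real N)"] le by simp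
  qed
  have "G Y - G 0 \<le> (\<Sum>n\<in>{1..<N}. (1 + c * (Y - ln (real n))) / real n) + (1 + c * (Y - ln (real N))) / real N"
    using ind[OF N(1) order_refl] last by linarith
  also have "\<dots> = (\<Sum>n\<in>{1..N}. (1 + c * (Y - ln (real n))) / real n)"
  proof -
    have "{1..N} = insert N {1..<N}" using N by auto
    then show ?thesis by simp
  qed
  finally show ?thesis unfolding set by (simp add: G_def)
qed

text \<open>The excluded set is taken to be the primes of \<open>S\<close> together with those up to
  \<open>B\<close>; avoiding them costs the two Euler products on the right.\<close>

lemma inner_sum_lower_bound:
  assumes S: "S \<in> prime_sets B L" and c: "0 \<le> c"
  shows "(L - lnsum S) + c * (L - lnsum S)\<^sup>2 / 2
    \<le> (\<Prod>p\<in>S. real p / (real p - 1)) * (\<Prod>p | prime p \<and> p \<le> B. real p / (real p - 1)) *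
      (\<Sum>T | S \<inter> T = {} \<and> S \<union> T \<in> prime_sets B L. (\<Prod>p\<in>T. 1 / (real p - 1)) * (1 + c * (L - lnsum (S \<union> T))))"
proof -
  note D = prime_setsD[OF S]
  define Z where "Z = S \<union> {p. prime p \<and> p \<le> B}"
  have finB: "finite {p. prime p \<and> p \<le> B}" by (rule finite_subset[of _ "{..B}"]) auto
  have disj: "S \<inter> {p. prime p \<and> p \<le> B} = {}" using D by force
  define Y where "Y = L - lnsum S"
  have Y: "0 \<le> Y" using D by (simp add: Y_def)
  have "Y + c * Y\<^sup>2 / 2 \<le> (\<Sum>n | 1 \<le> n \<and> ln (real n) \<le> Y. (1 + c * (Y - ln (real n))) / real n)"
    by (rule sum_linear_log_ge[OF c Y])
  also have "\<dots> \<le> (\<Prod>p\<in>Z. real p / (real p - 1)) *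
       (\<Sum>T | T \<in> prime_sets 0 Y \<and> T \<inter> Z = {}. (\<Prod>p\<in>T. 1 / (real p - 1)) * (1 + c * (Y - lnsum T)))"
    by (rule sum_antimono_over_integers_le[where \<psi> = "\<lambda>s. 1 + c * (Y - s)"])
       (use D finB c in \<open>auto simp: Z_def intro!: mult_left_mono\<close>)
  also have "{T. T \<in> prime_sets 0 Y \<and> T \<inter> Z = {}} = {T. S \<inter> T = {} \<and> S \<union> T \<in> prime_sets B L}"
  proof (intro equalityI subsetI)
    fix T assume "T \<in> {T. T \<in> prime_sets 0 Y \<and> T \<inter> Z = {}}"
    then have T: "T \<in> prime_sets 0 Y" "T \<inter> Z = {}" by auto
    note D' = prime_setsD[OF T(1)]
    have "B < p" if "p \<in> T" for p
    proof (rule ccontr)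
      assume "\<not> B < p"
      then have "p \<in> Z" using D'(2)[OF that] by (simp add: Z_def)
      then show False using T(2) that by blast
    qed
    moreover have "S \<inter> T = {}" using T(2) by (auto simp: Z_def)
    ultimately show "T \<in> {T. S \<inter> T = {} \<and> S \<union> T \<in> prime_sets B L}"
      using T D D' lnsum_Un[of S T] by (auto simp: prime_sets_def Z_def Y_def)
  next
    fix T assume "T \<in> {T. S \<inter> T = {} \<and> S \<union> T \<in> prime_sets B L}"
    then have T: "S \<inter> T = {}" "S \<union> T \<in> prime_sets B L" by auto
    note D' = prime_setsD[OF T(2)]
    have *: "finite T" "p \<in> T \<Longrightarrow> prime p \<and> B < p" for p using D' by auto
    then have "lnsum T \<le> Y" using lnsum_Un[of S T] T D D' by (simp add: Y_def)
    then show "T \<in> {T. T \<in> prime_sets 0 Y \<and> T \<inter> Z = {}}"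
    proof -
      have "p \<notin> Z" "0 < p" if "p \<in> T" for p
        using *(2)[OF that] T(1) that by (auto simp: Z_def)
      then show ?thesis using * \<open>lnsum T \<le> Y\<close> by (auto simp: prime_sets_def)
    qed
  qed
  also have "(\<Sum>T | S \<inter> T = {} \<and> S \<union> T \<in> prime_sets B L. (\<Prod>p\<in>T. 1 / (real p - 1)) * (1 + c * (Y - lnsum T)))
    = (\<Sum>T | S \<inter> T = {} \<and> S \<union> T \<in> prime_sets B L. (\<Prod>p\<in>T. 1 / (real p - 1)) * (1 + c * (L - lnsum (S \<union> T))))"
  proof (intro sum.cong refl)
    fix T assume "T \<in> {T. S \<inter> T = {} \<and> S \<union> T \<in> prime_sets B L}"
    then have "lnsum (S \<union> T) = lnsum S + lnsum T"
      using prime_setsD(1)[of "S \<union> T" B L] by (intro lnsum_Un) auto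
    then show "(\<Prod>p\<in>T. 1 / (real p - 1)) * (1 + c * (Y - lnsum T)) =
        (\<Prod>p\<in>T. 1 / (real p - 1)) * (1 + c * (L - lnsum (S \<union> T)))"
      by (simp add: Y_def algebra_simps)
  qed
  finally show ?thesis
    unfolding Z_def Y_def by (simp only: prod.union_disjoint[OF D(1) finB disj])
qed

section \<open>Mertens' theorem and negligible errors\<close>

lemma sum_inverse_le_ln:
  assumes "1 \<le> n" shows "(\<Sum>k\<in>{1..n}. 1 / real k) \<le> 1 + ln (real n)"
  using assms
proof (induction n rule: dec_induct)
  case (step n)
  have n: "1 \<le> n" by fact
  have "ln (real n / real (Suc n)) \<le> real n / real (Suc n) - 1"
    using n by (intro ln_le_minus_one) auto
  also have "\<dots> = - (1 / real (Suc n))" by (simp add: field_simps)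
  finally have "1 / real (Suc n) \<le> ln (real (Suc n)) - ln (real n)"
    using n ln_div[of "real n" "real (Suc n)"] by simp
  then show ?case using step.IH n by (simp del: of_nat_Suc)
qed auto

text \<open>Only the modulus \<open>q = 1\<close> is kept, for which condition (A) is a form of the
  prime number theorem.\<close>

lemma chebyshev_of_condA:
  assumes A: "condA \<theta>" and \<theta>: "0 < \<theta>" and \<epsilon>: "0 < \<epsilon>"
  shows "\<exists>C\<ge>0. \<forall>N. \<bar>(\<Sum>p | prime p \<and> p \<le> N. ln (real p)) - real N\<bar> \<le> \<epsilon> * real N + C"
proof -
  let ?f = "\<lambda>N. (\<Sum>p | prime p \<and> p \<le> N. ln (real p)) - real N"
  \<comment> \<open>Choosing the slack equal to \<open>\<theta>\<close> gives the bound
    \<open>N powr 0\<close>, so for positive \<open>N\<close> the range of moduli is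
    \<open>{1}\<close>.\<close>
  have "(\<lambda>N::nat. \<Sum>q\<in>{1..nat \<lfloor>real N powr (\<theta> - \<theta>)\<rfloor>}.
        Max ((\<lambda>a. \<bar>(\<Sum>p\<in>{p. prime p \<and> p \<le> N \<and> [p = a] (mod q)}. ln (real p))
                    - real N / real (totient q)\<bar>) ` {a. a < q \<and> coprime a q}))
     \<in> O(\<lambda>N. real N / ln (real N) powr 1)"
    by (rule A[unfolded condA_def, rule_format, OF \<theta> zero_less_one])
  then obtain c where c: "c > 0" "eventually (\<lambda>N. norm (\<Sum>q\<in>{1..nat \<lfloor>real N powr (\<theta> - \<theta>)\<rfloor>}.
        Max ((\<lambda>a. \<bar>(\<Sum>p\<in>{p. prime p \<and> p \<le> N \<and> [p = a] (mod q)}. ln (real p))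
                    - real N / real (totient q)\<bar>) ` {a. a < q \<and> coprime a q}))
     \<le> c * norm (real N / ln (real N) powr 1)) sequentially"
    by (elim landau_o.bigE)
  have "eventually (\<lambda>N::nat. c / \<epsilon> \<le> ln (real N)) sequentially"
    using filterlim_compose[OF ln_at_top filterlim_real_sequentially]
    by (simp add: filterlim_at_top)
  with c(2) have "eventually (\<lambda>N. \<bar>?f N\<bar> \<le> \<epsilon> * real N) sequentially"
    using eventually_ge_at_top[of 3]
  proof eventually_elim
    case (elim N)
    have "{a. a < Suc 0 \<and> coprime a (Suc 0)} = {0}" by auto
    then have "\<bar>?f N\<bar> \<le> c * \<bar>real N / ln (real N)\<bar>"
      using elim by (simp add: powr_one)
    also have "\<dots> = c / ln (real N) * real N" using elim by simp
    also have "\<dots> \<le> \<epsilon> * real N"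
    proof (rule mult_right_mono)
      have "0 < ln (real N)" using elim by simp
      then show "c / ln (real N) \<le> \<epsilon>" using elim(2) \<epsilon> by (simp add: field_simps)
    qed simp
    finally show ?case .
  qed
  then obtain N0 where N0: "\<And>N. N0 \<le> N \<Longrightarrow> \<bar>?f N\<bar> \<le> \<epsilon> * real N"
    by (auto simp: eventually_sequentially)
  \<comment> \<open>Absorbs the finitely many \<open>N\<close> below the threshold.\<close>
  define C where "C = (\<Sum>N<N0. \<bar>?f N\<bar>)"
  have "\<bar>?f N\<bar> \<le> \<epsilon> * real N + C" for N
  proof (cases "N0 \<le> N")
    case True
    have "0 \<le> C" unfolding C_def by (rule sum_nonneg) simp
    then show ?thesis using N0[OF True] by simp
  next
    case False
    then have "\<bar>?f N\<bar> \<le> C" unfolding C_def by (intro member_le_sum) auto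
    moreover have "0 \<le> \<epsilon> * real N" using \<epsilon> by simp
    ultimately show ?thesis by linarith
  qed
  moreover have "0 \<le> C" unfolding C_def by (rule sum_nonneg) simp
  ultimately show ?thesis by blast
qed

text \<open>Summation by parts: \<open>1 / p\<close> is \<open>1 / (n + 1)\<close> plus the
  telescoping sum of \<open>1 / (m * (m + 1))\<close> over \<open>p \<le> m \<le> n\<close>.\<close>

lemma abel_sum_ln_over:
  fixes \<psi> :: "nat \<Rightarrow> real"
  defines "\<psi> \<equiv> (\<lambda>n. \<Sum>p | prime p \<and> p \<le> n. ln (real p))"
  shows "(\<Sum>p | prime p \<and> p \<le> n. ln (real p) / real p)
    = \<psi> n / (real n + 1) + (\<Sum>m\<in>{1..n}. \<psi> m / (real m * (real m + 1)))"
proof (induction n)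
  case 0
  have "{p::nat. prime p \<and> p = 0} = {}" by auto
  then show ?case by (simp add: \<psi>_def)
next
  case (Suc n)
  have set: "{p. prime p \<and> p \<le> Suc n} = (if prime (Suc n) then insert (Suc n) {p. prime p \<and> p \<le> n} else {p. prime p \<and> p \<le> n})"
    by (auto simp: le_Suc_eq)
  have fin: "finite {p::nat. prime p \<and> p \<le> n}" by (rule finite_subset[of _ "{..n}"]) auto
  define d where "d = (if prime (Suc n) then ln (real (Suc n)) else 0)"
  have 1: "\<psi> (Suc n) = \<psi> n + d" unfolding \<psi>_def set d_def using fin by auto
  have 2: "(\<Sum>p | prime p \<and> p \<le> Suc n. ln (real p) / real p)
      = (\<Sum>p | prime p \<and> p \<le> n. ln (real p) / real p) + d / (real n + 1)"
    unfolding set d_def using fin by (auto simp: add.commute)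
  have alg: "t / x + d / x = (t + d) / (x + 1) + (t + d) / (x * (x + 1))" if "0 < x" for t d x :: real
  proof -
    have "(t + d) / (x + 1) + (t + d) / (x * (x + 1)) = (t + d) / x"
      using that by (simp add: divide_simps) (simp add: algebra_simps)
    then show ?thesis by (simp add: add_divide_distrib)
  qed
  show ?case unfolding 2 Suc.IH using alg[of "real n + 1" "\<psi> n" d]
    by (simp add: 1 add.commute)
qed

text \<open>In \<open>abel_sum_ln_over\<close> the function \<open>\<psi> m\<close> is replaced by
  \<open>m\<close>. This leaves a harmonic sum within 1 of \<open>x\<close>; the error
  \<open>\<epsilon> * m\<close> gives \<open>\<epsilon>\<close> times that sum, and the constant
  \<open>C\<close> meets a telescoping series.\<close>

lemma mertens_of_condA:
  assumes A: "condA \<theta>" and \<theta>: "0 < \<theta>"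
  shows mertens
  unfolding mertens_def
proof (intro allI impI)
  fix \<epsilon> :: real assume \<epsilon>: "0 < \<epsilon>"
  define \<psi> where "\<psi> = (\<lambda>n. \<Sum>p | prime p \<and> p \<le> n. ln (real p))"
  obtain C where C: "0 \<le> C" "\<And>N. \<bar>\<psi> N - real N\<bar> \<le> \<epsilon> * real N + C"
    using chebyshev_of_condA[OF A \<theta> \<epsilon>] unfolding \<psi>_def by blast
  have "\<bar>(\<Sum>p | prime p \<and> ln (real p) \<le> x. ln (real p) / real p) - x\<bar> \<le> \<epsilon> * x + (2 * C + 3 * \<epsilon> + 4)"
    if x: "0 \<le> x" for x
  proof -
    have psi: "(\<Sum>p | prime p \<and> p \<le> m. ln (real p)) = \<psi> m" for m by (simp add: \<psi>_def)
    define n where "n = nat \<lfloor>exp x\<rfloor>"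
    have "1 \<le> exp x" using x by simp
    then have "1 \<le> \<lfloor>exp x\<rfloor>" by (simp add: le_floor_iff)
    then have n: "1 \<le> n" "real n \<le> exp x" "exp x < real n + 1" unfolding n_def by linarith+
    have set: "{p. prime p \<and> ln (real p) \<le> x} = {p. prime p \<and> p \<le> n}"
    proof (intro equalityI subsetI)
      fix p assume "p \<in> {p. prime p \<and> ln (real p) \<le> x}"
      then show "p \<in> {p. prime p \<and> p \<le> n}" using ln_le_imp_le_nat_floor_exp by (auto simp: n_def)
    next
      fix p assume p: "p \<in> {p. prime p \<and> p \<le> n}"
      then have "real p \<le> exp x" "0 < real p" using n prime_gt_0_nat by auto
      then have "ln (real p) \<le> x" using ln_mono[of "real p" "exp x"] by simp
      then show "p \<in> {p. prime p \<and> ln (real p) \<le> x}" using p by simp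
    qed
    have lnx: "ln (real n) \<le> x" "x \<le> ln (real n + 1)"
      using ln_mono[of "real n" "exp x"] ln_mono[of "exp x" "real n + 1"] n by auto
    define H where "H = (\<Sum>m\<in>{1..n}. 1 / (real m + 1))"
    have H: "H \<le> x + 1" "x - 1 \<le> H"
    proof -
      have eq: "H + 1 = (\<Sum>k\<in>{1..Suc n}. 1 / real k)" unfolding H_def
        by (induction n) (auto simp: add_ac)
      have "(\<Sum>k\<in>{1..Suc n}. 1 / real k) = harm (Suc n)" unfolding harm_def by (simp add: inverse_eq_divide)
      moreover have "ln (real (Suc n) + 1) \<le> harm (Suc n)" by (rule ln_le_harm)
      moreover have "ln (real n + 1) \<le> ln (real (Suc n) + 1)" by (rule ln_mono) auto
      ultimately show "x - 1 \<le> H" using eq lnx by linarith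
      have "(\<Sum>k\<in>{1..Suc n}. 1 / real k) \<le> 1 + ln (real n) + 1 / real (Suc n)"
        using sum_inverse_le_ln[OF n(1)] n by simp
      then have "H \<le> ln (real n) + 1 / real (Suc n)" using eq by linarith
      moreover have "1 / real (Suc n) \<le> 1" by simp
      ultimately show "H \<le> x + 1" using lnx by linarith
    qed
    have t0: "0 \<le> \<psi> n / (real n + 1)" unfolding \<psi>_def
      by (intro divide_nonneg_nonneg sum_nonneg) (auto dest: prime_ln_pos)
    have t1: "\<psi> n / (real n + 1) \<le> 1 + \<epsilon> + C"
    proof -
      have "\<psi> n \<le> real n + \<epsilon> * real n + C" using C(2)[of n] by linarith
      also have "\<dots> \<le> (1 + \<epsilon> + C) * (real n + 1)" using \<epsilon> C(1) by (simp add: algebra_simps)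
      finally show ?thesis by (simp add: pos_divide_le_eq)
    qed
    have "(\<Sum>m\<in>{1..n}. \<psi> m / (real m * (real m + 1))) - H = (\<Sum>m\<in>{1..n}. (\<psi> m - real m) / (real m * (real m + 1)))"
      unfolding H_def sum_subtractf[symmetric] by (intro sum.cong refl) (simp add: diff_divide_distrib)
    also have "\<bar>\<dots>\<bar> \<le> (\<Sum>m\<in>{1..n}. \<epsilon> * (1 / (real m + 1)) + C * (1 / real m - 1 / real (Suc m)))"
    proof (rule order_trans[OF sum_abs], rule sum_mono)
      fix m assume m: "m \<in> {1..n}"
      have "\<bar>(\<psi> m - real m) / (real m * (real m + 1))\<bar> \<le> (\<epsilon> * real m + C) / (real m * (real m + 1))"
        using C(2)[of m] by (simp add: abs_divide divide_right_mono)
      also have "\<dots> = \<epsilon> * (1 / (real m + 1)) + C * (1 / real m - 1 / real (Suc m))"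
        using m by (simp add: divide_simps) (simp add: algebra_simps)
      finally show "\<bar>(\<psi> m - real m) / (real m * (real m + 1))\<bar> \<le> \<epsilon> * (1 / (real m + 1)) + C * (1 / real m - 1 / real (Suc m))" .
    qed
    also have "\<dots> = \<epsilon> * H + C * (\<Sum>m\<in>{1..n}. 1 / real m - 1 / real (Suc m))"
      unfolding H_def by (simp add: sum.distrib sum_distrib_left)
    also have "(\<Sum>m\<in>{1..n}. 1 / real m - 1 / real (Suc m)) = 1 - 1 / real (Suc n)"
    proof -
      have "(\<Sum>m\<in>{1..n}. (- 1 / real (Suc m)) - (- 1 / real m)) = - 1 / real (Suc n) - (- 1 / real 1)"
        by (rule sum_Suc_diff) (use n in auto)
      then show ?thesis by simp
    qed
    also have "\<epsilon> * H + C * (1 - 1 / real (Suc n)) \<le> \<epsilon> * (x + 1) + C * 1"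
      using H \<epsilon> C(1) by (intro add_mono mult_left_mono) auto
    finally have "\<bar>(\<Sum>m\<in>{1..n}. \<psi> m / (real m * (real m + 1))) - H\<bar> \<le> \<epsilon> * x + \<epsilon> + C" by (simp add: distrib_left)
    then show ?thesis
      unfolding set abel_sum_ln_over psi
      using t0 t1 H \<epsilon> C(1) by linarith
  qed
  then show "\<exists>C. \<forall>x\<ge>0. \<bar>(\<Sum>p | prime p \<and> ln (real p) \<le> x. ln (real p) / real p) - x\<bar> \<le> \<epsilon> * x + C"
    by blast
qed

section \<open>Divisor-type sums over sets of primes\<close>

lemma prime_factors_Prod_primes:
  assumes "finite S" "\<And>p. p \<in> S \<Longrightarrow> prime (p::nat)"
  shows "prime_factors (\<Prod>S) = S"
  using assms
proof (induction S rule: finite_induct)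
  case (insert p S)
  have "\<Prod>S \<noteq> 0" using insert.hyps insert.prems[of 0] by auto
  moreover have "prime p" "p \<noteq> 0" using insert.prems[of p] by auto
  ultimately show ?case using insert
    by (simp add: prime_factors_product prime_prime_factors)
qed auto

lemma real_Prod_primes:
  assumes "\<And>p. p \<in> S \<Longrightarrow> prime p"
  shows "real (\<Prod>S) = exp (lnsum S)"
proof (cases "finite S")
  case True
  have "exp (lnsum S) = (\<Prod>p\<in>S. exp (ln (real p)))"
    unfolding lnsum_def using True by (rule exp_sum)
  also have "\<dots> = (\<Prod>p\<in>S. real p)"
    by (intro prod.cong refl) (use assms prime_gt_0_nat in auto)
  finally show ?thesis by simp
qed (simp add: lnsum_def)

text \<open>Different sets have different products, all of them integers up to \<open>exp L\<close>,
  so a harmonic sum is an upper bound.\<close>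

lemma sum_inverse_Prod_le:
  assumes L: "0 \<le> L"
  shows "(\<Sum>Q\<in>prime_sets B L. 1 / real (\<Prod>Q)) \<le> 1 + L"
proof -
  define n where "n = nat \<lfloor>exp L\<rfloor>"
  have "1 \<le> exp L" using L by simp
  then have "1 \<le> \<lfloor>exp L\<rfloor>" by (simp add: le_floor_iff)
  then have n: "1 \<le> n" "real n \<le> exp L" unfolding n_def by linarith+
  have inj: "inj_on (\<lambda>Q. \<Prod>Q) (prime_sets B L)"
    by (rule inj_on_inverseI[where g = prime_factors]) (use prime_setsD in \<open>auto intro!: prime_factors_Prod_primes\<close>)
  have "(\<Sum>Q\<in>prime_sets B L. 1 / real (\<Prod>Q)) = (\<Sum>m\<in>(\<lambda>Q. \<Prod>Q) ` prime_sets B L. 1 / real m)"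
    by (simp add: sum.reindex[OF inj])
  also have "\<dots> \<le> (\<Sum>m\<in>{1..n}. 1 / real m)"
  proof (rule sum_mono2)
    show "(\<lambda>Q. \<Prod>Q) ` prime_sets B L \<subseteq> {1..n}"
    proof (rule image_subsetI)
      fix Q assume Q: "Q \<in> prime_sets B L"
      note D = prime_setsD[OF Q]
      have "real (\<Prod>Q) \<le> exp L" using real_Prod_primes[of Q] D by simp
      then have "\<Prod>Q \<le> n" unfolding n_def by linarith
      moreover have "0 < \<Prod>Q" by (rule prod_pos) (use D prime_gt_0_nat in auto)
      ultimately show "\<Prod>Q \<in> {1..n}" by simp
    qed
  qed auto
  also have "\<dots> \<le> 1 + ln (real n)" by (rule sum_inverse_le_ln[OF n(1)])
  also have "ln (real n) \<le> L" using ln_mono[of "real n" "exp L"] n by simp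
  finally show ?thesis by simp
qed

text \<open>The power \<open>(m + 1) ^ card Q\<close> expands over the splittings of
  \<open>Q\<close> into \<open>A\<close> and \<open>Q - A\<close> with weight
  \<open>m ^ card A\<close>; forgetting that the two parts are disjoint and jointly small bounds the
  sum by a product.\<close>

lemma sum_power_card_over_Prod_le:
  assumes L: "0 \<le> L"
  shows "(\<Sum>Q\<in>prime_sets B L. real m ^ card Q / real (\<Prod>Q)) \<le> (1 + L) ^ m"
proof (induction m)
  case 0
  \<comment> \<open>Since \<open>0 ^ 0 = 1\<close>, exactly the empty set survives.\<close>
  have "(\<Sum>Q\<in>prime_sets B L. real 0 ^ card Q / real (\<Prod>Q)) = (\<Sum>Q\<in>{{}}. real 0 ^ card Q / real (\<Prod>Q))"
  proof (rule sum.mono_neutral_right)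
    show "\<forall>Q\<in>prime_sets B L - {{}}. real 0 ^ card Q / real (\<Prod>Q) = 0"
      using prime_setsD(1) by (auto simp: power_0_left)
  qed (use L finite_prime_sets in auto)
  then show ?case by simp
next
  case (Suc m)
  define F where "F = prime_sets B L"
  have expand: "real (Suc m) ^ card Q / real (\<Prod>Q)
      = (\<Sum>A\<in>Pow Q. (real m ^ card A / real (\<Prod>A)) * (1 / real (\<Prod>(Q - A))))" if Q: "Q \<in> F" for Q
  proof -
    have fin: "finite Q" using Q prime_setsD(1) by (auto simp: F_def)
    have "real (Suc m) ^ card Q / real (\<Prod>Q) = (\<Prod>p\<in>Q. real m / real p + 1 / real p)"
      by (simp add: add_divide_distrib[symmetric] prod_dividef add.commute)
    also have "\<dots> = (\<Sum>A\<in>Pow Q. (\<Prod>p\<in>A. real m / real p) * (\<Prod>p\<in>Q-A. 1 / real p))"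
      by (rule prod_add[OF fin])
    finally show ?thesis by (simp add: prod_dividef)
  qed
  have "(\<Sum>Q\<in>F. real (Suc m) ^ card Q / real (\<Prod>Q))
     = (\<Sum>Q\<in>F. \<Sum>A\<in>Pow Q. (real m ^ card A / real (\<Prod>A)) * (1 / real (\<Prod>(Q - A))))"
    by (intro sum.cong refl expand)
  also have "\<dots> = (\<Sum>(Q, A)\<in>Sigma F Pow. (real m ^ card A / real (\<Prod>A)) * (1 / real (\<Prod>(Q - A))))"
    by (rule sum.Sigma) (auto simp: F_def finite_prime_sets dest: prime_setsD)
  also have "\<dots> = (\<Sum>(A, A')\<in>(\<lambda>(Q, A). (A, Q - A)) ` Sigma F Pow. (real m ^ card A / real (\<Prod>A)) * (1 / real (\<Prod>A')))"
  proof (subst sum.reindex)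
    show "inj_on (\<lambda>(Q, A). (A, Q - A)) (Sigma F Pow)" by (auto simp: inj_on_def)
  qed (auto intro!: sum.cong)
  also have "\<dots> \<le> (\<Sum>(A, A')\<in>F \<times> F. (real m ^ card A / real (\<Prod>A)) * (1 / real (\<Prod>A')))"
  proof (rule sum_mono2)
    show "(\<lambda>(Q, A). (A, Q - A)) ` Sigma F Pow \<subseteq> F \<times> F"
      using prime_sets_subset by (fastforce simp: F_def)
  qed (auto simp: F_def finite_prime_sets intro!: divide_nonneg_nonneg mult_nonneg_nonneg prod_nonneg)
  also have "\<dots> = (\<Sum>A\<in>F. real m ^ card A / real (\<Prod>A)) * (\<Sum>A'\<in>F. 1 / real (\<Prod>A'))"
    by (simp add: sum_product sum.cartesian_product)
  also have "\<dots> \<le> (1 + L) ^ m * (1 + L)"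
    using Suc.IH sum_inverse_Prod_le[OF L, of B] L unfolding F_def
    by (intro mult_mono) (auto intro!: sum_nonneg prod_nonneg)
  finally show ?case unfolding F_def by (simp add: mult.commute)
qed

text \<open>The average bound is unweighted, while the sieve errors carry factors
  \<open>m ^ card Q\<close>; the trivial pointwise bound is recorded to remove them. Its factor
  \<open>2 ^ card Q\<close> comes from replacing a totient by the number itself.\<close>

definition negligible_error :: "nat \<Rightarrow> real \<Rightarrow> (nat \<Rightarrow> nat set \<Rightarrow> real) \<Rightarrow> bool" where
  "negligible_error B \<eta> E \<longleftrightarrow>
     (\<exists>C. eventually (\<lambda>N. \<forall>Q\<in>prime_sets B (\<eta> * ln (real N)).
        0 \<le> E N Q \<and> E N Q \<le> C * real N * ln (real N) * 2 ^ card Q / real (\<Prod>Q)) sequentially) \<and>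
     (\<forall>A::nat. \<exists>C. eventually (\<lambda>N. (\<Sum>Q\<in>prime_sets B (\<eta> * ln (real N)). E N Q) \<le> C * real N / ln (real N) ^ A) sequentially)"

lemma filterlim_ln_nat: "filterlim (\<lambda>N::nat. ln (real N)) at_top sequentially"
  by (rule filterlim_compose[OF ln_at_top filterlim_real_sequentially])

lemma eventually_ln_ge: "eventually (\<lambda>N::nat. c \<le> ln (real N)) sequentially"
  using filterlim_ln_nat by (simp add: filterlim_at_top)

text \<open>The divisor-type weights are removed by
  \<open>2 * m ^ \<omega> \<le> m ^ (2 * \<omega>) / t + t\<close>, using the trivial bound for the first
  summand and the average bound for the second.\<close>

lemma negligible_error_weighted:
  assumes E: "negligible_error B \<eta> E" and \<eta>: "0 \<le> \<eta>"
  shows "(\<lambda>N. ln (real N) ^ D * (\<Sum>Q\<in>prime_sets B (\<eta> * ln (real N)). real m ^ card Q * E N Q) / real N) \<longlonglongrightarrow> 0"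
proof -
  \<comment> \<open>The balancing parameter is \<open>ln N ^ T\<close>. The trivial part costs
    \<open>D + 1 + 2 * m^2\<close> logarithms, the exponent of the divisor sum being
    \<open>m ^ 2\<close> times the 2 of the pointwise bound, so one logarithm is saved; the exponent
    \<open>D + T + 1\<close> below does the same for the other part.\<close>
  define T where "T = D + 2 * m\<^sup>2 + 2"
  obtain C1 where C1: "eventually (\<lambda>N. \<forall>Q\<in>prime_sets B (\<eta> * ln (real N)).
        0 \<le> E N Q \<and> E N Q \<le> C1 * real N * ln (real N) * 2 ^ card Q / real (\<Prod>Q)) sequentially"
    using E unfolding negligible_error_def by blast
  obtain C2 where C2: "eventually (\<lambda>N. (\<Sum>Q\<in>prime_sets B (\<eta> * ln (real N)). E N Q) \<le> C2 * real N / ln (real N) ^ (D + T + 1)) sequentially"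
    using E unfolding negligible_error_def by blast
  define C where "C = \<bar>C1\<bar> * (1 + \<eta>) ^ (2 * m\<^sup>2) + \<bar>C2\<bar>"
  have "eventually (\<lambda>N. norm (ln (real N) ^ D * (\<Sum>Q\<in>prime_sets B (\<eta> * ln (real N)). real m ^ card Q * E N Q) / real N)
      \<le> C / ln (real N)) sequentially"
    using C1 C2 eventually_ln_ge[of 1] eventually_gt_at_top[of 0]
  proof eventually_elim
    case (elim N)
    define l where "l = ln (real N)"
    define F where "F = prime_sets B (\<eta> * l)"
    have l1: "1 \<le> l" using elim(3) by (simp only: l_def)
    then have l: "1 \<le> l" "0 < l" by linarith+
    have N: "0 < real N" using elim by simp
    have E0: "0 \<le> E N Q" and E1: "E N Q \<le> C1 * real N * l * 2 ^ card Q / real (\<Prod>Q)" if "Q \<in> F" for Q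
      using elim(1) that by (auto simp: F_def l_def)
    have E2: "(\<Sum>Q\<in>F. E N Q) \<le> \<bar>C2\<bar> * real N / l ^ (D + T + 1)"
    proof -
      have "(\<Sum>Q\<in>F. E N Q) \<le> C2 * real N / l ^ (D + T + 1)" using elim(2) by (simp add: F_def l_def)
      also have "\<dots> \<le> \<bar>C2\<bar> * real N / l ^ (D + T + 1)"
        using l N by (intro divide_right_mono mult_right_mono) auto
      finally show ?thesis .
    qed
    have "(\<Sum>Q\<in>F. real m ^ card Q * E N Q) \<le> (\<Sum>Q\<in>F. (real m ^ card Q)\<^sup>2 / l ^ T * E N Q + l ^ T * E N Q)"
    proof (rule sum_mono)
      fix Q assume Q: "Q \<in> F"
      have amgm: "y \<le> y\<^sup>2 / t + t" if "0 < t" for y t :: real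
      proof -
        have "y * t \<le> y\<^sup>2 + t\<^sup>2" using zero_le_power2[of "y - t"] zero_le_power2[of y] zero_le_power2[of t]
          unfolding power2_diff by linarith
        then show ?thesis using that by (simp add: field_simps power2_eq_square)
      qed
      have "real m ^ card Q * E N Q \<le> ((real m ^ card Q)\<^sup>2 / l ^ T + l ^ T) * E N Q"
        by (intro mult_right_mono amgm E0 Q) (use l in auto)
      then show "real m ^ card Q * E N Q \<le> (real m ^ card Q)\<^sup>2 / l ^ T * E N Q + l ^ T * E N Q"
        by (simp add: distrib_right)
    qed
    also have "\<dots> = (\<Sum>Q\<in>F. (real m ^ card Q)\<^sup>2 / l ^ T * E N Q) + l ^ T * (\<Sum>Q\<in>F. E N Q)"
      by (simp add: sum.distrib sum_distrib_left)
    also have "\<dots> \<le> \<bar>C1\<bar> * real N * l / l ^ T * (\<Sum>Q\<in>F. real (2 * m\<^sup>2) ^ card Q / real (\<Prod>Q)) + l ^ T * (\<Sum>Q\<in>F. E N Q)"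
    proof (rule add_right_mono, unfold sum_distrib_left, rule sum_mono)
      fix Q assume Q: "Q \<in> F"
      have "(real m ^ card Q)\<^sup>2 / l ^ T * E N Q \<le> (real m ^ card Q)\<^sup>2 / l ^ T * (\<bar>C1\<bar> * real N * l * 2 ^ card Q / real (\<Prod>Q))"
      proof (rule mult_left_mono)
        have "C1 * real N * l * 2 ^ card Q / real (\<Prod>Q) \<le> \<bar>C1\<bar> * real N * l * 2 ^ card Q / real (\<Prod>Q)"
          using l N by (intro divide_right_mono mult_right_mono) (auto intro: prod_nonneg)
        then show "E N Q \<le> \<bar>C1\<bar> * real N * l * 2 ^ card Q / real (\<Prod>Q)" by (rule order_trans[OF E1[OF Q]])
      qed (use l in auto)
      also have "\<dots> = \<bar>C1\<bar> * real N * l / l ^ T * (((real m ^ card Q)\<^sup>2 * 2 ^ card Q) / real (\<Prod>Q))"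
        by simp
      also have "(real m ^ card Q)\<^sup>2 * 2 ^ card Q = real (2 * m\<^sup>2) ^ card Q"
        by (simp add: power_mult_distrib power_mult[symmetric] mult.commute)
      finally show "(real m ^ card Q)\<^sup>2 / l ^ T * E N Q \<le> \<bar>C1\<bar> * real N * l / l ^ T * (real (2 * m\<^sup>2) ^ card Q / real (\<Prod>Q))" .
    qed
    also have "\<dots> \<le> \<bar>C1\<bar> * real N * l / l ^ T * ((1 + \<eta>) * l) ^ (2 * m\<^sup>2) + l ^ T * (\<bar>C2\<bar> * real N / l ^ (D + T + 1))"
    proof (intro add_mono mult_left_mono E2)
      have "(\<Sum>Q\<in>F. real (2 * m\<^sup>2) ^ card Q / real (\<Prod>Q)) \<le> (1 + \<eta> * l) ^ (2 * m\<^sup>2)"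
        unfolding F_def by (rule sum_power_card_over_Prod_le) (use \<eta> l in auto)
      also have "\<dots> \<le> ((1 + \<eta>) * l) ^ (2 * m\<^sup>2)"
        using \<eta> l by (intro power_mono) (auto simp: distrib_right)
      finally show "(\<Sum>Q\<in>F. real (2 * m\<^sup>2) ^ card Q / real (\<Prod>Q)) \<le> ((1 + \<eta>) * l) ^ (2 * m\<^sup>2)" .
    qed (use l N in auto)
    finally have "l ^ D * (\<Sum>Q\<in>F. real m ^ card Q * E N Q) / real N \<le>
       l ^ D * (\<bar>C1\<bar> * real N * l / l ^ T * ((1 + \<eta>) * l) ^ (2 * m\<^sup>2) + l ^ T * (\<bar>C2\<bar> * real N / l ^ (D + T + 1))) / real N"
      using l N by (intro divide_right_mono mult_left_mono) auto
    also have "\<dots> = \<bar>C1\<bar> * (1 + \<eta>) ^ (2 * m\<^sup>2) * (l ^ D * l * l ^ (2 * m\<^sup>2) / l ^ T) + \<bar>C2\<bar> * (l ^ D * l ^ T / l ^ (D + T + 1))"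
      using N unfolding power_mult_distrib by (simp add: field_simps)
    also have "l ^ D * l * l ^ (2 * m\<^sup>2) / l ^ T = 1 / l"
      using l unfolding T_def by (simp add: power_add)
    also have "l ^ D * l ^ T / l ^ (D + T + 1) = 1 / l"
      using l by (simp add: power_add)
    finally have "l ^ D * (\<Sum>Q\<in>F. real m ^ card Q * E N Q) / real N \<le> C / l"
      unfolding C_def by (simp add: add_divide_distrib)
    moreover have "0 \<le> l ^ D * (\<Sum>Q\<in>F. real m ^ card Q * E N Q) / real N"
      using l N E0 by (intro divide_nonneg_nonneg mult_nonneg_nonneg sum_nonneg) auto
    ultimately show ?case by (simp add: F_def l_def)
  qed
  moreover have "(\<lambda>N::nat. C / ln (real N)) \<longlonglongrightarrow> 0"
    by (rule tendsto_divide_0[OF tendsto_const filterlim_at_top_imp_at_infinity[OF filterlim_ln_nat]])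
  ultimately show ?thesis by (rule Lim_null_comparison)
qed

section \<open>Weighted sums over residue classes\<close>

lemma crt_class:
  fixes \<rho> :: "nat \<Rightarrow> nat"
  assumes "finite A" "\<And>p. p \<in> A \<Longrightarrow> prime p"
  obtains x where "\<And>n. (\<forall>p\<in>A. [n = \<rho> p] (mod p)) \<longleftrightarrow> [n = x] (mod \<Prod>A)"
proof -
  have cop: "\<forall>i\<in>A. \<forall>j\<in>A. i \<noteq> j \<longrightarrow> coprime i j"
    using assms by (auto intro: primes_coprime)
  obtain x where x: "\<forall>i\<in>A. [x = \<rho> i] (mod i)"
    using chinese_remainder_nat[OF assms(1), of "\<lambda>p. p" \<rho>] cop by blast
  have "(\<forall>p\<in>A. [n = \<rho> p] (mod p)) \<longleftrightarrow> [n = x] (mod \<Prod>A)" for n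
  proof
    assume n: "\<forall>p\<in>A. [n = \<rho> p] (mod p)"
    show "[n = x] (mod \<Prod>A)"
    proof (rule coprime_cong_prod_nat)
      show "coprime i j" if "i \<in> A" "j \<in> A" "i \<noteq> j" for i j using cop that by blast
      show "[n = x] (mod i)" if "i \<in> A" for i
        using n x that by (meson cong_sym cong_trans)
    qed
  next
    assume n: "[n = x] (mod \<Prod>A)"
    show "\<forall>p\<in>A. [n = \<rho> p] (mod p)"
    proof
      fix p assume p: "p \<in> A"
      then have "p dvd \<Prod>A" using dvd_prodI[OF assms(1), of p "\<lambda>p. p"] by simp
      then have "[n = x] (mod p)" by (rule cong_dvd_modulus_nat[OF n])
      then show "[n = \<rho> p] (mod p)" using x p by (meson cong_trans)
    qed
  qed
  then show ?thesis by (rule that)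
qed

text \<open>The class of \<open>-h\<close> modulo \<open>p\<close> in natural numbers;
  \<open>h < p\<close> prevents the subtraction from being truncated.\<close>

lemma cong_complement_iff:
  assumes "h < p"
  shows "[n = p - h] (mod p) \<longleftrightarrow> p dvd n + (h::nat)"
proof -
  have "[n = p - h] (mod p) \<longleftrightarrow> [n + h = (p - h) + h] (mod p)"
    by (simp only: cong_add_rcancel_nat)
  also have "\<dots> \<longleftrightarrow> [n + h = 0] (mod p)" using assms by (simp add: cong_def)
  finally show ?thesis by (simp add: cong_0_iff)
qed

text \<open>A set is the union of two of its subsets in at most as many ways as there are pairs of
  subsets; the exact count \<open>3 ^ card Q\<close> would gain nothing.\<close>

lemma sum_union_pairs_le:
  fixes \<Phi> :: "'a set \<Rightarrow> real"
  assumes F: "finite F" "\<And>S. S \<in> F \<Longrightarrow> finite S" and G: "finite G" "\<And>S. S \<in> G \<Longrightarrow> finite S"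
    and FG: "\<And>D E. D \<in> F \<Longrightarrow> E \<in> F \<Longrightarrow> D \<union> E \<in> G" and \<Phi>: "\<And>Q. Q \<in> G \<Longrightarrow> 0 \<le> \<Phi> Q"
  shows "(\<Sum>D\<in>F. \<Sum>E\<in>F. \<Phi> (D \<union> E)) \<le> (\<Sum>Q\<in>G. 4 ^ card Q * \<Phi> Q)"
proof -
  have "(\<Sum>D\<in>F. \<Sum>E\<in>F. \<Phi> (D \<union> E)) = (\<Sum>x\<in>F \<times> F. \<Phi> (fst x \<union> snd x))"
    by (simp add: sum.cartesian_product case_prod_beta)
  also have "\<dots> = (\<Sum>Q\<in>G. \<Sum>x\<in>{x\<in>F \<times> F. fst x \<union> snd x = Q}. \<Phi> (fst x \<union> snd x))"
  proof (rule sum.group[symmetric])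
    show "(\<lambda>x. fst x \<union> snd x) ` (F \<times> F) \<subseteq> G" using FG by auto
  qed (simp_all add: F(1) G(1))
  also have "\<dots> = (\<Sum>Q\<in>G. real (card {x\<in>F \<times> F. fst x \<union> snd x = Q}) * \<Phi> Q)"
    by (intro sum.cong refl) simp
  also have "\<dots> \<le> (\<Sum>Q\<in>G. 4 ^ card Q * \<Phi> Q)"
  proof (intro sum_mono mult_right_mono \<Phi>)
    fix Q assume Q: "Q \<in> G"
    have "card {x\<in>F \<times> F. fst x \<union> snd x = Q} \<le> card (Pow Q \<times> Pow Q)"
      by (rule card_mono) (use G(2)[OF Q] in auto)
    also have "\<dots> = 4 ^ card Q"
      using G(2)[OF Q] by (simp add: card_cartesian_product card_Pow power_mult_distrib[symmetric])
    finally have "real (card {x\<in>F \<times> F. fst x \<union> snd x = Q}) \<le> real (4 ^ card Q)"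
      by (rule of_nat_mono)
    then show "real (card {x\<in>F \<times> F. fst x \<union> snd x = Q}) \<le> 4 ^ card Q" by simp
  qed auto
  finally show ?thesis .
qed

lemma prime_sets_Un:
  assumes "D \<in> prime_sets B L" "E \<in> prime_sets B L"
  shows "D \<union> E \<in> prime_sets B (2 * L)"
proof -
  note D = prime_setsD[OF assms(1)] and E = prime_setsD[OF assms(2)]
  have "lnsum (D \<union> E) = lnsum D + lnsum (E - D)"
    using D E by (subst lnsum_Un[symmetric]) auto
  moreover have "lnsum (E - D) \<le> lnsum E" by (rule lnsum_mono) (use E in auto)
  ultimately show ?thesis using D E by (auto simp: prime_sets_def)
qed

text \<open>\<open>cres p\<close> is the residue class modulo a small prime \<open>p \<le> B\<close> to which \<open>n\<close> is restricted, so that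
  no \<open>n + h\<close> is divisible by \<open>p\<close>.\<close>

locale tuple_sieve =
  fixes B k :: nat and H :: "nat set" and cres :: "nat \<Rightarrow> nat"
  assumes H: "finite H" "card H = k" "\<And>h. h \<in> H \<Longrightarrow> h \<le> B"
    and k: "2 \<le> k" "2 * k \<le> B"
    and cres: "\<And>p h. prime p \<Longrightarrow> p \<le> B \<Longrightarrow> h \<in> H \<Longrightarrow> \<not> p dvd cres p + h"
begin

definition Z :: "nat set" where "Z = {p. prime p \<and> p \<le> B}"

lemma Z: "finite Z" "p \<in> Z \<Longrightarrow> prime p" "p \<in> Z \<Longrightarrow> p \<le> B"
  by (auto simp: Z_def intro: finite_subset[of _ "{..B}"])

definition good :: "nat \<Rightarrow> bool" where
  "good n \<longleftrightarrow> (\<forall>p\<in>Z. [n = cres p] (mod p))"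

text \<open>For a finite set \<open>D\<close> of primes: the product of \<open>D\<close> divides the
  product of all \<open>n + h\<close>.\<close>

definition hits :: "nat set \<Rightarrow> nat \<Rightarrow> bool" where
  "hits D n \<longleftrightarrow> (\<forall>p\<in>D. \<exists>h\<in>H. p dvd n + h)"

definition modulus :: "nat set \<Rightarrow> nat" where
  "modulus Q = \<Prod>(Q \<union> Z)"

lemma disjoint_Z: "(\<And>p. p \<in> Q \<Longrightarrow> B < p) \<Longrightarrow> Q \<inter> Z = {}"
  by (auto simp: Z_def dest: leD)

lemma modulus_eq: "finite Q \<Longrightarrow> (\<And>p. p \<in> Q \<Longrightarrow> B < p) \<Longrightarrow> modulus Q = \<Prod>Q * \<Prod>Z"
  unfolding modulus_def by (intro prod.union_disjoint Z disjoint_Z)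

text \<open>A prime \<open>p > B\<close> exceeds every \<open>h\<close>, so it divides
  \<open>n + h\<close> for at most one \<open>h\<close> in \<open>H\<close>. Hence \<open>n\<close>
  determines the choice \<open>\<sigma>\<close>, and the conditions for different choices are
  disjoint.\<close>

lemma hits_sum_choices:
  fixes f :: "nat \<Rightarrow> real"
  assumes I: "finite I" and Q: "finite Q" "\<And>p. p \<in> Q \<Longrightarrow> B < p"
  shows "(\<Sum>n | n \<in> I \<and> good n \<and> hits Q n. f n)
    = (\<Sum>\<sigma>\<in>PiE Q (\<lambda>_. H). \<Sum>n | n \<in> I \<and> good n \<and> (\<forall>p\<in>Q. p dvd n + \<sigma> p). f n)"
proof -
  have "(\<Sum>\<sigma>\<in>PiE Q (\<lambda>_. H). \<Sum>n | n \<in> I \<and> good n \<and> (\<forall>p\<in>Q. p dvd n + \<sigma> p). f n)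
     = (\<Sum>n\<in>(\<Union>\<sigma>\<in>PiE Q (\<lambda>_. H). {n. n \<in> I \<and> good n \<and> (\<forall>p\<in>Q. p dvd n + \<sigma> p)}). f n)"
  proof (rule sum.UNION_disjoint[symmetric])
    show "\<forall>\<sigma>\<in>PiE Q (\<lambda>_. H). \<forall>\<tau>\<in>PiE Q (\<lambda>_. H). \<sigma> \<noteq> \<tau> \<longrightarrow>
       {n. n \<in> I \<and> good n \<and> (\<forall>p\<in>Q. p dvd n + \<sigma> p)} \<inter> {n. n \<in> I \<and> good n \<and> (\<forall>p\<in>Q. p dvd n + \<tau> p)} = {}"
    proof (intro ballI impI)
      fix \<sigma> \<tau> assume \<sigma>: "\<sigma> \<in> PiE Q (\<lambda>_. H)" and \<tau>: "\<tau> \<in> PiE Q (\<lambda>_. H)" and ne: "\<sigma> \<noteq> \<tau>"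
      obtain p where p: "p \<in> Q" "\<sigma> p \<noteq> \<tau> p" using PiE_ext[OF \<sigma> \<tau>] ne by blast
      have lt: "\<sigma> p < p" "\<tau> p < p"
        using H(3)[OF PiE_mem[OF \<sigma> p(1)]] H(3)[OF PiE_mem[OF \<tau> p(1)]] Q(2)[OF p(1)] by auto
      have False if "p dvd n + \<sigma> p" "p dvd n + \<tau> p" for n
      proof -
        have "[n + \<sigma> p = n + \<tau> p] (mod p)" using that by (metis cong_0_iff cong_sym cong_trans)
        then have "[\<sigma> p = \<tau> p] (mod p)" by (simp add: cong_add_lcancel_nat)
        then show False using lt p by (simp add: cong_def)
      qed
      then show "{n. n \<in> I \<and> good n \<and> (\<forall>p\<in>Q. p dvd n + \<sigma> p)} \<inter> {n. n \<in> I \<and> good n \<and> (\<forall>p\<in>Q. p dvd n + \<tau> p)} = {}"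
        using p(1) by blast
    qed
  qed (use I Q H in \<open>auto intro!: finite_PiE\<close>)
  also have "(\<Union>\<sigma>\<in>PiE Q (\<lambda>_. H). {n. n \<in> I \<and> good n \<and> (\<forall>p\<in>Q. p dvd n + \<sigma> p)}) = {n. n \<in> I \<and> good n \<and> hits Q n}"
  proof (intro equalityI subsetI)
    fix n assume "n \<in> (\<Union>\<sigma>\<in>PiE Q (\<lambda>_. H). {n. n \<in> I \<and> good n \<and> (\<forall>p\<in>Q. p dvd n + \<sigma> p)})"
    then obtain \<sigma> where "\<sigma> \<in> PiE Q (\<lambda>_. H)" "n \<in> I" "good n" "\<forall>p\<in>Q. p dvd n + \<sigma> p" by blast
    then show "n \<in> {n. n \<in> I \<and> good n \<and> hits Q n}" unfolding hits_def using PiE_mem by blast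
  next
    fix n assume n: "n \<in> {n. n \<in> I \<and> good n \<and> hits Q n}"
    then have "\<forall>p\<in>Q. \<exists>h. h \<in> H \<and> p dvd n + h" unfolding hits_def by blast
    then obtain \<sigma> where "\<forall>p\<in>Q. \<sigma> p \<in> H \<and> p dvd n + \<sigma> p" by (rule bchoice[THEN exE])
    then have "restrict \<sigma> Q \<in> PiE Q (\<lambda>_. H)" "\<forall>p\<in>Q. p dvd n + restrict \<sigma> Q p" by auto
    then show "n \<in> (\<Union>\<sigma>\<in>PiE Q (\<lambda>_. H). {n. n \<in> I \<and> good n \<and> (\<forall>p\<in>Q. p dvd n + \<sigma> p)})" using n by blast
  qed
  finally show ?thesis by simp
qed

lemma choice_class:
  assumes Q: "finite Q" "\<And>p. p \<in> Q \<Longrightarrow> prime p" "\<And>p. p \<in> Q \<Longrightarrow> B < p" and \<sigma>: "\<sigma> \<in> PiE Q (\<lambda>_. H)"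
  obtains x where "\<And>n. (good n \<and> (\<forall>p\<in>Q. p dvd n + \<sigma> p)) \<longleftrightarrow> [n = x] (mod modulus Q)"
proof -
  define \<rho> where "\<rho> = (\<lambda>p. if p \<in> Z then cres p else p - \<sigma> p)"
  have fin: "finite (Q \<union> Z)" "\<And>p. p \<in> Q \<union> Z \<Longrightarrow> prime p" using Q Z by auto
  obtain x where x: "\<And>n. (\<forall>p\<in>Q \<union> Z. [n = \<rho> p] (mod p)) \<longleftrightarrow> [n = x] (mod \<Prod>(Q \<union> Z))"
    using crt_class[OF fin, of \<rho>] by blast
  have QZ: "p \<notin> Z" if "p \<in> Q" for p using disjoint_Z[OF Q(3)] that by blast
  have e1: "(\<forall>p\<in>Q. [n = \<rho> p] (mod p)) \<longleftrightarrow> (\<forall>p\<in>Q. p dvd n + \<sigma> p)" for n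
  proof (intro ball_cong refl)
    fix p assume p: "p \<in> Q"
    have "\<sigma> p < p" using PiE_mem[OF \<sigma> p] H(3) Q(3)[OF p] by (meson le_less_trans)
    then show "[n = \<rho> p] (mod p) \<longleftrightarrow> p dvd n + \<sigma> p"
      using QZ[OF p] by (simp add: \<rho>_def cong_complement_iff)
  qed
  have e2: "(\<forall>p\<in>Z. [n = \<rho> p] (mod p)) \<longleftrightarrow> good n" for n
    by (auto simp: \<rho>_def good_def)
  have "(good n \<and> (\<forall>p\<in>Q. p dvd n + \<sigma> p)) \<longleftrightarrow> [n = x] (mod modulus Q)" for n
    unfolding modulus_def x[symmetric] ball_Un e1 e2 by (rule conj_commute)
  then show ?thesis by (rule that)
qed

text \<open>Every choice of shifts is one residue class, by \<open>choice_class\<close>. The subset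
  \<open>H'\<close> holds the shifts that can contribute: all of \<open>H\<close> for general
  \<open>f\<close>, and \<open>H\<close> without \<open>h\<close> when \<open>f\<close> lives on the
  primes \<open>n + h\<close>.\<close>

lemma hits_sum_approx:
  fixes f :: "nat \<Rightarrow> real"
  assumes I: "finite I" and Q: "Q \<in> prime_sets B L" and H': "H' \<subseteq> H"
    and main: "\<And>\<sigma> x. \<sigma> \<in> PiE Q (\<lambda>_. H') \<Longrightarrow> (\<And>n. (good n \<and> (\<forall>p\<in>Q. p dvd n + \<sigma> p)) \<longleftrightarrow> [n = x] (mod modulus Q)) \<Longrightarrow>
        \<bar>(\<Sum>n | n \<in> I \<and> [n = x] (mod modulus Q). f n) - X\<bar> \<le> E"
    and zero: "\<And>p h n. p \<in> Q \<Longrightarrow> h \<in> H - H' \<Longrightarrow> n \<in> I \<Longrightarrow> p dvd n + h \<Longrightarrow> f n = 0"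
    and E: "0 \<le> E"
  shows "\<bar>(\<Sum>n | n \<in> I \<and> good n \<and> hits Q n. f n) - real (card H') ^ card Q * X\<bar> \<le> real k ^ card Q * E"
proof -
  note D = prime_setsD[OF Q]
  define S where "S = (\<lambda>\<sigma>. \<Sum>n | n \<in> I \<and> good n \<and> (\<forall>p\<in>Q. p dvd n + \<sigma> p). f n)"
  have fin: "finite (PiE Q (\<lambda>_. H))" "finite (PiE Q (\<lambda>_. H'))"
    using D(1) H(1) finite_subset[OF H' H(1)] by (auto intro: finite_PiE)
  have sub: "PiE Q (\<lambda>_. H') \<subseteq> PiE Q (\<lambda>_. H)" using H' by (intro PiE_mono) auto
  have "(\<Sum>n | n \<in> I \<and> good n \<and> hits Q n. f n) = (\<Sum>\<sigma>\<in>PiE Q (\<lambda>_. H). S \<sigma>)"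
    unfolding S_def by (rule hits_sum_choices) (use I D in auto)
  also have "\<dots> = (\<Sum>\<sigma>\<in>PiE Q (\<lambda>_. H'). S \<sigma>)"
  proof (rule sum.mono_neutral_right[OF fin(1) sub], rule ballI)
    fix \<sigma> assume \<sigma>: "\<sigma> \<in> PiE Q (\<lambda>_. H) - PiE Q (\<lambda>_. H')"
    then obtain p where p: "p \<in> Q" "\<sigma> p \<in> H - H'" unfolding PiE_iff by blast
    show "S \<sigma> = 0" unfolding S_def
      by (rule sum.neutral) (use p zero in blast)
  qed
  finally have eq: "(\<Sum>n | n \<in> I \<and> good n \<and> hits Q n. f n) = (\<Sum>\<sigma>\<in>PiE Q (\<lambda>_. H'). S \<sigma>)" .
  have card: "card (PiE Q (\<lambda>_. H')) = card H' ^ card Q" using D by (simp add: card_PiE)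
  have "card H' \<le> k" using H H' by (metis card_mono)
  have each: "\<bar>S \<sigma> - X\<bar> \<le> E" if \<sigma>: "\<sigma> \<in> PiE Q (\<lambda>_. H')" for \<sigma>
  proof -
    obtain x where x: "\<And>n. (good n \<and> (\<forall>p\<in>Q. p dvd n + \<sigma> p)) \<longleftrightarrow> [n = x] (mod modulus Q)"
      using choice_class[OF D(1-3) subsetD[OF sub \<sigma>]] by metis
    show ?thesis unfolding S_def x using main[OF \<sigma> x] by simp
  qed
  have "(\<Sum>\<sigma>\<in>PiE Q (\<lambda>_. H'). S \<sigma>) - real (card H') ^ card Q * X = (\<Sum>\<sigma>\<in>PiE Q (\<lambda>_. H'). S \<sigma> - X)"
    by (simp add: sum_subtractf card)
  also have "\<bar>\<dots>\<bar> \<le> (\<Sum>\<sigma>\<in>PiE Q (\<lambda>_. H'). E)"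
    by (rule order_trans[OF sum_abs], rule sum_mono, rule each)
  also have "\<dots> = real (card H') ^ card Q * E" by (simp add: card)
  also have "\<dots> \<le> real k ^ card Q * E"
    using \<open>card H' \<le> k\<close> E by (intro mult_right_mono power_mono) auto
  finally show ?thesis unfolding eq .
qed

definition wsum :: "nat set set \<Rightarrow> (nat set \<Rightarrow> real) \<Rightarrow> nat \<Rightarrow> real" where
  "wsum F lam n = (\<Sum>D | D \<in> F \<and> hits D n. lam D)\<^sup>2"

lemma weighted_sum_expand:
  assumes F: "finite F" and I: "finite I"
  shows "(\<Sum>n | n \<in> I \<and> good n. f n * wsum F lam n)
    = (\<Sum>D\<in>F. \<Sum>E\<in>F. lam D * lam E * (\<Sum>n | n \<in> I \<and> good n \<and> hits (D \<union> E) n. f n))"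
proof -
  have w: "wsum F lam n = (\<Sum>D\<in>F. \<Sum>E\<in>F. if hits (D \<union> E) n then lam D * lam E else 0)" for n
  proof -
    have a: "(\<Sum>D | D \<in> F \<and> hits D n. lam D) = (\<Sum>D\<in>F. if hits D n then lam D else 0)"
      using F by (simp add: sum.inter_filter)
    have b: "hits (D \<union> E) n \<longleftrightarrow> hits D n \<and> hits E n" for D E
      by (auto simp: hits_def)
    show ?thesis unfolding wsum_def power2_eq_square a sum_product
      by (intro sum.cong refl) (simp add: b)
  qed
  have "(\<Sum>n | n \<in> I \<and> good n. f n * wsum F lam n)
     = (\<Sum>n | n \<in> I \<and> good n. \<Sum>D\<in>F. \<Sum>E\<in>F. if hits (D \<union> E) n then lam D * lam E * f n else 0)"
    unfolding w sum_distrib_left by (intro sum.cong refl) auto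
  also have "\<dots> = (\<Sum>D\<in>F. \<Sum>n | n \<in> I \<and> good n. \<Sum>E\<in>F. if hits (D \<union> E) n then lam D * lam E * f n else 0)"
    by (rule sum.swap)
  also have "\<dots> = (\<Sum>D\<in>F. \<Sum>E\<in>F. \<Sum>n | n \<in> I \<and> good n. if hits (D \<union> E) n then lam D * lam E * f n else 0)"
    by (intro sum.cong refl sum.swap)
  also have "\<dots> = (\<Sum>D\<in>F. \<Sum>E\<in>F. lam D * lam E * (\<Sum>n | n \<in> I \<and> good n \<and> hits (D \<union> E) n. f n))"
  proof (intro sum.cong refl)
    fix D E
    have "(\<Sum>n | n \<in> I \<and> good n. if hits (D \<union> E) n then lam D * lam E * f n else 0)
       = (\<Sum>n | n \<in> {n. n \<in> I \<and> good n} \<and> hits (D \<union> E) n. lam D * lam E * f n)"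
      by (rule sum.inter_filter[symmetric]) (use I in simp)
    then show "(\<Sum>n | n \<in> I \<and> good n. if hits (D \<union> E) n then lam D * lam E * f n else 0)
       = lam D * lam E * (\<Sum>n | n \<in> I \<and> good n \<and> hits (D \<union> E) n. f n)"
      by (simp add: sum_distrib_left conj_assoc)
  qed
  finally show ?thesis .
qed

text \<open>Per prime, the factor \<open>16 * k\<close> collects 4 from the two weights,
  \<open>k\<close> from the choices of shifts, and 4 from passing from pairs \<open>D\<close>,
  \<open>E\<close> to their union.\<close>

lemma weighted_sum_approx:
  fixes f :: "nat \<Rightarrow> real"
  assumes I: "finite I"
    and lam: "\<And>D. D \<in> prime_sets B L \<Longrightarrow> \<bar>lam D\<bar> \<le> \<Lambda> * 2 ^ card D" and \<Lambda>: "0 \<le> \<Lambda>"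
    and E: "\<And>Q. Q \<in> prime_sets B (2 * L) \<Longrightarrow> 0 \<le> E Q"
    and approx: "\<And>Q. Q \<in> prime_sets B (2 * L) \<Longrightarrow>
       \<bar>(\<Sum>n | n \<in> I \<and> good n \<and> hits Q n. f n) - X * prod G Q\<bar> \<le> real k ^ card Q * E Q"
  shows "\<bar>(\<Sum>n | n \<in> I \<and> good n. f n * wsum (prime_sets B L) lam n)
      - X * (\<Sum>D\<in>prime_sets B L. \<Sum>E\<in>prime_sets B L. lam D * lam E * prod G (D \<union> E))\<bar>
    \<le> \<Lambda>\<^sup>2 * (\<Sum>Q\<in>prime_sets B (2 * L). real (16 * k) ^ card Q * E Q)"
proof -
  define F where "F = prime_sets B L"
  define S where "S = (\<lambda>Q. \<Sum>n | n \<in> I \<and> good n \<and> hits Q n. f n)"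
  have un: "D \<union> D' \<in> prime_sets B (2 * L)" if "D \<in> F" "D' \<in> F" for D D'
    using that prime_sets_Un by (auto simp: F_def)
  have finF: "finite F" "\<And>D. D \<in> F \<Longrightarrow> finite D" unfolding F_def using finite_prime_sets prime_setsD(1) by auto
  have "(\<Sum>n | n \<in> I \<and> good n. f n * wsum F lam n) - X * (\<Sum>D\<in>F. \<Sum>D'\<in>F. lam D * lam D' * prod G (D \<union> D'))
     = (\<Sum>D\<in>F. \<Sum>D'\<in>F. lam D * lam D' * (S (D \<union> D') - X * prod G (D \<union> D')))"
    unfolding weighted_sum_expand[OF finF(1) I] S_def
    by (simp add: sum_distrib_left sum_subtractf right_diff_distrib mult_ac)
  also have "\<bar>\<dots>\<bar> \<le> (\<Sum>D\<in>F. \<Sum>D'\<in>F. \<Lambda>\<^sup>2 * (real (4 * k) ^ card (D \<union> D') * E (D \<union> D')))"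
  proof (rule order_trans[OF sum_abs], rule sum_mono, rule order_trans[OF sum_abs], rule sum_mono)
    fix D D' assume D: "D \<in> F" "D' \<in> F"
    note fin = finF(2)[OF D(1)] finF(2)[OF D(2)]
    have le: "card D \<le> card (D \<union> D')" "card D' \<le> card (D \<union> D')" using fin by (auto intro: card_mono)
    have "\<bar>lam D * lam D' * (S (D \<union> D') - X * prod G (D \<union> D'))\<bar>
      = \<bar>lam D\<bar> * \<bar>lam D'\<bar> * \<bar>S (D \<union> D') - X * prod G (D \<union> D')\<bar>" by (simp add: abs_mult)
    also have "\<dots> \<le> (\<Lambda> * 2 ^ card (D \<union> D')) * (\<Lambda> * 2 ^ card (D \<union> D')) * (real k ^ card (D \<union> D') * E (D \<union> D'))"
    proof (intro mult_mono)
      show "\<bar>lam D\<bar> \<le> \<Lambda> * 2 ^ card (D \<union> D')"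
        by (rule order_trans[OF lam], use D in \<open>simp add: F_def\<close>, intro mult_left_mono power_increasing le \<Lambda>) simp
      show "\<bar>lam D'\<bar> \<le> \<Lambda> * 2 ^ card (D \<union> D')"
        by (rule order_trans[OF lam], use D in \<open>simp add: F_def\<close>, intro mult_left_mono power_increasing le \<Lambda>) simp
      show "\<bar>S (D \<union> D') - X * prod G (D \<union> D')\<bar> \<le> real k ^ card (D \<union> D') * E (D \<union> D')"
        unfolding S_def by (rule approx) (rule un[OF D])
    qed (use \<Lambda> in auto)
    also have "\<dots> = \<Lambda>\<^sup>2 * (real (4 * k) ^ card (D \<union> D') * E (D \<union> D'))"
    proof -
      have "real (4 * k) = 2 * 2 * real k" by simp
      then show ?thesis by (simp only: power_mult_distrib power2_eq_square) (simp only: mult_ac)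
    qed
    finally show "\<bar>lam D * lam D' * (S (D \<union> D') - X * prod G (D \<union> D'))\<bar> \<le> \<Lambda>\<^sup>2 * (real (4 * k) ^ card (D \<union> D') * E (D \<union> D'))" .
  qed
  also have "\<dots> = \<Lambda>\<^sup>2 * (\<Sum>D\<in>F. \<Sum>D'\<in>F. real (4 * k) ^ card (D \<union> D') * E (D \<union> D'))"
    by (simp add: sum_distrib_left)
  also have "\<dots> \<le> \<Lambda>\<^sup>2 * (\<Sum>Q\<in>prime_sets B (2 * L). 4 ^ card Q * (real (4 * k) ^ card Q * E Q))"
  proof (rule mult_left_mono)
    show "(\<Sum>D\<in>F. \<Sum>D'\<in>F. real (4 * k) ^ card (D \<union> D') * E (D \<union> D'))
      \<le> (\<Sum>Q\<in>prime_sets B (2 * L). 4 ^ card Q * (real (4 * k) ^ card Q * E Q))"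
    proof (rule sum_union_pairs_le[OF finF finite_prime_sets])
      show "finite S" if "S \<in> prime_sets B (2 * L)" for S using prime_setsD(1)[OF that] .
      show "D \<union> D' \<in> prime_sets B (2 * L)" if "D \<in> F" "D' \<in> F" for D D' by (rule un[OF that])
      show "0 \<le> real (4 * k) ^ card Q * E Q" if "Q \<in> prime_sets B (2 * L)" for Q
        by (intro mult_nonneg_nonneg E that) simp
    qed
  qed simp
  also have "\<dots> = \<Lambda>\<^sup>2 * (\<Sum>Q\<in>prime_sets B (2 * L). real (16 * k) ^ card Q * E Q)"
  proof -
    have "real (16 * k) = 4 * real (4 * k)" by simp
    then show ?thesis by (simp only: power_mult_distrib mult.assoc)
  qed
  finally show ?thesis unfolding F_def .
qed

end

section \<open>Equidistribution in residue classes\<close>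

lemma card_class_shift:
  fixes q x N :: nat
  assumes q: "0 < q"
  shows "card {n. n \<in> {1..N + q} \<and> [n = x] (mod q)} = card {n. n \<in> {1..N} \<and> [n = x] (mod q)} + 1"
proof -
  \<comment> \<open>The representative of \<open>x\<close> in \<open>1..q\<close> rather than
    \<open>0..<q\<close>, since the counted interval starts at 1.\<close>
  define y where "y = (if x mod q = 0 then q else x mod q)"
  have ymod: "y mod q = x mod q" by (simp add: y_def)
  have y: "1 \<le> y" "y \<le> q" using q by (auto simp: y_def Suc_le_eq)
  have split: "{n. n \<in> {1..N + q} \<and> [n = x] (mod q)} = insert y ((\<lambda>n. n + q) ` {n. n \<in> {1..N} \<and> [n = x] (mod q)})"
  proof (intro equalityI subsetI)
    fix n assume n: "n \<in> {n. n \<in> {1..N + q} \<and> [n = x] (mod q)}"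
    then have n': "1 \<le> n" "n \<le> N + q" "n mod q = x mod q" by (auto simp: cong_def)
    show "n \<in> insert y ((\<lambda>n. n + q) ` {n. n \<in> {1..N} \<and> [n = x] (mod q)})"
    proof (cases "n \<le> q")
      case True
      then have "n = y" using n' q by (cases "n = q") (auto simp: y_def)
      then show ?thesis by simp
    next
      case False
      then have "n = (n - q) + q" "1 \<le> n - q" "n - q \<le> N" "(n - q) mod q = x mod q"
        using n' by (auto simp: le_mod_geq)
      then show ?thesis by (auto simp: cong_def intro!: image_eqI[of _ _ "n - q"])
    qed
  next
    fix n assume "n \<in> insert y ((\<lambda>n. n + q) ` {n. n \<in> {1..N} \<and> [n = x] (mod q)})"
    then show "n \<in> {n. n \<in> {1..N + q} \<and> [n = x] (mod q)}"
      using y ymod by (auto simp: cong_def)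
  qed
  have "y \<notin> (\<lambda>n. n + q) ` {n. n \<in> {1..N} \<and> [n = x] (mod q)}" using y by auto
  then show ?thesis unfolding split by (simp add: card_image)
qed

lemma card_class_approx:
  fixes q x N :: nat
  assumes q: "0 < q"
  shows "\<bar>real (card {n. n \<in> {1..N} \<and> [n = x] (mod q)}) - real N / real q\<bar> \<le> 1"
proof (induction N rule: less_induct)
  case (less N)
  show ?case
  proof (cases "N < q")
    case True
    have "card {n. n \<in> {1..N} \<and> [n = x] (mod q)} \<le> card {x mod q}"
      by (rule card_mono) (use True in \<open>auto simp: cong_def\<close>)
    then have "card {n. n \<in> {1..N} \<and> [n = x] (mod q)} \<le> 1" by simp
    moreover have "0 \<le> real N / real q" "real N / real q \<le> 1" using True by auto
    ultimately show ?thesis by linarith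
  next
    case False
    then obtain M where M: "N = M + q" by (metis add.commute le_Suc_ex not_less)
    have "real (card {n. n \<in> {1..N} \<and> [n = x] (mod q)}) = real (card {n. n \<in> {1..M} \<and> [n = x] (mod q)}) + 1"
      unfolding M card_class_shift[OF q] by simp
    moreover have "real N / real q = real M / real q + 1" using q by (simp add: M add_divide_distrib)
    moreover have "\<bar>real (card {n. n \<in> {1..M} \<and> [n = x] (mod q)}) - real M / real q\<bar> \<le> 1"
      by (rule less) (use M q in auto)
    ultimately show ?thesis by linarith
  qed
qed

lemma card_class_interval:
  fixes q x N :: nat
  assumes q: "0 < q"
  shows "\<bar>real (card {n. n \<in> {N<..2 * N} \<and> [n = x] (mod q)}) - real N / real q\<bar> \<le> 2"
proof -
  have "{n. n \<in> {1..2 * N} \<and> [n = x] (mod q)} = {n. n \<in> {1..N} \<and> [n = x] (mod q)} \<union> {n. n \<in> {N<..2 * N} \<and> [n = x] (mod q)}"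
    by auto
  then have "card {n. n \<in> {1..2 * N} \<and> [n = x] (mod q)} = card {n. n \<in> {1..N} \<and> [n = x] (mod q)} + card {n. n \<in> {N<..2 * N} \<and> [n = x] (mod q)}"
    by (simp only:) (rule card_Un_disjoint, auto)
  moreover have "real (2 * N) / real q = real N / real q + real N / real q" by (simp add: add_divide_distrib)
  ultimately show ?thesis
    using card_class_approx[OF q, of "2 * N" x] card_class_approx[OF q, of N x] by linarith
qed

section \<open>Error terms of conditions (A) and (B) for a single modulus\<close>

definition errA :: "nat \<Rightarrow> nat \<Rightarrow> real" where
  "errA N q = Max ((\<lambda>a. \<bar>(\<Sum>p\<in>{p. prime p \<and> p \<le> N \<and> [p = a] (mod q)}. ln (real p))
                    - real N / real (totient q)\<bar>) ` {a. a < q \<and> coprime a q})"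

definition errB :: "nat \<Rightarrow> nat \<Rightarrow> real" where
  "errB N q = Max ((\<lambda>(y, a). \<bar>real_of_int (\<Sum>n\<in>{n. 1 \<le> n \<and> n \<le> y \<and> [n = a] (mod q)}.
                    liouville (int n))\<bar>) ` ({0..N} \<times> {..<q}))"

lemma ex_coprime_less: "1 \<le> q \<Longrightarrow> \<exists>a::nat. a < q \<and> coprime a q"
  by (cases "q = 1") (auto intro: exI[of _ 1])

lemma errA_ge:
  assumes "a < q" "coprime a q"
  shows "\<bar>(\<Sum>p\<in>{p. prime p \<and> p \<le> N \<and> [p = a] (mod q)}. ln (real p)) - real N / real (totient q)\<bar> \<le> errA N q"
  unfolding errA_def by (rule Max_ge) (use assms in auto)

lemma errA_nonneg: "1 \<le> q \<Longrightarrow> 0 \<le> errA N q"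
  using ex_coprime_less[of q] errA_ge[of _ q N] by (metis abs_ge_zero order_trans)

lemma errB_ge:
  assumes "a < q" "y \<le> N"
  shows "\<bar>real_of_int (\<Sum>n\<in>{n. 1 \<le> n \<and> n \<le> y \<and> [n = a] (mod q)}. liouville (int n))\<bar> \<le> errB N q"
  unfolding errB_def by (rule Max_ge) (use assms in \<open>auto intro!: image_eqI[of _ _ "(y, a)"]\<close>)

lemma errB_nonneg: "1 \<le> q \<Longrightarrow> 0 \<le> errB N q"
  using errB_ge[of 0 q 0 N] by simp

lemma card_class_le_2:
  assumes "1 \<le> q" "q \<le> N"
  shows "real (card {n. n \<in> {1..N} \<and> [n = x] (mod q)}) \<le> 2 * real N / real (totient q)"
proof -
  have "real (card {n. n \<in> {1..N} \<and> [n = x] (mod q)}) \<le> real N / real q + 1"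
    using card_class_approx[of q N x] assms by linarith
  also have "1 \<le> real N / real q" using assms by simp
  then have "real N / real q + 1 \<le> 2 * real N / real q" by simp
  also have "\<dots> \<le> 2 * real N / real (totient q)"
    using assms totient_le[of q] by (intro divide_left_mono) auto
  finally show ?thesis .
qed

text \<open>Counts every integer of the class with weight \<open>ln N\<close>; since
  \<open>q \<le> N\<close>, there are at most \<open>2 * N / q\<close> of them.\<close>

lemma errA_trivial:
  assumes N: "3 \<le> N" "1 \<le> q" "q \<le> N"
  shows "errA N q \<le> 3 * (real N * ln (real N) / real (totient q))"
  unfolding errA_def
proof (subst Max_le_iff)
  show "finite ((\<lambda>a. \<bar>(\<Sum>p\<in>{p. prime p \<and> p \<le> N \<and> [p = a] (mod q)}. ln (real p)) - real N / real (totient q)\<bar>) ` {a. a < q \<and> coprime a q})"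
    by simp
  show "(\<lambda>a. \<bar>(\<Sum>p\<in>{p. prime p \<and> p \<le> N \<and> [p = a] (mod q)}. ln (real p)) - real N / real (totient q)\<bar>) ` {a. a < q \<and> coprime a q} \<noteq> {}"
    using ex_coprime_less[OF N(2)] by blast
  have lnN: "1 \<le> ln (real N)"
  proof -
    have "exp 1 \<le> real N" using exp_le N by linarith
    then show ?thesis using N by (simp add: ln_ge_iff)
  qed
  show "\<forall>a\<in>(\<lambda>a. \<bar>(\<Sum>p\<in>{p. prime p \<and> p \<le> N \<and> [p = a] (mod q)}. ln (real p)) - real N / real (totient q)\<bar>) ` {a. a < q \<and> coprime a q}.
       a \<le> 3 * (real N * ln (real N) / real (totient q))"
  proof (rule ballI, erule imageE)
    fix b a assume b: "b = \<bar>(\<Sum>p\<in>{p. prime p \<and> p \<le> N \<and> [p = a] (mod q)}. ln (real p)) - real N / real (totient q)\<bar>"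
    define P where "P = {p. prime p \<and> p \<le> N \<and> [p = a] (mod q)}"
    have "(\<Sum>p\<in>P. ln (real p)) \<le> (\<Sum>p\<in>P. ln (real N))"
    proof (rule sum_mono)
      fix p assume "p \<in> P"
      then have "0 < p" "p \<le> N" by (auto simp: P_def prime_gt_0_nat)
      then show "ln (real p) \<le> ln (real N)" by (intro ln_mono) auto
    qed
    also have "\<dots> = real (card P) * ln (real N)" by simp
    also have "\<dots> \<le> (2 * real N / real (totient q)) * ln (real N)"
    proof (rule mult_right_mono)
      have "card P \<le> card {n. n \<in> {1..N} \<and> [n = a] (mod q)}"
        by (rule card_mono) (auto simp: P_def Suc_le_eq prime_gt_0_nat)
      then have "real (card P) \<le> real (card {n. n \<in> {1..N} \<and> [n = a] (mod q)})" by (rule of_nat_mono)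
      also have "\<dots> \<le> 2 * real N / real (totient q)" by (rule card_class_le_2[OF N(2,3)])
      finally show "real (card P) \<le> 2 * real N / real (totient q)" .
    qed (use lnN in simp)
    finally have 1: "(\<Sum>p\<in>P. ln (real p)) \<le> 2 * (real N * ln (real N) / real (totient q))" by simp
    have 2: "0 \<le> (\<Sum>p\<in>P. ln (real p))"
      by (rule sum_nonneg) (auto simp: P_def dest: prime_ln_pos)
    have "real N * 1 / real (totient q) \<le> real N * ln (real N) / real (totient q)"
      by (intro divide_right_mono mult_left_mono lnN) auto
    then have 3: "real N / real (totient q) \<le> real N * ln (real N) / real (totient q)" by simp
    have 4: "0 \<le> real N / real (totient q)" by simp
    show "b \<le> 3 * (real N * ln (real N) / real (totient q))"
      unfolding b P_def[symmetric] using 1 2 3 4 by linarith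
  qed
qed

text \<open>The logarithm is given away so that the bound has the shape of
  \<open>errA_trivial\<close> and both errors can be treated alike.\<close>

lemma errB_trivial:
  assumes N: "3 \<le> N" "1 \<le> q" "q \<le> N"
  shows "errB N q \<le> 3 * (real N * ln (real N) / real (totient q))"
  unfolding errB_def
proof (subst Max_le_iff)
  show "finite ((\<lambda>(y, a). \<bar>real_of_int (\<Sum>n\<in>{n. 1 \<le> n \<and> n \<le> y \<and> [n = a] (mod q)}. liouville (int n))\<bar>) ` ({0..N} \<times> {..<q}))"
    by simp
  show "(\<lambda>(y, a). \<bar>real_of_int (\<Sum>n\<in>{n. 1 \<le> n \<and> n \<le> y \<and> [n = a] (mod q)}. liouville (int n))\<bar>) ` ({0..N} \<times> {..<q}) \<noteq> {}"
    using N by (auto simp: lessThan_empty_iff)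
  have lnN: "1 \<le> ln (real N)"
  proof -
    have "exp 1 \<le> real N" using exp_le N by linarith
    then show ?thesis using N by (simp add: ln_ge_iff)
  qed
  show "\<forall>b\<in>(\<lambda>(y, a). \<bar>real_of_int (\<Sum>n\<in>{n. 1 \<le> n \<and> n \<le> y \<and> [n = a] (mod q)}. liouville (int n))\<bar>) ` ({0..N} \<times> {..<q}).
      b \<le> 3 * (real N * ln (real N) / real (totient q))"
  proof (rule ballI, erule imageE)
    fix b x assume b: "b = (\<lambda>(y, a). \<bar>real_of_int (\<Sum>n\<in>{n. 1 \<le> n \<and> n \<le> y \<and> [n = a] (mod q)}. liouville (int n))\<bar>) x"
      and x: "x \<in> {0..N} \<times> {..<q}"
    obtain y a where ya: "x = (y, a)" "y \<le> N" using x by auto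
    define P where "P = {n. 1 \<le> n \<and> n \<le> y \<and> [n = a] (mod q)}"
    have "\<bar>real_of_int (\<Sum>n\<in>P. liouville (int n))\<bar> \<le> (\<Sum>n\<in>P. \<bar>real_of_int (liouville (int n))\<bar>)"
      by (simp add: of_int_sum)
    also have "\<dots> = real (card P)" by (simp add: liouville_def)
    also have "\<dots> \<le> real (card {n. n \<in> {1..N} \<and> [n = a] (mod q)})"
      by (intro of_nat_mono card_mono) (use ya in \<open>auto simp: P_def\<close>)
    also have "\<dots> \<le> 2 * real N / real (totient q)" by (rule card_class_le_2[OF N(2,3)])
    also have "\<dots> \<le> 3 * (real N * ln (real N) / real (totient q))"
    proof -
      have "real N * 1 / real (totient q) \<le> real N * ln (real N) / real (totient q)"
        by (intro divide_right_mono mult_left_mono lnN) auto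
      then have "real N / real (totient q) \<le> real N * ln (real N) / real (totient q)" by simp
      moreover have "0 \<le> real N / real (totient q)" by simp
      moreover have "2 * real N / real (totient q) = 2 * (real N / real (totient q))" by simp
      ultimately show ?thesis by linarith
    qed
    finally show "b \<le> 3 * (real N * ln (real N) / real (totient q))"
      using b ya by (simp add: P_def)
  qed
qed

text \<open>The common shape of the average bounds for primes, for the Liouville function and for
  plain counting, with natural exponents in place of real ones.\<close>

definition level_bound :: "real \<Rightarrow> (nat \<Rightarrow> nat \<Rightarrow> real) \<Rightarrow> bool" where
  "level_bound \<eta> err \<longleftrightarrow> (\<forall>A::nat. \<exists>C. eventually (\<lambda>N. (\<Sum>q\<in>{1..nat \<lfloor>real N powr \<eta>\<rfloor>}. err N q) \<le> C * real N / ln (real N) ^ A) sequentially)"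

lemma level_bound_of_bigo:
  assumes "\<And>A::real. 0 < A \<Longrightarrow> (\<lambda>N. \<Sum>q\<in>{1..nat \<lfloor>real N powr \<eta>\<rfloor>}. err N q) \<in> O(\<lambda>N. real N / ln (real N) powr A)"
  shows "level_bound \<eta> err"
  unfolding level_bound_def
proof
  fix A :: nat
  obtain c where c: "c > 0" "eventually (\<lambda>N. norm (\<Sum>q\<in>{1..nat \<lfloor>real N powr \<eta>\<rfloor>}. err N q)
     \<le> c * norm (real N / ln (real N) powr (real A + 1))) sequentially"
    \<comment> \<open>The assumption speaks of positive exponents only; the shift by 1 covers
      \<open>A = 0\<close>.\<close>
    using assms[of "real A + 1"] by (auto elim!: landau_o.bigE)
  have "eventually (\<lambda>N. (\<Sum>q\<in>{1..nat \<lfloor>real N powr \<eta>\<rfloor>}. err N q) \<le> c * real N / ln (real N) ^ A) sequentially"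
    using c(2) eventually_ln_ge[of 1]
  proof eventually_elim
    case (elim N)
    define l where "l = ln (real N)"
    have l: "1 \<le> l" "0 < l" using elim(2) unfolding l_def by linarith+
    have "(\<Sum>q\<in>{1..nat \<lfloor>real N powr \<eta>\<rfloor>}. err N q) \<le> c * (real N / l powr (real A + 1))"
      using elim(1) l by (simp add: l_def[symmetric])
    also have "l powr (real A + 1) = l ^ (A + 1)"
      using l powr_realpow[of l "A + 1"] by (simp add: add.commute)
    also have "c * (real N / l ^ (A + 1)) \<le> c * (real N / l ^ A)"
      using c l by (intro mult_left_mono divide_left_mono power_increasing) auto
    finally show ?case by (simp add: l_def)
  qed
  then show "\<exists>C. eventually (\<lambda>N. (\<Sum>q\<in>{1..nat \<lfloor>real N powr \<eta>\<rfloor>}. err N q) \<le> C * real N / ln (real N) ^ A) sequentially"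
    by blast
qed

lemma level_bound_errA:
  assumes "condA \<theta>" "\<eta> < \<theta>"
  shows "level_bound \<eta> errA"
proof (rule level_bound_of_bigo)
  fix A :: real assume "0 < A"
  then show "(\<lambda>N. \<Sum>q\<in>{1..nat \<lfloor>real N powr \<eta>\<rfloor>}. errA N q) \<in> O(\<lambda>N. real N / ln (real N) powr A)"
    using assms(1)[unfolded condA_def, rule_format, of "\<theta> - \<eta>" A] assms(2) by (simp add: errA_def)
qed

lemma level_bound_errB:
  assumes "condB \<theta>" "\<eta> < \<theta>"
  shows "level_bound \<eta> errB"
proof (rule level_bound_of_bigo)
  fix A :: real assume "0 < A"
  then show "(\<lambda>N. \<Sum>q\<in>{1..nat \<lfloor>real N powr \<eta>\<rfloor>}. errB N q) \<in> O(\<lambda>N. real N / ln (real N) powr A)"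
    using assms(1)[unfolded condB_def, rule_format, of "\<theta> - \<eta>" A] assms(2) by (simp add: errB_def)
qed

text \<open>Counting integers in a class errs by at most 2, in total by
  \<open>2 * N powr \<eta>\<close>, which beats every power of the logarithm when
  \<open>\<eta> < 1\<close>.\<close>

lemma level_bound_const:
  assumes "\<eta> < 1"
  shows "level_bound \<eta> (\<lambda>_ _. 2)"
  unfolding level_bound_def
proof
  fix A :: nat
  have "eventually (\<lambda>N::nat. ln (real N) ^ A \<le> real N powr (1 - \<eta>)) sequentially"
    using assms by real_asymp
  then have "eventually (\<lambda>N::nat. (\<Sum>q\<in>{1..nat \<lfloor>real N powr \<eta>\<rfloor>}. 2) \<le> 2 * real N / ln (real N) ^ A) sequentially"
    using eventually_ln_ge[of 1] eventually_gt_at_top[of 0]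
  proof eventually_elim
    case (elim N)
    have l: "0 < ln (real N)" using elim(2) by linarith
    have "(\<Sum>q\<in>{1..nat \<lfloor>real N powr \<eta>\<rfloor>}. (2::real)) \<le> 2 * real N powr \<eta>" by simp
    also have "\<dots> = 2 * (real N / real N powr (1 - \<eta>))"
      using elim by (simp add: powr_diff)
    also have "\<dots> \<le> 2 * (real N / ln (real N) ^ A)"
      using elim(1,3) by (intro mult_left_mono divide_left_mono mult_pos_pos zero_less_power l) auto
    finally show ?case by simp
  qed
  then show "\<exists>C. eventually (\<lambda>N::nat. (\<Sum>q\<in>{1..nat \<lfloor>real N powr \<eta>\<rfloor>}. 2) \<le> C * real N / ln (real N) ^ A) sequentially"
    by blast
qed

lemma real_totient_Prod_primes:
  assumes "finite A" "\<And>p. p \<in> A \<Longrightarrow> prime p"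
  shows "real (totient (\<Prod>A)) = (\<Prod>p\<in>A. real p - 1)"
  using assms
proof (induction A rule: finite_induct)
  case (insert p A)
  have "coprime p (\<Prod>A)"
    by (rule prod_coprime_right) (use insert in \<open>auto intro: primes_coprime\<close>)
  then have "totient (\<Prod>(insert p A)) = totient p * totient (\<Prod>A)"
    using insert.hyps by (simp add: totient_mult_coprime)
  moreover have "real (totient p) = real p - 1"
    using insert.prems[of p] prime_ge_1_nat[of p] by (simp add: totient_prime of_nat_diff)
  ultimately show ?case using insert by simp
qed auto

definition vth :: "nat \<Rightarrow> real" where
  "vth n = (if prime n then ln (real n) else 0)"

section \<open>Integers, Liouville values and primes in the sieve classes\<close>

context tuple_sieve
begin

lemma modulus_pos: "finite Q \<Longrightarrow> (\<And>p. p \<in> Q \<Longrightarrow> prime p) \<Longrightarrow> 1 \<le> modulus Q"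
proof -
  assume Q: "finite Q" "\<And>p. p \<in> Q \<Longrightarrow> prime p"
  have "0 < modulus Q" unfolding modulus_def
    by (rule prod_pos) (use Q Z prime_gt_0_nat in blast)
  then show ?thesis by simp
qed

lemma prod_Z_ge_1: "1 \<le> \<Prod>Z"
  using modulus_pos[of "{}"] by (simp add: modulus_def)

lemma prime_factors_modulus:
  assumes "Q \<in> prime_sets B L"
  shows "prime_factors (modulus Q) - Z = Q"
proof -
  note D = prime_setsD[OF assms]
  have "prime_factors (modulus Q) = Q \<union> Z"
    unfolding modulus_def by (rule prime_factors_Prod_primes) (use D Z in auto)
  then show ?thesis using disjoint_Z[of Q] D by blast
qed

text \<open>Each prime of \<open>Q\<close> satisfies \<open>p - 1 \<ge> p / 2\<close>, and the
  primes of \<open>Z\<close> contribute factors at least 1.\<close>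

lemma inverse_totient_modulus_le:
  assumes "Q \<in> prime_sets B L"
  shows "1 / real (totient (modulus Q)) \<le> 2 ^ card Q / real (\<Prod>Q)"
proof -
  note D = prime_setsD[OF assms]
  have "real (totient (modulus Q)) = (\<Prod>p\<in>Q \<union> Z. real p - 1)"
    unfolding modulus_def by (rule real_totient_Prod_primes) (use D Z in auto)
  also have "\<dots> = (\<Prod>p\<in>Q. real p - 1) * (\<Prod>p\<in>Z. real p - 1)"
    by (rule prod.union_disjoint) (use D Z disjoint_Z in auto)
  finally have tot: "real (totient (modulus Q)) = (\<Prod>p\<in>Q. real p - 1) * (\<Prod>p\<in>Z. real p - 1)" .
  have ge2: "2 \<le> real p" if "p \<in> Q \<union> Z" for p
    using that D(2) Z(2) prime_ge_2_nat[of p] by (auto simp del: of_nat_le_iff)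
  have "(\<Prod>p\<in>Q. real p / 2) * 1 \<le> (\<Prod>p\<in>Q. real p - 1) * (\<Prod>p\<in>Z. real p - 1)"
  proof (rule mult_mono)
    show "(\<Prod>p\<in>Q. real p / 2) \<le> (\<Prod>p\<in>Q. real p - 1)"
    proof (rule prod_mono)
      fix p assume "p \<in> Q"
      then have "2 \<le> real p" using ge2 by blast
      then show "0 \<le> real p / 2 \<and> real p / 2 \<le> real p - 1" by linarith
    qed
    show "1 \<le> (\<Prod>p\<in>Z. real p - 1)"
    proof (rule prod_ge_1)
      fix p assume "p \<in> Z"
      then have "2 \<le> real p" using ge2 by blast
      then show "1 \<le> real p - 1" by linarith
    qed
    show "0 \<le> (\<Prod>p\<in>Q. real p - 1)"
    proof (rule prod_nonneg)
      fix p assume "p \<in> Q"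
      then have "2 \<le> real p" using ge2 by blast
      then show "0 \<le> real p - 1" by linarith
    qed
  qed simp
  then have le: "real (\<Prod>Q) / 2 ^ card Q \<le> real (totient (modulus Q))"
    unfolding tot by (simp add: prod_dividef)
  have "0 < \<Prod>Q" by (rule prod_pos) (use D(2) prime_gt_0_nat in blast)
  then have pos: "0 < real (\<Prod>Q) / 2 ^ card Q" by (simp only: of_nat_0_less_iff zero_less_divide_iff) simp
  have "1 / real (totient (modulus Q)) \<le> 1 / (real (\<Prod>Q) / 2 ^ card Q)"
    by (intro divide_left_mono mult_pos_pos le pos less_le_trans[OF pos le]) simp
  then show ?thesis by simp
qed

text \<open>The gap between \<open>\<eta>'\<close> and \<open>\<eta>\<close> swallows the fixed
  factor \<open>\<Prod>Z\<close> of the modulus. As \<open>Q\<close> can be recovered from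
  \<open>modulus Q\<close>, the sum over sets is part of the sum over all moduli. The function
  \<open>s\<close> stands for the endpoints at which errors are taken, such as \<open>3 * N\<close>
  or \<open>2 * N + h\<close>.\<close>

lemma negligible_of_level:
  assumes \<eta>: "0 < \<eta>'" "\<eta>' < \<eta>" "\<eta> \<le> 1" and lev: "level_bound \<eta> err"
    and nn: "\<And>N q. 1 \<le> q \<Longrightarrow> 0 \<le> err N q"
    and triv: "\<And>N q. 3 \<le> N \<Longrightarrow> 1 \<le> q \<Longrightarrow> q \<le> N \<Longrightarrow> err N q \<le> 3 * (real N * ln (real N) / real (totient q))"
    and s: "eventually (\<lambda>N. N \<le> s N \<and> s N \<le> 4 * N) sequentially"
  shows "negligible_error B \<eta>' (\<lambda>N Q. err (s N) (modulus Q))"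
proof -
  have ev: "eventually (\<lambda>N. \<forall>Q\<in>prime_sets B (\<eta>' * ln (real N)).
      real (modulus Q) \<le> real (s N) powr \<eta> \<and> modulus Q \<le> s N) sequentially"
  proof -
    have "eventually (\<lambda>N::nat. real (\<Prod>Z) \<le> real N powr (\<eta> - \<eta>')) sequentially"
    proof -
      have "0 < \<eta> - \<eta>'" using \<eta> by simp
      then have "filterlim (\<lambda>N::nat. real N powr (\<eta> - \<eta>')) at_top sequentially" by real_asymp
      then show ?thesis by (simp only: filterlim_at_top)
    qed
    then show ?thesis using s eventually_gt_at_top[of 0]
    proof eventually_elim
      case (elim N)
      show ?case
      proof
        fix Q assume Q: "Q \<in> prime_sets B (\<eta>' * ln (real N))"
        note D = prime_setsD[OF Q]
        have "real (\<Prod>Q) = exp (lnsum Q)" by (rule real_Prod_primes) (rule D)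
        also have "\<dots> \<le> exp (\<eta>' * ln (real N))" using D by simp
        also have "\<dots> = real N powr \<eta>'" using elim by (simp add: powr_def)
        finally have "real (\<Prod>Q) * real (\<Prod>Z) \<le> real N powr \<eta>' * real N powr (\<eta> - \<eta>')"
          by (rule mult_mono[OF _ elim(1) powr_ge_zero of_nat_0_le_iff])
        then have "real (modulus Q) \<le> real N powr \<eta>' * real N powr (\<eta> - \<eta>')"
          by (simp only: modulus_eq[OF D(1,3)] of_nat_mult)
        also have "\<dots> = real N powr \<eta>" by (simp add: powr_add[symmetric])
        finally have 1: "real (modulus Q) \<le> real N powr \<eta>" .
        have "real N powr \<eta> \<le> real (s N) powr \<eta>" using elim \<eta> by (intro powr_mono2) auto
        moreover have "real N powr \<eta> \<le> real N powr 1" using elim \<eta> by (intro powr_mono) auto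
        then have "real N powr \<eta> \<le> real N" using elim by simp
        then have "real (modulus Q) \<le> real N" using 1 by linarith
        then have "modulus Q \<le> s N" using elim(2) by simp
        ultimately show "real (modulus Q) \<le> real (s N) powr \<eta> \<and> modulus Q \<le> s N" using 1 by simp
      qed
    qed
  qed
  show ?thesis unfolding negligible_error_def
  proof (intro conjI allI)
    show "\<exists>C. eventually (\<lambda>N. \<forall>Q\<in>prime_sets B (\<eta>' * ln (real N)).
        0 \<le> err (s N) (modulus Q) \<and> err (s N) (modulus Q) \<le> C * real N * ln (real N) * 2 ^ card Q / real (\<Prod>Q)) sequentially"
    \<comment> \<open>24 is 3 from the trivial bound, times 4 from \<open>s N \<le> 4 * N\<close>,
      times 2 from \<open>ln (s N) \<le> 2 * ln N\<close>.\<close>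
    proof (rule exI[of _ 24])
      show "eventually (\<lambda>N. \<forall>Q\<in>prime_sets B (\<eta>' * ln (real N)).
        0 \<le> err (s N) (modulus Q) \<and> err (s N) (modulus Q) \<le> 24 * real N * ln (real N) * 2 ^ card Q / real (\<Prod>Q)) sequentially"
        using ev s eventually_ge_at_top[of 4]
      proof eventually_elim
        case (elim N)
        show ?case
        proof
          fix Q assume Q: "Q \<in> prime_sets B (\<eta>' * ln (real N))"
          note D = prime_setsD[OF Q]
          have m1: "1 \<le> modulus Q" by (rule modulus_pos) (use D in auto)
          have m2: "modulus Q \<le> s N" using elim(1) Q by blast
          have lnN: "0 \<le> ln (real N)" using elim by simp
          have "ln (real (s N)) \<le> ln (real N * real N)"
          proof (rule ln_mono)
            show "0 < real (s N)" using elim by linarith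
            have "s N \<le> N * N" using elim by (meson le_trans mult_le_mono1)
            then show "real (s N) \<le> real N * real N" by (metis of_nat_le_iff of_nat_mult)
          qed
          then have ls: "ln (real (s N)) \<le> 2 * ln (real N)" using elim by (simp add: ln_mult)
          have "err (s N) (modulus Q) \<le> 3 * (real (s N) * ln (real (s N)) / real (totient (modulus Q)))"
            by (rule triv) (use elim m1 m2 in linarith)+
          also have "\<dots> = 3 * (real (s N) * ln (real (s N)) * (1 / real (totient (modulus Q))))" by simp
          also have "\<dots> \<le> 3 * ((4 * real N) * (2 * ln (real N)) * (2 ^ card Q / real (\<Prod>Q)))"
          proof (intro mult_left_mono mult_mono ls inverse_totient_modulus_le[OF Q])
            show "real (s N) \<le> 4 * real N" using elim by linarith
            show "0 \<le> ln (real (s N))" using elim by simp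
          qed (use elim lnN in auto)
          finally show "0 \<le> err (s N) (modulus Q) \<and> err (s N) (modulus Q) \<le> 24 * real N * ln (real N) * 2 ^ card Q / real (\<Prod>Q)"
            using nn[OF m1] by simp
        qed
      qed
    qed
  next
    fix A :: nat
    obtain C where C: "eventually (\<lambda>N. (\<Sum>q\<in>{1..nat \<lfloor>real N powr \<eta>\<rfloor>}. err N q) \<le> C * real N / ln (real N) ^ A) sequentially"
      using lev unfolding level_bound_def by blast
    have slim: "filterlim s at_top sequentially"
      by (rule filterlim_at_top_mono[OF filterlim_ident]) (use s in \<open>auto elim: eventually_mono\<close>)
    have C': "eventually (\<lambda>N. (\<Sum>q\<in>{1..nat \<lfloor>real (s N) powr \<eta>\<rfloor>}. err (s N) q) \<le> C * real (s N) / ln (real (s N)) ^ A) sequentially"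
      using eventually_compose_filterlim[OF C slim] .
    have "eventually (\<lambda>N. (\<Sum>Q\<in>prime_sets B (\<eta>' * ln (real N)). err (s N) (modulus Q)) \<le> 4 * \<bar>C\<bar> * real N / ln (real N) ^ A) sequentially"
      using C' ev s eventually_ge_at_top[of 2]
    proof eventually_elim
      case (elim N)
      define F where "F = prime_sets B (\<eta>' * ln (real N))"
      have inj: "inj_on modulus F"
        by (rule inj_on_inverseI[where g = "\<lambda>m. prime_factors m - Z"]) (auto simp: F_def prime_factors_modulus)
      have "(\<Sum>Q\<in>F. err (s N) (modulus Q)) = (\<Sum>q\<in>modulus ` F. err (s N) q)"
        by (simp add: sum.reindex[OF inj])
      also have "\<dots> \<le> (\<Sum>q\<in>{1..nat \<lfloor>real (s N) powr \<eta>\<rfloor>}. err (s N) q)"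
      proof (rule sum_mono2)
        show "modulus ` F \<subseteq> {1..nat \<lfloor>real (s N) powr \<eta>\<rfloor>}"
        proof (rule image_subsetI)
          fix Q assume Q: "Q \<in> F"
          have "1 \<le> modulus Q" using prime_setsD[of Q B] Q by (intro modulus_pos) (auto simp: F_def)
          moreover have "real (modulus Q) \<le> real (s N) powr \<eta>" using elim(2) Q by (auto simp: F_def)
          then have "modulus Q \<le> nat \<lfloor>real (s N) powr \<eta>\<rfloor>" by linarith
          ultimately show "modulus Q \<in> {1..nat \<lfloor>real (s N) powr \<eta>\<rfloor>}" by simp
        qed
      qed (auto intro: nn)
      also have "\<dots> \<le> C * real (s N) / ln (real (s N)) ^ A" by (rule elim(1))
      also have "\<dots> \<le> \<bar>C\<bar> * real (s N) / ln (real (s N)) ^ A"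
        using elim by (intro divide_right_mono mult_right_mono) auto
      also have "\<dots> \<le> \<bar>C\<bar> * (4 * real N) / ln (real N) ^ A"
      proof (rule frac_le)
        show "\<bar>C\<bar> * real (s N) \<le> \<bar>C\<bar> * (4 * real N)" using elim by (intro mult_left_mono) linarith+
        show "0 < ln (real N) ^ A" using elim by simp
        show "ln (real N) ^ A \<le> ln (real (s N)) ^ A" using elim by (intro power_mono ln_mono) auto
      qed auto
      finally show ?case by (simp add: F_def mult_ac)
    qed
    then show "\<exists>C. eventually (\<lambda>N. (\<Sum>Q\<in>prime_sets B (\<eta>' * ln (real N)). err (s N) (modulus Q)) \<le> C * real N / ln (real N) ^ A) sequentially"
      by blast
  qed
qed

lemma approx_count:
  assumes Q: "Q \<in> prime_sets B L"
  shows "\<bar>(\<Sum>n | n \<in> {N<..2 * N} \<and> good n \<and> hits Q n. 1) - real N / real (\<Prod>Z) * (\<Prod>p\<in>Q. real k / real p)\<bar> \<le> real k ^ card Q * 2"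
proof -
  note D = prime_setsD[OF Q]
  have m1: "0 < modulus Q" using modulus_pos[of Q] D by force
  have "\<bar>(\<Sum>n | n \<in> {N<..2 * N} \<and> good n \<and> hits Q n. 1) - real (card H) ^ card Q * (real N / real (modulus Q))\<bar> \<le> real k ^ card Q * 2"
  proof (rule hits_sum_approx[OF _ Q order_refl])
    fix \<sigma> x
    show "\<bar>(\<Sum>n | n \<in> {N<..2 * N} \<and> [n = x] (mod modulus Q). 1) - real N / real (modulus Q)\<bar> \<le> 2"
      using card_class_interval[OF m1, of N x] by simp
  qed auto
  moreover have "real (card H) ^ card Q * (real N / real (modulus Q)) = real N / real (\<Prod>Z) * (\<Prod>p\<in>Q. real k / real p)"
  proof -
    have "real (modulus Q) = real (\<Prod>Q) * real (\<Prod>Z)" by (simp only: modulus_eq[OF D(1,3)] of_nat_mult)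
    then show ?thesis unfolding H(2) by (simp add: prod_dividef mult.commute)
  qed
  ultimately show ?thesis by simp
qed

text \<open>Shifting by \<open>r\<close> turns the sum into a difference of two initial sums of the
  Liouville function over one class, each bounded by condition (B), so the main term is 0. The bound
  on \<open>r\<close> keeps \<open>n + r\<close> positive and at most \<open>3 * N\<close>. The
  factor \<open>0 * prod G Q\<close> matches the shape needed by
  \<open>weighted_sum_approx\<close>.\<close>

lemma approx_liouville:
  assumes Q: "Q \<in> prime_sets B L" and N: "\<bar>r\<bar> \<le> int N"
  shows "\<bar>(\<Sum>n | n \<in> {N<..2 * N} \<and> good n \<and> hits Q n. real_of_int (liouville (int n + r))) - 0 * prod G Q\<bar>
    \<le> real k ^ card Q * (2 * errB (3 * N) (modulus Q))"
proof -
  note D = prime_setsD[OF Q]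
  have m1: "1 \<le> modulus Q" using modulus_pos[of Q] D by simp
  have "\<bar>(\<Sum>n | n \<in> {N<..2 * N} \<and> good n \<and> hits Q n. real_of_int (liouville (int n + r))) - real (card H) ^ card Q * 0\<bar>
    \<le> real k ^ card Q * (2 * errB (3 * N) (modulus Q))"
  proof (rule hits_sum_approx[OF _ Q order_refl])
    show "0 \<le> 2 * errB (3 * N) (modulus Q)" using errB_nonneg[OF m1] by simp
    fix \<sigma> x
    define M where "M = modulus Q"
    define a where "a = nat ((int x + r) mod int M)"
    have M: "0 < M" using m1 by (simp add: M_def)
    have ia: "int a = (int x + r) mod int M" using M by (simp add: a_def)
    then have aM: "a < M" using M by (metis of_nat_0_less_iff of_nat_less_iff pos_mod_bound)
    define S where "S = (\<lambda>y. {n. 1 \<le> n \<and> n \<le> y \<and> [n = a] (mod M)})"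
    define y1 y2 where "y1 = nat (int N + r)" and "y2 = nat (2 * int N + r)"
    have y: "int y1 = int N + r" "int y2 = 2 * int N + r" "y1 \<le> y2" "y2 \<le> 3 * N"
      using N by (auto simp: y1_def y2_def)
    have cong: "[nat (int n + r) = a] (mod M) \<longleftrightarrow> [n = x] (mod M)" if "N < n" for n
    proof -
      have "0 \<le> int n + r" using that N by linarith
      then have "[nat (int n + r) = a] (mod M) \<longleftrightarrow> [int n + r = int a] (mod int M)"
        by (simp add: cong_int_iff[symmetric])
      also have "\<dots> \<longleftrightarrow> [int n + r = int x + r] (mod int M)" by (simp add: ia cong_def)
      also have "\<dots> \<longleftrightarrow> [int n = int x] (mod int M)" by (rule cong_add_rcancel)
      finally show ?thesis by (simp add: cong_int_iff)
    qed
    have "(\<Sum>n | n \<in> {N<..2 * N} \<and> [n = x] (mod M). real_of_int (liouville (int n + r)))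
        = (\<Sum>m\<in>S y2 - S y1. real_of_int (liouville (int m)))"
    proof (rule sum.reindex_bij_witness[of _ "\<lambda>m. nat (int m - r)" "\<lambda>n. nat (int n + r)"])
      fix n assume n: "n \<in> {n. n \<in> {N<..2 * N} \<and> [n = x] (mod M)}"
      have p: "0 < int n + r" using n N by auto
      show "nat (int (nat (int n + r)) - r) = n" using p by simp
      show "nat (int n + r) \<in> S y2 - S y1"
        using n p cong[of n] y unfolding S_def by auto
      show "real_of_int (liouville (int (nat (int n + r)))) = real_of_int (liouville (int n + r))" using p by simp
    next
      fix m assume m: "m \<in> S y2 - S y1"
      then have m': "y1 < m" "m \<le> y2" "[m = a] (mod M)" by (auto simp: S_def)
      have p: "int N < int m - r" "int m - r \<le> 2 * int N" using m' y by linarith+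
      show "nat (int (nat (int m - r)) + r) = m" using p by simp
      have "[nat (int (nat (int m - r)) + r) = a] (mod M)" using m' p by simp
      then have "[nat (int m - r) = x] (mod M)" using cong[of "nat (int m - r)"] p by simp
      then show "nat (int m - r) \<in> {n. n \<in> {N<..2 * N} \<and> [n = x] (mod M)}" using p by auto
    qed
    also have "\<dots> = (\<Sum>m\<in>S y2. real_of_int (liouville (int m))) - (\<Sum>m\<in>S y1. real_of_int (liouville (int m)))"
      by (rule sum_diff) (use y in \<open>auto simp: S_def\<close>)
    finally have eq: "(\<Sum>n | n \<in> {N<..2 * N} \<and> [n = x] (mod M). real_of_int (liouville (int n + r)))
        = real_of_int (\<Sum>m\<in>S y2. liouville (int m)) - real_of_int (\<Sum>m\<in>S y1. liouville (int m))"
      by simp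
    have "\<bar>real_of_int (\<Sum>m\<in>S y2. liouville (int m))\<bar> \<le> errB (3 * N) M"
      "\<bar>real_of_int (\<Sum>m\<in>S y1. liouville (int m))\<bar> \<le> errB (3 * N) M"
      unfolding S_def by (rule errB_ge; use aM y in simp)+
    then show "\<bar>(\<Sum>n | n \<in> {N<..2 * N} \<and> [n = x] (mod modulus Q). real_of_int (liouville (int n + r))) - 0\<bar> \<le> 2 * errB (3 * N) (modulus Q)"
      unfolding eq[unfolded M_def] M_def by linarith
  qed auto
  then show ?thesis by simp
qed

text \<open>If \<open>p\<close> in \<open>Q\<close> divides \<open>n + h\<close>, then
  \<open>p \<le> exp L \<le> N < n + h\<close>, so \<open>n + h\<close> is not prime: the shift
  \<open>h\<close> is never chosen, and \<open>k - 1\<close> choices per prime remain. For those,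
  the class of \<open>n + h\<close> is coprime to the modulus, at small primes by
  \<open>cres\<close> and at primes of \<open>Q\<close> because
  \<open>\<sigma> p \<noteq> h\<close>; condition (A) therefore applies.\<close>

lemma approx_primes:
  assumes Q: "Q \<in> prime_sets B L" and N: "exp L \<le> real N" and h: "h \<in> H"
  shows "\<bar>(\<Sum>n | n \<in> {N<..2 * N} \<and> good n \<and> hits Q n. vth (n + h))
      - real N / real (totient (\<Prod>Z)) * (\<Prod>p\<in>Q. (real k - 1) / (real p - 1))\<bar>
    \<le> real k ^ card Q * (errA (2 * N + h) (modulus Q) + errA (N + h) (modulus Q))"
proof -
  note D = prime_setsD[OF Q]
  have m1: "1 \<le> modulus Q" using modulus_pos[of Q] D by simp
  have cardH: "real (card (H - {h})) = real k - 1" using H h k by (simp add: of_nat_diff)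
  have "\<bar>(\<Sum>n | n \<in> {N<..2 * N} \<and> good n \<and> hits Q n. vth (n + h))
      - real (card (H - {h})) ^ card Q * (real N / real (totient (modulus Q)))\<bar>
    \<le> real k ^ card Q * (errA (2 * N + h) (modulus Q) + errA (N + h) (modulus Q))"
  proof (rule hits_sum_approx[OF _ Q])
    show "0 \<le> errA (2 * N + h) (modulus Q) + errA (N + h) (modulus Q)"
      using errA_nonneg[OF m1] by (simp add: add_nonneg_nonneg)
    show "vth (n + h) = 0" if p: "p \<in> Q" and "h' \<in> H - (H - {h})" and n: "n \<in> {N<..2 * N}" and "p dvd n + h'" for p h' n
    proof -
      have dvd: "p dvd n + h" using that by auto
      have "ln (real p) \<le> lnsum Q" using lnsum_mono[of Q "{p}"] D p by (simp add: lnsum_def)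
      then have "exp (ln (real p)) \<le> exp L" using D by simp
      then have "real p \<le> real N" using N D(2)[OF p] prime_gt_0_nat[of p] by simp
      then have "p < n + h" using n by auto
      moreover have "p \<noteq> 1" using D(2)[OF p] by auto
      ultimately have "\<not> prime (n + h)" using dvd by (metis less_irrefl prime_nat_iff)
      then show ?thesis by (simp add: vth_def)
    qed
    fix \<sigma> x
    assume \<sigma>: "\<sigma> \<in> PiE Q (\<lambda>_. H - {h})"
      and x: "\<And>n. (good n \<and> (\<forall>p\<in>Q. p dvd n + \<sigma> p)) \<longleftrightarrow> [n = x] (mod modulus Q)"
    define M where "M = modulus Q"
    define a where "a = (x + h) mod M"
    have M: "0 < M" using m1 by (simp add: M_def)
    have aM: "a < M" using M by (simp add: a_def)
    have gx: "good x" "\<And>p. p \<in> Q \<Longrightarrow> p dvd x + \<sigma> p" using x[of x] by auto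
    have ndvd: "\<not> p dvd x + h" if p: "p \<in> Q \<union> Z" for p
    proof (cases "p \<in> Z")
      case True
      then have "[x + h = cres p + h] (mod p)" using gx(1) by (simp add: good_def cong_add_rcancel_nat)
      then have "p dvd x + h \<longleftrightarrow> p dvd cres p + h" by (rule cong_dvd_iff)
      then show ?thesis using cres[of p h] True h by (simp add: Z_def)
    next
      case False
      then have pQ: "p \<in> Q" using p by simp
      show ?thesis
      proof
        assume "p dvd x + h"
        then have "[x + h = x + \<sigma> p] (mod p)" using gx(2)[OF pQ] by (metis cong_0_iff cong_sym cong_trans)
        then have "[h = \<sigma> p] (mod p)" by (simp add: cong_add_lcancel_nat)
        moreover have "\<sigma> p \<in> H - {h}" using PiE_mem[OF \<sigma> pQ] .
        moreover have "h < p" "\<sigma> p < p" using H(3) h D(3)[OF pQ] \<open>\<sigma> p \<in> H - {h}\<close> by (auto intro: le_less_trans)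
        ultimately show False by (auto simp: cong_def)
      qed
    qed
    have "coprime (x + h) M" unfolding M_def modulus_def
    proof (rule prod_coprime_right)
      fix p assume p: "p \<in> Q \<union> Z"
      then have "prime p" using D Z by auto
      then show "coprime (x + h) p" using ndvd[OF p] by (metis coprime_commute prime_imp_coprime)
    qed
    then have cop: "coprime a M" unfolding a_def using M by (simp add: coprime_mod_left_iff)
    define S where "S = (\<lambda>y. {p. prime p \<and> p \<le> y \<and> [p = a] (mod M)})"
    have finS: "finite (S y)" for y by (rule finite_subset[of _ "{..y}"]) (auto simp: S_def)
    have "(\<Sum>n | n \<in> {N<..2 * N} \<and> [n = x] (mod M). vth (n + h))
       = (\<Sum>n | n \<in> {n. n \<in> {N<..2 * N} \<and> [n = x] (mod M)} \<and> prime (n + h). ln (real (n + h)))"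
      unfolding vth_def by (rule sum.inter_filter[symmetric]) simp
    also have "\<dots> = (\<Sum>p\<in>S (2 * N + h) - S (N + h). ln (real p))"
    proof (rule sum.reindex_bij_witness[of _ "\<lambda>p. p - h" "\<lambda>n. n + h"])
      fix n assume n: "n \<in> {n. n \<in> {n. n \<in> {N<..2 * N} \<and> [n = x] (mod M)} \<and> prime (n + h)}"
      then have "[n + h = x + h] (mod M)" by (simp only: cong_add_rcancel_nat mem_Collect_eq)
      then have "[n + h = a] (mod M)" by (simp add: a_def cong_def)
      then show "n + h \<in> S (2 * N + h) - S (N + h)" using n by (auto simp: S_def)
    next
      fix p assume p: "p \<in> S (2 * N + h) - S (N + h)"
      then have p': "N + h < p" "p \<le> 2 * N + h" "prime p" "[p = a] (mod M)" by (auto simp: S_def)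
      then show "p - h + h = p" by simp
      have "[p - h + h = x + h] (mod M)" using p' by (simp add: a_def cong_def)
      then have "[p - h = x] (mod M)" by (simp only: cong_add_rcancel_nat)
      then show "p - h \<in> {n. n \<in> {n. n \<in> {N<..2 * N} \<and> [n = x] (mod M)} \<and> prime (n + h)}"
        using p' by auto
    qed auto
    also have "\<dots> = (\<Sum>p\<in>S (2 * N + h). ln (real p)) - (\<Sum>p\<in>S (N + h). ln (real p))"
      by (rule sum_diff[OF finS]) (auto simp: S_def)
    finally have eq: "(\<Sum>n | n \<in> {N<..2 * N} \<and> [n = x] (mod M). vth (n + h))
       = (\<Sum>p\<in>S (2 * N + h). ln (real p)) - (\<Sum>p\<in>S (N + h). ln (real p))" .
    have e1: "\<bar>(\<Sum>p\<in>S (2 * N + h). ln (real p)) - real (2 * N + h) / real (totient M)\<bar> \<le> errA (2 * N + h) M"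
      and e2: "\<bar>(\<Sum>p\<in>S (N + h). ln (real p)) - real (N + h) / real (totient M)\<bar> \<le> errA (N + h) M"
      unfolding S_def by (rule errA_ge[OF aM cop])+
    have "real (2 * N + h) / real (totient M) = real (N + h) / real (totient M) + real N / real (totient M)"
      by (simp add: add_divide_distrib[symmetric])
    then show "\<bar>(\<Sum>n | n \<in> {N<..2 * N} \<and> [n = x] (mod modulus Q). vth (n + h)) - real N / real (totient (modulus Q))\<bar>
      \<le> errA (2 * N + h) (modulus Q) + errA (N + h) (modulus Q)"
      unfolding M_def[symmetric] eq using e1 e2 by linarith
  qed auto
  moreover have "real (card (H - {h})) ^ card Q * (real N / real (totient (modulus Q)))
     = real N / real (totient (\<Prod>Z)) * (\<Prod>p\<in>Q. (real k - 1) / (real p - 1))"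
  proof -
    have "real (totient (modulus Q)) = (\<Prod>p\<in>Q \<union> Z. real p - 1)"
      unfolding modulus_def by (rule real_totient_Prod_primes) (use D Z in auto)
    also have "\<dots> = (\<Prod>p\<in>Q. real p - 1) * (\<Prod>p\<in>Z. real p - 1)"
      by (rule prod.union_disjoint) (use D Z disjoint_Z in auto)
    also have "(\<Prod>p\<in>Z. real p - 1) = real (totient (\<Prod>Z))"
      by (rule real_totient_Prod_primes[symmetric]) (use Z in auto)
    finally show ?thesis unfolding cardH by (simp add: prod_dividef mult.commute)
  qed
  ultimately show ?thesis by simp
qed

end

section \<open>Main terms\<close>

lemma divisor_family_prime_sets: "divisor_family (prime_sets B L)"
  by unfold_locales (auto simp: finite_prime_sets dest: prime_setsD(1) intro: prime_sets_subset)

lemma prime_pairs_eq_Sigma: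
  assumes "0 \<le> L"
  shows "prime_pairs B L = Sigma (prime_sets B L) (\<lambda>S. {T. S \<inter> T = {} \<and> S \<union> T \<in> prime_sets B L})"
  by (auto simp: prime_pairs_def intro: prime_sets_subset)

lemma finite_complements: "finite {T. S \<inter> T = {} \<and> S \<union> T \<in> prime_sets B L}"
  by (rule finite_subset[OF _ finite_prime_sets[of B L]]) (auto intro: prime_sets_subset)

lemma sum_pairs_by_fst:
  fixes f :: "nat set \<Rightarrow> nat set \<Rightarrow> real"
  assumes "0 \<le> L"
  shows "(\<Sum>x\<in>prime_pairs B L. f (fst x) (snd x)) = (\<Sum>S\<in>prime_sets B L. \<Sum>T | S \<inter> T = {} \<and> S \<union> T \<in> prime_sets B L. f S T)"
  unfolding prime_pairs_eq_Sigma[OF assms]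
  by (subst sum.Sigma) (auto simp: finite_prime_sets finite_complements case_prod_beta)

text \<open>Expands each product over the splittings of \<open>Q\<close>. This rewrites a sum over
  single sets as one over pairs, where the prime sum lives.\<close>

lemma sum_pairs_by_union:
  fixes \<alpha> \<beta> :: "nat \<Rightarrow> real"
  shows "(\<Sum>x\<in>prime_pairs B L. prod \<alpha> (fst x) * prod \<beta> (snd x) * F (fst x \<union> snd x))
    = (\<Sum>Q\<in>prime_sets B L. (\<Prod>p\<in>Q. \<alpha> p + \<beta> p) * F Q)"
proof -
  have "(\<Sum>x\<in>prime_pairs B L. prod \<alpha> (fst x) * prod \<beta> (snd x) * F (fst x \<union> snd x))
     = (\<Sum>y\<in>Sigma (prime_sets B L) Pow. prod \<alpha> (snd y) * prod \<beta> (fst y - snd y) * F (fst y))"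
  proof (rule sum.reindex_bij_witness[of _ "\<lambda>y. (snd y, fst y - snd y)" "\<lambda>x. (fst x \<union> snd x, fst x)"])
    fix x assume "x \<in> prime_pairs B L"
    then have d: "fst x \<inter> snd x = {}" and u: "fst x \<union> snd x \<in> prime_sets B L" by (auto simp: prime_pairs_def)
    have e: "fst x \<union> snd x - fst x = snd x" using d by auto
    show "(snd (fst x \<union> snd x, fst x), fst (fst x \<union> snd x, fst x) - snd (fst x \<union> snd x, fst x)) = x"
      using e by simp
    show "(fst x \<union> snd x, fst x) \<in> Sigma (prime_sets B L) Pow" using u by auto
    show "prod \<alpha> (snd (fst x \<union> snd x, fst x)) * prod \<beta> (fst (fst x \<union> snd x, fst x) - snd (fst x \<union> snd x, fst x)) *
        F (fst (fst x \<union> snd x, fst x)) = prod \<alpha> (fst x) * prod \<beta> (snd x) * F (fst x \<union> snd x)"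
      using e by simp
  next
    fix y assume "y \<in> Sigma (prime_sets B L) Pow"
    then have y: "fst y \<in> prime_sets B L" "snd y \<subseteq> fst y" by auto
    then have e: "snd y \<union> (fst y - snd y) = fst y" by auto
    show "(fst (snd y, fst y - snd y) \<union> snd (snd y, fst y - snd y), fst (snd y, fst y - snd y)) = y"
      using e by simp
    show "(snd y, fst y - snd y) \<in> prime_pairs B L" using y e by (auto simp: prime_pairs_def)
  qed
  also have "\<dots> = (\<Sum>Q\<in>prime_sets B L. \<Sum>S\<in>Pow Q. prod \<alpha> S * prod \<beta> (Q - S) * F Q)"
    by (subst sum.Sigma) (auto simp: finite_prime_sets case_prod_beta dest: prime_setsD(1))
  also have "\<dots> = (\<Sum>Q\<in>prime_sets B L. (\<Prod>p\<in>Q. \<alpha> p + \<beta> p) * F Q)"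
    by (intro sum.cong refl) (simp add: prod_add[OF prime_setsD(1)] sum_distrib_right)
  finally show ?thesis .
qed

context tuple_sieve
begin

text \<open>\<open>gv p\<close> is the density of the condition \<open>p dvd \<Prod>(n + h)\<close>, and \<open>gv p * \<gamma>v p\<close> its density
  when one of the \<open>n + h\<close> is prime. Diagonalising the form for the second density in the variables
  of the first one produces \<open>\<alpha>v\<close> and \<open>\<beta>v\<close>.\<close>

definition av :: "nat \<Rightarrow> real" where "av p = real k / (real p - real k)"
definition gv :: "nat \<Rightarrow> real" where "gv p = real k / real p"
definition \<gamma>v :: "nat \<Rightarrow> real" where "\<gamma>v p = (real k - 1) * real p / (real k * (real p - 1))"
definition \<alpha>v :: "nat \<Rightarrow> real" where "\<alpha>v p = (real k - 1) * real p / ((real p - 1) * (real p - real k))"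
definition \<beta>v :: "nat \<Rightarrow> real" where "\<beta>v p = 1 / (real p - 1)"
definition zf :: "real \<Rightarrow> real \<Rightarrow> nat set \<Rightarrow> real" where "zf b L Q = 1 + b * ((L - lnsum Q) / L)"
definition lam :: "real \<Rightarrow> real \<Rightarrow> nat set \<Rightarrow> real" where
  "lam b L = divisor_family.sieve_weight (prime_sets B L) gv av (zf b L)"

text \<open>The purpose of \<open>2 * k \<le> B\<close>: the denominators \<open>p - k\<close> and
  \<open>p - 1\<close> stay above \<open>p / 2\<close>.\<close>

lemma large_prime:
  assumes "B < p"
  shows "2 * real k < real p" "1 < real p" "2 \<le> real k" "real p / 2 \<le> real p - real k" "real p / 2 \<le> real p - 1"
proof -
  have "2 * k < p" using assms k by simp
  then have "real (2 * k) < real p" by (simp only: of_nat_less_iff)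
  then show 1: "2 * real k < real p" by simp
  have "real 2 \<le> real k" using k by (simp only: of_nat_le_iff)
  then show 2: "2 \<le> real k" by simp
  show "1 < real p" "real p / 2 \<le> real p - real k" "real p / 2 \<le> real p - 1" using 1 2 by linarith+
qed

lemma density_\<alpha>v: "density B \<alpha>v (real k - 1)"
  unfolding density_def
proof (intro conjI allI impI)
  show "0 \<le> real k - 1" using k by simp
  show "0 \<le> \<alpha>v p" if "prime p \<and> B < p" for p
    unfolding \<alpha>v_def using large_prime[of p] that by (intro divide_nonneg_nonneg mult_nonneg_nonneg) auto
  show "\<exists>C\<ge>0. \<forall>p. prime p \<and> B < p \<longrightarrow> \<bar>\<alpha>v p - (real k - 1) / real p\<bar> \<le> C / (real p)\<^sup>2"
  \<comment> \<open>The difference has numerator at most \<open>(k - 1) * (k + 1) * p\<close>; the 4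
    comes from bounding \<open>p - 1\<close> and \<open>p - k\<close> below by
    \<open>p / 2\<close>.\<close>
  proof (rule exI[of _ "4 * (real k - 1) * (real k + 1)"], intro conjI allI impI)
    show "0 \<le> 4 * (real k - 1) * (real k + 1)" using k by simp
    fix p assume p: "prime p \<and> B < p"
    define x where "x = real p"
    define K where "K = real k"
    note L = large_prime[of p, folded x_def K_def]
    have L': "2 * K < x" "1 < x" "2 \<le> K" "x / 2 \<le> x - K" "x / 2 \<le> x - 1" using L p by auto
    have eq: "(K - 1) * x / ((x - 1) * (x - K)) - (K - 1) / x = (K - 1) * ((K + 1) * x - K) / (x * ((x - 1) * (x - K)))"
    proof -
      have "x \<noteq> 0" "x - 1 \<noteq> 0" "x - K \<noteq> 0" using L' by auto
      then show ?thesis by (simp add: divide_simps) (simp add: algebra_simps)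
    qed
    have den: "x * (x / 2 * (x / 2)) \<le> x * ((x - 1) * (x - K))"
      using L' by (intro mult_left_mono mult_mono) auto
    have num: "0 \<le> (K - 1) * ((K + 1) * x - K)" "(K - 1) * ((K + 1) * x - K) \<le> (K - 1) * ((K + 1) * x)"
    proof -
      have "K * 1 \<le> (K + 1) * x" using L' by (intro mult_mono) auto
      then show "0 \<le> (K - 1) * ((K + 1) * x - K)" using L' by (intro mult_nonneg_nonneg) auto
      show "(K - 1) * ((K + 1) * x - K) \<le> (K - 1) * ((K + 1) * x)" using L' by (intro mult_left_mono) auto
    qed
    have pos: "0 < x * (x / 2 * (x / 2))" using L' by simp
    have "\<bar>(K - 1) * ((K + 1) * x - K) / (x * ((x - 1) * (x - K)))\<bar> = (K - 1) * ((K + 1) * x - K) / (x * ((x - 1) * (x - K)))"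
      using num(1) less_le_trans[OF pos den] by (intro abs_of_nonneg divide_nonneg_pos) auto
    also have "\<dots> \<le> (K - 1) * ((K + 1) * x) / (x * (x / 2 * (x / 2)))"
      using num den pos by (intro frac_le) auto
    also have "\<dots> = 4 * (K - 1) * (K + 1) / x\<^sup>2" using L' by (simp add: power2_eq_square field_simps)
    finally show "\<bar>\<alpha>v p - (real k - 1) / real p\<bar> \<le> 4 * (real k - 1) * (real k + 1) / (real p)\<^sup>2"
      unfolding \<alpha>v_def using eq by (simp add: x_def K_def)
  qed
qed

lemma density_\<beta>v: "density B \<beta>v 1"
  unfolding density_def
proof (intro conjI allI impI)
  show "0 \<le> \<beta>v p" if "prime p \<and> B < p" for p
    unfolding \<beta>v_def using large_prime[of p] that by auto
  show "\<exists>C\<ge>0. \<forall>p. prime p \<and> B < p \<longrightarrow> \<bar>\<beta>v p - 1 / real p\<bar> \<le> C / (real p)\<^sup>2"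
  proof (rule exI[of _ 2], intro conjI allI impI)
    fix p assume p: "prime p \<and> B < p"
    define x where "x = real p"
    have x: "1 < x" "x / 2 \<le> x - 1" using large_prime[of p] p by (auto simp: x_def)
    have "1 / (x - 1) - 1 / x = 1 / (x * (x - 1))" using x by (simp add: divide_simps)
    moreover have "1 / (x * (x - 1)) \<le> 1 / (x * (x / 2))"
      using x by (intro divide_left_mono mult_left_mono mult_pos_pos) auto
    moreover have "0 \<le> 1 / (x * (x - 1))" using x by simp
    ultimately show "\<bar>\<beta>v p - 1 / real p\<bar> \<le> 2 / (real p)\<^sup>2"
      unfolding \<beta>v_def by (simp add: x_def[symmetric] power2_eq_square)
  qed simp
qed simp

text \<open>The identity that places both main terms on one measure: the count carries
  \<open>av\<close> at each prime, the prime sum carries \<open>\<alpha>v\<close> on the first and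
  \<open>\<beta>v\<close> on the second component.\<close>

lemma \<alpha>v_plus_\<beta>v: "B < p \<Longrightarrow> \<alpha>v p + \<beta>v p = av p"
proof -
  assume p: "B < p"
  have "real p - 1 \<noteq> 0" "real p - real k \<noteq> 0" using large_prime[OF p] by auto
  then show ?thesis unfolding \<alpha>v_def \<beta>v_def av_def
    by (simp add: divide_simps) (simp add: algebra_simps)
qed

lemma zf_bounds:
  assumes "Q \<in> prime_sets B L" "0 < L" "0 \<le> b"
  shows "0 \<le> zf b L Q" "zf b L Q \<le> 1 + b"
proof -
  note D = prime_setsD[OF assms(1)]
  have "0 \<le> (L - lnsum Q) / L" "(L - lnsum Q) / L \<le> 1" using D assms by auto
  then have "0 \<le> b * ((L - lnsum Q) / L)" "b * ((L - lnsum Q) / L) \<le> b"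
    using assms(3) by (auto intro: mult_nonneg_nonneg mult_left_le simp del: times_divide_eq_right)
  then show "0 \<le> zf b L Q" "zf b L Q \<le> 1 + b"
    unfolding zf_def by linarith+
qed

text \<open>Writing \<open>Q\<close> as \<open>D\<close> plus a disjoint rest factors out
  \<open>prod av D\<close>, and \<open>av p / gv p = p / (p - k)\<close> is at most 2. The remaining
  sum is a divisor sum because \<open>av p \<le> 2 * k / p\<close>.\<close>

lemma lam_bound:
  assumes D: "D \<in> prime_sets B L" and L: "0 < L" and b: "0 \<le> b"
  shows "\<bar>lam b L D\<bar> \<le> ((1 + b) * (1 + L) ^ (2 * k)) * 2 ^ card D"
proof -
  interpret fam: divisor_family "prime_sets B L" by (rule divisor_family_prime_sets)
  note DD = prime_setsD[OF D]
  have av0: "0 \<le> av p" "av p \<le> real (2 * k) / real p" if "B < p" for p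
  proof -
    note lp = large_prime[OF that]
    show "0 \<le> av p" unfolding av_def using lp by auto
    have "real k / (real p - real k) \<le> real k / (real p / 2)" using lp by (intro divide_left_mono mult_pos_pos) auto
    then show "av p \<le> real (2 * k) / real p" unfolding av_def by (simp add: mult.commute)
  qed
  have S: "(\<Sum>T\<in>prime_sets B L. prod av T) \<le> (1 + L) ^ (2 * k)"
  proof -
    have "(\<Sum>T\<in>prime_sets B L. prod av T) \<le> (\<Sum>T\<in>prime_sets B L. real (2 * k) ^ card T / real (\<Prod>T))"
    proof (rule sum_mono)
      fix T assume T: "T \<in> prime_sets B L"
      have "prod av T \<le> (\<Prod>p\<in>T. real (2 * k) / real p)"
        by (rule prod_mono) (use av0 prime_setsD(3)[OF T] in blast)
      then show "prod av T \<le> real (2 * k) ^ card T / real (\<Prod>T)" by (simp add: prod_dividef)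
    qed
    also have "\<dots> \<le> (1 + L) ^ (2 * k)" by (rule sum_power_card_over_Prod_le) (use L in simp)
    finally show ?thesis .
  qed
  have T: "(\<Sum>Q | Q \<in> prime_sets B L \<and> D \<subseteq> Q. prod av Q) \<le> prod av D * (\<Sum>T\<in>prime_sets B L. prod av T)"
  proof -
    have "(\<Sum>Q | Q \<in> prime_sets B L \<and> D \<subseteq> Q. prod av Q) = (\<Sum>Q | Q \<in> prime_sets B L \<and> D \<subseteq> Q. prod av D * prod av (Q - D))"
    proof (rule sum.cong[OF refl])
      fix Q assume "Q \<in> {Q. Q \<in> prime_sets B L \<and> D \<subseteq> Q}"
      then have "finite Q" "D \<subseteq> Q" using prime_setsD(1) by auto
      then show "prod av Q = prod av D * prod av (Q - D)" by (metis prod.subset_diff mult.commute)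
    qed
    also have "\<dots> = prod av D * (\<Sum>T\<in>(\<lambda>Q. Q - D) ` {Q. Q \<in> prime_sets B L \<and> D \<subseteq> Q}. prod av T)"
    proof -
      have "inj_on (\<lambda>Q. Q - D) {Q. Q \<in> prime_sets B L \<and> D \<subseteq> Q}" by (rule inj_onI) blast
      then show ?thesis by (simp add: sum.reindex sum_distrib_left)
    qed
    also have "\<dots> \<le> prod av D * (\<Sum>T\<in>prime_sets B L. prod av T)"
    proof (intro mult_left_mono sum_mono2)
      show "0 \<le> prod av D" by (rule prod_nonneg) (use av0 DD in blast)
      show "0 \<le> prod av T" if "T \<in> prime_sets B L - (\<lambda>Q. Q - D) ` {Q. Q \<in> prime_sets B L \<and> D \<subseteq> Q}" for T
      proof (rule prod_nonneg)
        fix p assume "p \<in> T"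
        then have "B < p" using that prime_setsD(3)[of T B L] by blast
        then show "0 \<le> av p" by (rule av0)
      qed
    qed (auto simp: finite_prime_sets intro: prime_sets_subset)
    finally show ?thesis .
  qed
  have "\<bar>lam b L D\<bar> = (\<Prod>p\<in>D. 1 / gv p) * \<bar>\<Sum>Q | Q \<in> prime_sets B L \<and> D \<subseteq> Q. prod av Q * zf b L Q\<bar>"
  proof -
    have "\<bar>\<Prod>p\<in>D. - 1 / gv p\<bar> = (\<Prod>p\<in>D. 1 / gv p)"
      unfolding abs_prod by (intro prod.cong refl) (simp add: gv_def)
    then show ?thesis unfolding lam_def fam.sieve_weight_def abs_mult by simp
  qed
  also have "\<dots> \<le> (\<Prod>p\<in>D. 1 / gv p) * ((1 + b) * (prod av D * (1 + L) ^ (2 * k)))"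
  proof (rule mult_left_mono)
    have "\<bar>\<Sum>Q | Q \<in> prime_sets B L \<and> D \<subseteq> Q. prod av Q * zf b L Q\<bar>
       \<le> (\<Sum>Q | Q \<in> prime_sets B L \<and> D \<subseteq> Q. prod av Q * (1 + b))"
    proof (rule order_trans[OF sum_abs], rule sum_mono)
      fix Q assume "Q \<in> {Q. Q \<in> prime_sets B L \<and> D \<subseteq> Q}"
      then have Q: "Q \<in> prime_sets B L" by simp
      have "0 \<le> prod av Q" by (rule prod_nonneg) (use av0 prime_setsD(3)[OF Q] in blast)
      then show "\<bar>prod av Q * zf b L Q\<bar> \<le> prod av Q * (1 + b)"
        using zf_bounds[OF Q L b] by (simp add: abs_mult mult_left_mono)
    qed
    also have "\<dots> = (1 + b) * (\<Sum>Q | Q \<in> prime_sets B L \<and> D \<subseteq> Q. prod av Q)"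
      by (simp add: sum_distrib_left mult.commute)
    also have "\<dots> \<le> (1 + b) * (prod av D * (1 + L) ^ (2 * k))"
    proof (rule mult_left_mono)
      have "0 \<le> prod av D" by (rule prod_nonneg) (use av0 DD in blast)
      then show "(\<Sum>Q | Q \<in> prime_sets B L \<and> D \<subseteq> Q. prod av Q) \<le> prod av D * (1 + L) ^ (2 * k)"
        using T mult_left_mono[OF S, of "prod av D"] by linarith
    qed (use b in simp)
    finally show "\<bar>\<Sum>Q | Q \<in> prime_sets B L \<and> D \<subseteq> Q. prod av Q * zf b L Q\<bar> \<le> (1 + b) * (prod av D * (1 + L) ^ (2 * k))" .
  qed (auto intro!: prod_nonneg simp: gv_def)
  also have "\<dots> = ((1 + b) * (1 + L) ^ (2 * k)) * (\<Prod>p\<in>D. 1 / gv p * av p)"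
    by (simp only: prod.distrib) (simp only: mult_ac)
  also have "\<dots> \<le> ((1 + b) * (1 + L) ^ (2 * k)) * (\<Prod>p\<in>D. 2)"
  proof (intro mult_left_mono prod_mono conjI)
    fix p assume "p \<in> D"
    then have p: "B < p" by (rule DD)
    note lp = large_prime[OF p]
    have e: "1 / gv p * av p = real p / (real p - real k)" using lp by (simp add: gv_def av_def)
    show "1 / gv p * av p \<le> 2" "0 \<le> 1 / gv p * av p" unfolding e using lp by (auto simp: field_simps)
  qed (use b L in auto)
  finally show ?thesis by simp
qed

text \<open>The case \<open>\<gamma> = 1\<close>, where the inner sum collapses to
  \<open>T = {}\<close>. Since \<open>av\<close> is the reciprocal of \<open>h\<close>, the diagonal
  coefficient \<open>h * av^2\<close> is \<open>av\<close> itself, which then splits as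
  \<open>\<alpha>v + \<beta>v\<close>.\<close>

lemma count_main_term:
  assumes mert: mertens and L: "0 < L"
  shows "(\<Sum>D\<in>prime_sets B L. \<Sum>E\<in>prime_sets B L. lam b L D * lam b L E * (\<Prod>p\<in>D \<union> E. real k / real p))
    = pair_moments.mass B \<alpha>v \<beta>v L * pair_moments.avg B \<alpha>v \<beta>v L (\<lambda>x. (1 + b * pair_moments.vpart L x)\<^sup>2)"
proof -
  interpret fam: divisor_family "prime_sets B L" by (rule divisor_family_prime_sets)
  interpret pm: pair_moments B \<alpha>v \<beta>v "real k - 1" 1
    by unfold_locales (rule density_\<alpha>v density_\<beta>v mert)+
  define h where "h = (\<lambda>p. 1 / gv p - 1)"
  have "(\<Sum>D\<in>prime_sets B L. \<Sum>E\<in>prime_sets B L. lam b L D * lam b L E * (\<Prod>p\<in>D \<union> E. gv p * 1))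
    = (\<Sum>S\<in>prime_sets B L. (\<Prod>p\<in>S. h p * (1 * av p)\<^sup>2) *
        (\<Sum>T | S \<inter> T = {} \<and> S \<union> T \<in> prime_sets B L. prod (\<lambda>p. av p * (1 - 1)) T * zf b L (S \<union> T))\<^sup>2)"
    unfolding lam_def
  proof (rule fam.sieve_weight_quadratic_form)
    fix p S assume "S \<in> prime_sets B L" "p \<in> S"
    then have "B < p" by (rule prime_setsD(3))
    note lp = large_prime[OF this]
    show "gv p \<noteq> 0 \<and> (1::real) \<noteq> 0" using lp by (auto simp: gv_def)
    show "h p = 1 / (gv p * 1) - 1" by (simp add: h_def)
  qed
  also have "\<dots> = (\<Sum>S\<in>prime_sets B L. (\<Prod>p\<in>S. \<alpha>v p + \<beta>v p) * (zf b L S)\<^sup>2)"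
  proof (rule sum.cong[OF refl])
    fix S assume S: "S \<in> prime_sets B L"
    have "(\<Sum>T | S \<inter> T = {} \<and> S \<union> T \<in> prime_sets B L. prod (\<lambda>p. av p * (1 - 1)) T * zf b L (S \<union> T))
        = (\<Sum>T\<in>{{}}. prod (\<lambda>p. av p * (1 - 1)) T * zf b L (S \<union> T))"
    proof (rule sum.mono_neutral_right)
      show "\<forall>T\<in>{T. S \<inter> T = {} \<and> S \<union> T \<in> prime_sets B L} - {{}}. prod (\<lambda>p. av p * (1 - 1)) T * zf b L (S \<union> T) = 0"
      proof
        fix T assume T: "T \<in> {T. S \<inter> T = {} \<and> S \<union> T \<in> prime_sets B L} - {{}}"
        then have "finite T" "T \<noteq> {}" using prime_setsD(1)[of "S \<union> T" B L] by auto
        then have "prod (\<lambda>p. av p * (1 - 1)) T = 0" by (auto simp: prod_zero_iff)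
        then show "prod (\<lambda>p. av p * (1 - 1)) T * zf b L (S \<union> T) = 0" by simp
      qed
    qed (use S finite_complements in auto)
    moreover have "(\<Prod>p\<in>S. h p * (1 * av p)\<^sup>2) = (\<Prod>p\<in>S. \<alpha>v p + \<beta>v p)"
    proof (rule prod.cong[OF refl])
      fix p assume "p \<in> S"
      then have p: "B < p" using prime_setsD(3)[OF S] by blast
      note lp = large_prime[OF p]
      have nz: "real k \<noteq> 0" "real p - real k \<noteq> 0" using lp by auto
      have "h p = (real p - real k) / real k" using nz by (simp add: h_def gv_def diff_divide_distrib)
      then have "h p * (1 * av p)\<^sup>2 = av p" using nz by (simp add: av_def power2_eq_square)
      then show "h p * (1 * av p)\<^sup>2 = \<alpha>v p + \<beta>v p" using \<alpha>v_plus_\<beta>v[OF p] by simp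
    qed
    ultimately show "(\<Prod>p\<in>S. h p * (1 * av p)\<^sup>2) *
        (\<Sum>T | S \<inter> T = {} \<and> S \<union> T \<in> prime_sets B L. prod (\<lambda>p. av p * (1 - 1)) T * zf b L (S \<union> T))\<^sup>2
       = (\<Prod>p\<in>S. \<alpha>v p + \<beta>v p) * (zf b L S)\<^sup>2" by simp
  qed
  also have "\<dots> = (\<Sum>x\<in>prime_pairs B L. prod \<alpha>v (fst x) * prod \<beta>v (snd x) * (zf b L (fst x \<union> snd x))\<^sup>2)"
    by (rule sum_pairs_by_union[symmetric])
  also have "\<dots> = pm.mass L * pm.avg L (\<lambda>x. (1 + b * pm.vpart L x)\<^sup>2)"
    using pm.mass_ge_1[of L] L by (simp add: pm.avg_def pm.wt_def zf_def pm.vpart_def)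
  finally show ?thesis by (simp add: gv_def)
qed

text \<open>The diagonal coefficient is \<open>\<alpha>v p * p / (p - 1)\<close>. Of the two equal
  factors \<open>In S\<close>, one absorbs the Euler product \<open>\<rho> S\<close> and is bounded
  below by \<open>inner_sum_lower_bound\<close>; the other is opened into its sum over
  \<open>T\<close> and produces the measure on pairs.\<close>

lemma prime_main_term:
  assumes mert: mertens and L: "0 < L" and b: "0 \<le> b"
  shows "L / (\<Prod>p\<in>Z. real p / (real p - 1)) * (pair_moments.mass B \<alpha>v \<beta>v L *
      pair_moments.avg B \<alpha>v \<beta>v L (\<lambda>x. (1 + b * pair_moments.vpart L x) *
       ((pair_moments.tpart L x + pair_moments.vpart L x) + b * (pair_moments.tpart L x + pair_moments.vpart L x)\<^sup>2 / 2)))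
   \<le> (\<Sum>D\<in>prime_sets B L. \<Sum>E\<in>prime_sets B L. lam b L D * lam b L E * (\<Prod>p\<in>D \<union> E. (real k - 1) / (real p - 1)))"
proof -
  interpret fam: divisor_family "prime_sets B L" by (rule divisor_family_prime_sets)
  interpret pm: pair_moments B \<alpha>v \<beta>v "real k - 1" 1
    by unfold_locales (rule density_\<alpha>v density_\<beta>v mert)+
  define h where "h = (\<lambda>p. 1 / (gv p * \<gamma>v p) - 1)"
  define \<rho> where "\<rho> = (\<lambda>S. \<Prod>p\<in>S. real p / (real p - 1))"
  define In where "In = (\<lambda>S. \<Sum>T | S \<inter> T = {} \<and> S \<union> T \<in> prime_sets B L. prod \<beta>v T * zf b L (S \<union> T))"
  define Y where "Y = (\<lambda>S. L - lnsum S)"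
  have g\<gamma>: "gv p * \<gamma>v p = (real k - 1) / (real p - 1)" if "B < p" for p
    using large_prime[OF that] by (simp add: gv_def \<gamma>v_def)
  have "(\<Sum>D\<in>prime_sets B L. \<Sum>E\<in>prime_sets B L. lam b L D * lam b L E * (\<Prod>p\<in>D \<union> E. (real k - 1) / (real p - 1)))
     = (\<Sum>D\<in>prime_sets B L. \<Sum>E\<in>prime_sets B L. lam b L D * lam b L E * (\<Prod>p\<in>D \<union> E. gv p * \<gamma>v p))"
  proof (intro sum.cong refl arg_cong2[where f = times] prod.cong)
    fix D E p assume "D \<in> prime_sets B L" "E \<in> prime_sets B L" "p \<in> D \<union> E"
    then have "B < p" using prime_setsD(3) by blast
    then show "(real k - 1) / (real p - 1) = gv p * \<gamma>v p" by (simp add: g\<gamma>)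
  qed
  also have "\<dots> = (\<Sum>S\<in>prime_sets B L. (\<Prod>p\<in>S. h p * (\<gamma>v p * av p)\<^sup>2) *
        (\<Sum>T | S \<inter> T = {} \<and> S \<union> T \<in> prime_sets B L. prod (\<lambda>p. av p * (1 - \<gamma>v p)) T * zf b L (S \<union> T))\<^sup>2)"
    unfolding lam_def
  proof (rule fam.sieve_weight_quadratic_form)
    fix p S assume "S \<in> prime_sets B L" "p \<in> S"
    then have "B < p" by (rule prime_setsD(3))
    note lp = large_prime[OF this]
    show "gv p \<noteq> 0 \<and> \<gamma>v p \<noteq> 0" using lp by (auto simp: gv_def \<gamma>v_def)
    show "h p = 1 / (gv p * \<gamma>v p) - 1" by (simp add: h_def)
  qed
  also have "\<dots> = (\<Sum>S\<in>prime_sets B L. prod \<alpha>v S * (\<rho> S * In S) * In S)"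
  proof (rule sum.cong[OF refl])
    fix S assume S: "S \<in> prime_sets B L"
    have "(\<Sum>T | S \<inter> T = {} \<and> S \<union> T \<in> prime_sets B L. prod (\<lambda>p. av p * (1 - \<gamma>v p)) T * zf b L (S \<union> T)) = In S"
      unfolding In_def
    proof (intro sum.cong refl arg_cong2[where f = times] prod.cong)
      fix T p assume "T \<in> {T. S \<inter> T = {} \<and> S \<union> T \<in> prime_sets B L}" "p \<in> T"
      then have "B < p" using prime_setsD(3)[of "S \<union> T" B L] by blast
      note lp = large_prime[OF this]
      have nz: "real k \<noteq> 0" "real p - real k \<noteq> 0" "real p - 1 \<noteq> 0" using lp by auto
      have "1 - \<gamma>v p = (real p - real k) / (real k * (real p - 1))"
        unfolding \<gamma>v_def using nz by (simp add: divide_simps) (simp add: algebra_simps)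
      then show "av p * (1 - \<gamma>v p) = \<beta>v p" using nz by (simp add: av_def \<beta>v_def)
    qed
    moreover have "(\<Prod>p\<in>S. h p * (\<gamma>v p * av p)\<^sup>2) = prod \<alpha>v S * \<rho> S"
      unfolding \<rho>_def prod.distrib[symmetric]
    proof (rule prod.cong[OF refl])
      fix p assume "p \<in> S"
      then have p: "B < p" using prime_setsD(3)[OF S] by blast
      note lp = large_prime[OF p]
      have nz: "real k \<noteq> 0" "real p - real k \<noteq> 0" "real p - 1 \<noteq> 0" "real k - 1 \<noteq> 0" using lp by auto
      have "h p = (real p - real k) / (real k - 1)"
        unfolding h_def g\<gamma>[OF p] using nz by (simp add: field_simps)
      moreover have "\<gamma>v p * av p = (real k - 1) * real p / ((real p - 1) * (real p - real k))"
        unfolding \<gamma>v_def av_def using nz by simp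
      ultimately show "h p * (\<gamma>v p * av p)\<^sup>2 = \<alpha>v p * (real p / (real p - 1))"
        unfolding \<alpha>v_def using nz by (simp add: power2_eq_square mult_ac)
    qed
    ultimately show "(\<Prod>p\<in>S. h p * (\<gamma>v p * av p)\<^sup>2) *
        (\<Sum>T | S \<inter> T = {} \<and> S \<union> T \<in> prime_sets B L. prod (\<lambda>p. av p * (1 - \<gamma>v p)) T * zf b L (S \<union> T))\<^sup>2
       = prod \<alpha>v S * (\<rho> S * In S) * In S" by (simp add: power2_eq_square)
  qed
  finally have eq: "(\<Sum>D\<in>prime_sets B L. \<Sum>E\<in>prime_sets B L. lam b L D * lam b L E * (\<Prod>p\<in>D \<union> E. (real k - 1) / (real p - 1)))
     = (\<Sum>S\<in>prime_sets B L. prod \<alpha>v S * (\<rho> S * In S) * In S)" .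
  have \<rho>Z: "0 < \<rho> Z" unfolding \<rho>_def
  proof (rule prod_pos)
    fix p assume "p \<in> Z"
    then have "1 < real p" using prime_gt_1_nat[OF Z(2)] by simp
    then show "0 < real p / (real p - 1)" by simp
  qed
  \<comment> \<open>The slope is \<open>b / L\<close> because \<open>zf\<close> measures sizes
    relative to \<open>L\<close>. The second factor \<open>In S\<close> is nonnegative since
    \<open>zf\<close> is, so the lower bound may be multiplied by it.\<close>
  have "(\<Sum>S\<in>prime_sets B L. prod \<alpha>v S * ((Y S + b / L * (Y S)\<^sup>2 / 2) / \<rho> Z) * In S)
     \<le> (\<Sum>S\<in>prime_sets B L. prod \<alpha>v S * (\<rho> S * In S) * In S)"
  proof (rule sum_mono)
    fix S assume S: "S \<in> prime_sets B L"
    note DS = prime_setsD[OF S]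
    have "Y S + b / L * (Y S)\<^sup>2 / 2 \<le> \<rho> S * \<rho> Z *
      (\<Sum>T | S \<inter> T = {} \<and> S \<union> T \<in> prime_sets B L. (\<Prod>p\<in>T. 1 / (real p - 1)) * (1 + b / L * (L - lnsum (S \<union> T))))"
      unfolding Y_def \<rho>_def Z_def by (rule inner_sum_lower_bound[OF S]) (use L b in simp)
    also have "(\<Sum>T | S \<inter> T = {} \<and> S \<union> T \<in> prime_sets B L. (\<Prod>p\<in>T. 1 / (real p - 1)) * (1 + b / L * (L - lnsum (S \<union> T)))) = In S"
      unfolding In_def \<beta>v_def zf_def by simp
    finally have "(Y S + b / L * (Y S)\<^sup>2 / 2) / \<rho> Z \<le> \<rho> S * In S"
      using \<rho>Z by (simp add: pos_divide_le_eq mult_ac)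
    moreover have "0 \<le> prod \<alpha>v S" by (rule prod_nonneg) (use DS pm.nonneg in blast)
    moreover have "0 \<le> In S" unfolding In_def
    proof (intro sum_nonneg mult_nonneg_nonneg)
      fix T assume T: "T \<in> {T. S \<inter> T = {} \<and> S \<union> T \<in> prime_sets B L}"
      then show "0 \<le> zf b L (S \<union> T)" using zf_bounds[OF _ L b] by blast
      show "0 \<le> prod \<beta>v T" by (rule prod_nonneg) (use T prime_setsD(2,3)[of "S \<union> T" B L] pm.nonneg in blast)
    qed
    ultimately show "prod \<alpha>v S * ((Y S + b / L * (Y S)\<^sup>2 / 2) / \<rho> Z) * In S \<le> prod \<alpha>v S * (\<rho> S * In S) * In S"
      by (intro mult_right_mono mult_left_mono)
  qed
  moreover have "(\<Sum>S\<in>prime_sets B L. prod \<alpha>v S * ((Y S + b / L * (Y S)\<^sup>2 / 2) / \<rho> Z) * In S)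
    = L / \<rho> Z * (pm.mass L * pm.avg L (\<lambda>x. (1 + b * pm.vpart L x) * ((pm.tpart L x + pm.vpart L x) + b * (pm.tpart L x + pm.vpart L x)\<^sup>2 / 2)))"
  proof -
    have "(\<Sum>S\<in>prime_sets B L. prod \<alpha>v S * ((Y S + b / L * (Y S)\<^sup>2 / 2) / \<rho> Z) * In S)
       = (\<Sum>S\<in>prime_sets B L. \<Sum>T | S \<inter> T = {} \<and> S \<union> T \<in> prime_sets B L.
            1 / \<rho> Z * (prod \<alpha>v S * prod \<beta>v T * (zf b L (S \<union> T) * (Y S + b / L * (Y S)\<^sup>2 / 2))))"
      unfolding In_def sum_distrib_left by (intro sum.cong refl) simp
    also have "\<dots> = (\<Sum>x\<in>prime_pairs B L.
            1 / \<rho> Z * (prod \<alpha>v (fst x) * prod \<beta>v (snd x) * (zf b L (fst x \<union> snd x) * (Y (fst x) + b / L * (Y (fst x))\<^sup>2 / 2))))"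
      by (rule sum_pairs_by_fst[symmetric]) (use L in simp)
    also have "\<dots> = (\<Sum>x\<in>prime_pairs B L. L / \<rho> Z * (pm.wt x * ((1 + b * pm.vpart L x) * ((pm.tpart L x + pm.vpart L x) + b * (pm.tpart L x + pm.vpart L x)\<^sup>2 / 2))))"
    proof (rule sum.cong[OF refl])
      fix x assume "x \<in> prime_pairs B L"
      then have "(fst x, snd x) \<in> prime_pairs B L" by simp
      note Dx = prime_pairsD[OF this]
      \<comment> \<open>The share of the budget left by the first component alone, that is
        \<open>1 - s\<close>.\<close>
      define u where "u = pm.tpart L x + pm.vpart L x"
      have u: "Y (fst x) = L * u"
        unfolding u_def pm.tpart_def pm.vpart_def Y_def using Dx(9) L by (simp add: field_simps)
      have "Y (fst x) + b / L * (Y (fst x))\<^sup>2 / 2 = L * (u + b * u\<^sup>2 / 2)"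
        unfolding u using L by (simp add: power2_eq_square field_simps)
      then show "1 / \<rho> Z * (prod \<alpha>v (fst x) * prod \<beta>v (snd x) * (zf b L (fst x \<union> snd x) * (Y (fst x) + b / L * (Y (fst x))\<^sup>2 / 2)))
        = L / \<rho> Z * (pm.wt x * ((1 + b * pm.vpart L x) * ((pm.tpart L x + pm.vpart L x) + b * (pm.tpart L x + pm.vpart L x)\<^sup>2 / 2)))"
        unfolding u_def[symmetric] by (simp add: zf_def pm.wt_def pm.vpart_def)
    qed
    also have "\<dots> = L / \<rho> Z * (pm.mass L * pm.avg L (\<lambda>x. (1 + b * pm.vpart L x) * ((pm.tpart L x + pm.vpart L x) + b * (pm.tpart L x + pm.vpart L x)\<^sup>2 / 2)))"
      using pm.mass_ge_1[of L] L by (simp only: sum_distrib_left[symmetric] pm.avg_def) simp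
    finally show ?thesis .
  qed
  ultimately show ?thesis unfolding eq \<rho>_def by linarith
qed

end

section \<open>Comparison of the sums\<close>

lemma negligible_error_add:
  assumes "negligible_error B \<eta> E" "negligible_error B \<eta> E'"
  shows "negligible_error B \<eta> (\<lambda>N Q. E N Q + E' N Q)"
  unfolding negligible_error_def
proof (intro conjI allI)
  obtain C C' where C: "eventually (\<lambda>N. \<forall>Q\<in>prime_sets B (\<eta> * ln (real N)).
        0 \<le> E N Q \<and> E N Q \<le> C * real N * ln (real N) * 2 ^ card Q / real (\<Prod>Q)) sequentially"
      "eventually (\<lambda>N. \<forall>Q\<in>prime_sets B (\<eta> * ln (real N)).
        0 \<le> E' N Q \<and> E' N Q \<le> C' * real N * ln (real N) * 2 ^ card Q / real (\<Prod>Q)) sequentially"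
    using assms unfolding negligible_error_def by blast
  from C have "eventually (\<lambda>N. \<forall>Q\<in>prime_sets B (\<eta> * ln (real N)).
        0 \<le> E N Q + E' N Q \<and> E N Q + E' N Q \<le> (C + C') * real N * ln (real N) * 2 ^ card Q / real (\<Prod>Q)) sequentially"
    by eventually_elim (simp add: ring_distribs add_divide_distrib add_mono)
  then show "\<exists>C. eventually (\<lambda>N. \<forall>Q\<in>prime_sets B (\<eta> * ln (real N)).
        0 \<le> E N Q + E' N Q \<and> E N Q + E' N Q \<le> C * real N * ln (real N) * 2 ^ card Q / real (\<Prod>Q)) sequentially" by blast
next
  fix A :: nat
  obtain C C' where C: "eventually (\<lambda>N. (\<Sum>Q\<in>prime_sets B (\<eta> * ln (real N)). E N Q) \<le> C * real N / ln (real N) ^ A) sequentially"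
      "eventually (\<lambda>N. (\<Sum>Q\<in>prime_sets B (\<eta> * ln (real N)). E' N Q) \<le> C' * real N / ln (real N) ^ A) sequentially"
    using assms unfolding negligible_error_def by blast
  from C have "eventually (\<lambda>N. (\<Sum>Q\<in>prime_sets B (\<eta> * ln (real N)). E N Q + E' N Q) \<le> (C + C') * real N / ln (real N) ^ A) sequentially"
    by eventually_elim (simp add: sum.distrib ring_distribs add_divide_distrib add_mono)
  then show "\<exists>C. eventually (\<lambda>N. (\<Sum>Q\<in>prime_sets B (\<eta> * ln (real N)). E N Q + E' N Q) \<le> C * real N / ln (real N) ^ A) sequentially" by blast
qed

context tuple_sieve
begin

text \<open>The half ensures that the union of two admissible sets has product at most
  \<open>N powr \<eta>\<close>.\<close>

definition Lev :: "real \<Rightarrow> nat \<Rightarrow> real" where "Lev \<eta> N = \<eta> / 2 * ln (real N)"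

text \<open>The error of \<open>weighted_sum_approx\<close> with the constant of
  \<open>lam_bound\<close> inserted.\<close>

definition err_total :: "real \<Rightarrow> real \<Rightarrow> (nat \<Rightarrow> nat set \<Rightarrow> real) \<Rightarrow> nat \<Rightarrow> real" where
  "err_total b \<eta> E N = ((1 + b) * (1 + Lev \<eta> N) ^ (2 * k))\<^sup>2 *
     (\<Sum>Q\<in>prime_sets B (2 * Lev \<eta> N). real (16 * k) ^ card Q * E N Q)"

text \<open>The squared weight bound costs \<open>4 * k\<close> logarithms and the size of
  \<open>vth\<close> one more; \<open>negligible_error_weighted\<close> allows any fixed
  number.\<close>

lemma err_total_tendsto:
  assumes E: "negligible_error B \<eta> E" and \<eta>: "0 \<le> \<eta>" "\<eta> \<le> 1" and b: "0 \<le> b"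
  shows "(\<lambda>N. ln (real N) * err_total b \<eta> E N / real N) \<longlonglongrightarrow> 0"
proof -
  define X where "X = (\<lambda>N. \<Sum>Q\<in>prime_sets B (\<eta> * ln (real N)). real (16 * k) ^ card Q * E N Q)"
  define C where "C = (1 + b)\<^sup>2 * 2 ^ (4 * k)"
  have lim: "(\<lambda>N. C * \<bar>ln (real N) ^ (4 * k + 1) * X N / real N\<bar>) \<longlonglongrightarrow> 0"
  proof -
    have "(\<lambda>N. ln (real N) ^ (4 * k + 1) * X N / real N) \<longlonglongrightarrow> 0"
      unfolding X_def by (rule negligible_error_weighted[OF E \<eta>(1)])
    then have "(\<lambda>N. C * \<bar>ln (real N) ^ (4 * k + 1) * X N / real N\<bar>) \<longlonglongrightarrow> C * \<bar>0\<bar>"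
      by (intro tendsto_intros)
    then show ?thesis by simp
  qed
  have "eventually (\<lambda>N. norm (ln (real N) * err_total b \<eta> E N / real N) \<le> C * \<bar>ln (real N) ^ (4 * k + 1) * X N / real N\<bar>) sequentially"
    using eventually_ln_ge[of 1]
  proof eventually_elim
    case (elim N)
    define l where "l = ln (real N)"
    have l: "1 \<le> l" using elim by (simp only: l_def)
    have X: "err_total b \<eta> E N = ((1 + b) * (1 + Lev \<eta> N) ^ (2 * k))\<^sup>2 * X N"
      unfolding err_total_def X_def Lev_def by simp
    have "\<eta> * l \<le> 1 * l" "0 \<le> \<eta> * l" using \<eta> l by (auto intro: mult_right_mono)
    moreover have "Lev \<eta> N = \<eta> * l / 2" by (simp add: Lev_def l_def)
    ultimately have "1 + Lev \<eta> N \<le> 2 * l" "0 \<le> 1 + Lev \<eta> N" using l by linarith+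
    then have "((1 + b) * (1 + Lev \<eta> N) ^ (2 * k))\<^sup>2 \<le> ((1 + b) * (2 * l) ^ (2 * k))\<^sup>2"
      using b by (intro power_mono mult_left_mono mult_nonneg_nonneg) auto
    also have "\<dots> = C * l ^ (4 * k)"
      unfolding C_def by (simp add: power_mult_distrib power_mult[symmetric])
    finally have le: "((1 + b) * (1 + Lev \<eta> N) ^ (2 * k))\<^sup>2 \<le> C * l ^ (4 * k)" .
    have "norm (l * err_total b \<eta> E N / real N) = l * ((1 + b) * (1 + Lev \<eta> N) ^ (2 * k))\<^sup>2 * (\<bar>X N\<bar> / real N)"
      unfolding X using l by (simp add: abs_mult)
    also have "\<dots> \<le> l * (C * l ^ (4 * k)) * (\<bar>X N\<bar> / real N)"
      by (intro mult_right_mono mult_left_mono le) (use l in auto)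
    also have "\<dots> = C * \<bar>l ^ (4 * k + 1) * X N / real N\<bar>"
      using l by (simp add: abs_mult)
    finally show ?case by (simp add: l_def)
  qed
  from Lim_null_comparison[OF this lim] show ?thesis .
qed

lemma wsum_nonneg: "0 \<le> wsum F l n"
  by (simp add: wsum_def)

lemma sieve_upper_lower:
  assumes L: "0 < L" and b: "0 \<le> b" and mert: mertens
    and N: "0 < N" "exp (2 * L) \<le> real N" "\<bar>r\<bar> \<le> int N"
  defines "\<Lambda> \<equiv> (1 + b) * (1 + L) ^ (2 * k)"
    and "w \<equiv> wsum (prime_sets B L) (lam b L)"
    and "A1 \<equiv> pair_moments.avg B \<alpha>v \<beta>v L (\<lambda>x. (1 + b * pair_moments.vpart L x)\<^sup>2)"
    and "A2 \<equiv> pair_moments.avg B \<alpha>v \<beta>v L (\<lambda>x. (1 + b * pair_moments.vpart L x) *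
       ((pair_moments.tpart L x + pair_moments.vpart L x) + b * (pair_moments.tpart L x + pair_moments.vpart L x)\<^sup>2 / 2))"
    and "m \<equiv> pair_moments.mass B \<alpha>v \<beta>v L"
  shows "\<bar>(\<Sum>n | n \<in> {N<..2 * N} \<and> good n. 1 * w n) - real N / real (\<Prod>Z) * (m * A1)\<bar>
      \<le> \<Lambda>\<^sup>2 * (\<Sum>Q\<in>prime_sets B (2 * L). real (16 * k) ^ card Q * 2)"
    and "\<bar>\<Sum>n | n \<in> {N<..2 * N} \<and> good n. real_of_int (liouville (int n + r)) * w n\<bar>
      \<le> \<Lambda>\<^sup>2 * (\<Sum>Q\<in>prime_sets B (2 * L). real (16 * k) ^ card Q * (2 * errB (3 * N) (modulus Q)))"
    and "\<And>h. h \<in> H \<Longrightarrow> real N / real (\<Prod>Z) * (L * (m * A2)) -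
        \<Lambda>\<^sup>2 * (\<Sum>Q\<in>prime_sets B (2 * L). real (16 * k) ^ card Q * (errA (2 * N + h) (modulus Q) + errA (N + h) (modulus Q)))
      \<le> (\<Sum>n | n \<in> {N<..2 * N} \<and> good n. vth (n + h) * w n)"
proof -
  have \<Lambda>: "0 \<le> \<Lambda>" unfolding \<Lambda>_def using b L by simp
  have lamb: "\<bar>lam b L D\<bar> \<le> \<Lambda> * 2 ^ card D" if "D \<in> prime_sets B L" for D
    unfolding \<Lambda>_def by (rule lam_bound[OF that L b])
  have m1: "1 \<le> modulus Q" if "Q \<in> prime_sets B (2 * L)" for Q
    using prime_setsD[OF that] by (intro modulus_pos) auto
  show "\<bar>(\<Sum>n | n \<in> {N<..2 * N} \<and> good n. 1 * w n) - real N / real (\<Prod>Z) * (m * A1)\<bar>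
      \<le> \<Lambda>\<^sup>2 * (\<Sum>Q\<in>prime_sets B (2 * L). real (16 * k) ^ card Q * 2)"
    unfolding w_def m_def A1_def count_main_term[OF mert L, symmetric]
    by (rule weighted_sum_approx[OF _ lamb \<Lambda> _ approx_count]) simp_all
  have "\<bar>(\<Sum>n | n \<in> {N<..2 * N} \<and> good n. real_of_int (liouville (int n + r)) * wsum (prime_sets B L) (lam b L) n)
      - 0 * (\<Sum>D\<in>prime_sets B L. \<Sum>E\<in>prime_sets B L. lam b L D * lam b L E * prod (\<lambda>_. 1) (D \<union> E))\<bar>
      \<le> \<Lambda>\<^sup>2 * (\<Sum>Q\<in>prime_sets B (2 * L). real (16 * k) ^ card Q * (2 * errB (3 * N) (modulus Q)))"
    by (rule weighted_sum_approx[OF _ lamb \<Lambda> _ approx_liouville[OF _ N(3)]]) (auto intro: errB_nonneg m1)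
  then show "\<bar>\<Sum>n | n \<in> {N<..2 * N} \<and> good n. real_of_int (liouville (int n + r)) * w n\<bar>
      \<le> \<Lambda>\<^sup>2 * (\<Sum>Q\<in>prime_sets B (2 * L). real (16 * k) ^ card Q * (2 * errB (3 * N) (modulus Q)))"
    unfolding w_def by simp
  fix h assume h: "h \<in> H"
  define D2 where "D2 = (\<Sum>D\<in>prime_sets B L. \<Sum>E\<in>prime_sets B L. lam b L D * lam b L E * (\<Prod>p\<in>D \<union> E. (real k - 1) / (real p - 1)))"
  have 1: "\<bar>(\<Sum>n | n \<in> {N<..2 * N} \<and> good n. vth (n + h) * w n) - real N / real (totient (\<Prod>Z)) * D2\<bar>
     \<le> \<Lambda>\<^sup>2 * (\<Sum>Q\<in>prime_sets B (2 * L). real (16 * k) ^ card Q * (errA (2 * N + h) (modulus Q) + errA (N + h) (modulus Q)))"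
    unfolding w_def D2_def
    by (rule weighted_sum_approx[OF _ lamb \<Lambda> _ approx_primes[OF _ N(2) h]])
       (auto intro!: add_nonneg_nonneg errA_nonneg m1)
  define \<rho> where "\<rho> = (\<Prod>p\<in>Z. real p / (real p - 1))"
  have 2: "L / \<rho> * (m * A2) \<le> D2"
    unfolding \<rho>_def m_def A2_def D2_def by (rule prime_main_term[OF mert L b])
  have tot: "real (totient (\<Prod>Z)) = (\<Prod>p\<in>Z. real p - 1)"
    by (rule real_totient_Prod_primes) (use Z in auto)
  \<comment> \<open>The Euler product lost in the inner sum is exactly what turns the normalisation
    \<open>N / totient (\<Prod>Z)\<close> of the primes into the \<open>N / \<Prod>Z\<close> of the
    count.\<close>
  have "\<rho> = real (\<Prod>Z) / real (totient (\<Prod>Z))"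
    unfolding \<rho>_def tot by (simp add: prod_dividef)
  moreover have pos: "0 < real (totient (\<Prod>Z))" "0 < real (\<Prod>Z)"
    using prod_Z_ge_1 by (auto simp del: of_nat_prod)
  ultimately have "real N / real (\<Prod>Z) * (L * (m * A2)) = real N / real (totient (\<Prod>Z)) * (L / \<rho> * (m * A2))"
    by (simp del: of_nat_prod)
  also have "\<dots> \<le> real N / real (totient (\<Prod>Z)) * D2"
    using 2 by (intro mult_left_mono) auto
  finally show "real N / real (\<Prod>Z) * (L * (m * A2)) -
        \<Lambda>\<^sup>2 * (\<Sum>Q\<in>prime_sets B (2 * L). real (16 * k) ^ card Q * (errA (2 * N + h) (modulus Q) + errA (N + h) (modulus Q)))
      \<le> (\<Sum>n | n \<in> {N<..2 * N} \<and> good n. vth (n + h) * w n)"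
    using 1 by linarith
qed

text \<open>Without a prime among the \<open>n + h\<close> the left side is 0 and the right side
  nonnegative. With one prime the Liouville value is 1, so the right side is
  \<open>ln (3 * N)\<close>, which dominates \<open>ln (n + h)\<close>.\<close>

lemma pointwise_inequality:
  assumes n0: "card {h\<in>H. prime (n + h)} \<le> 1" "(\<exists>h\<in>H. prime (n + h)) \<longrightarrow> liouville (int n + r) = 1"
    and n: "n \<le> 2 * N" "B \<le> N"
  shows "(\<Sum>h\<in>H. vth (n + h)) \<le> ln (real (3 * N)) * ((1 + real_of_int (liouville (int n + r))) / 2)"
proof -
  define PH where "PH = {h\<in>H. prime (n + h)}"
  have fin: "finite PH" using H by (simp add: PH_def)
  have sum: "(\<Sum>h\<in>H. vth (n + h)) = (\<Sum>h\<in>PH. ln (real (n + h)))"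
    unfolding vth_def PH_def by (rule sum.inter_filter[symmetric]) (rule H)
  show ?thesis
  proof (cases "PH = {}")
    case True
    have "real_of_int (liouville (int n + r)) = 1 \<or> real_of_int (liouville (int n + r)) = -1"
      unfolding liouville_def by (cases "even (bigOmega (int n + r))") auto
    moreover have "0 \<le> ln (real (3 * N))" by (cases "N = 0") auto
    ultimately have "0 \<le> ln (real (3 * N)) * ((1 + real_of_int (liouville (int n + r))) / 2)"
      by (intro mult_nonneg_nonneg) auto
    then show ?thesis unfolding sum True by simp
  next
    case False
    then obtain h where h: "h \<in> PH" by blast
    have "PH = {h}"
    proof -
      have "card PH = 1" using n0(1) False fin by (simp add: PH_def[symmetric] card_gt_0_iff le_Suc_eq)
      then show ?thesis using h by (metis card_1_singletonE singletonD)
    qed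
    moreover have "liouville (int n + r) = 1" using n0(2) h by (auto simp: PH_def)
    moreover have "ln (real (n + h)) \<le> ln (real (3 * N))"
    proof (rule ln_mono)
      have "prime (n + h)" using h by (simp add: PH_def)
      then show "0 < real (n + h)" by (simp only: of_nat_0_less_iff prime_gt_0_nat)
      have "h \<le> B" using h H(3) by (simp add: PH_def)
      then have "n + h \<le> 3 * N" using n by linarith
      then show "real (n + h) \<le> real (3 * N)" by (rule of_nat_mono)
    qed
    ultimately show ?thesis unfolding sum by simp
  qed
qed

text \<open>The pointwise inequality is summed against the weight, divided by \<open>ln N\<close>
  and by the common factor \<open>N / W\<close> times the mass, and then \<open>N\<close> tends to
  infinity. The numbers \<open>m1\<close>, \<open>m2\<close>, \<open>m3\<close> are the moments
  \<open>vmom\<close> for total dimension \<open>k\<close>, and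
  \<open>L = \<eta>' / 2 * ln N\<close> puts \<open>\<eta>'\<close> on the left.\<close>

lemma sieve_inequality:
  assumes A: "condA \<theta>" and Bc: "condB \<theta>"
    and \<eta>: "0 < \<eta>'" "\<eta>' < \<eta>" "\<eta> < \<theta>" "\<eta> < 1" and b: "0 \<le> b"
    and n0: "\<And>n. n0 \<le> n \<Longrightarrow> card {h\<in>H. prime (n + h)} \<le> 1"
      "\<And>n. n0 \<le> n \<Longrightarrow> (\<exists>h\<in>H. prime (n + h)) \<longrightarrow> liouville (int n + r) = 1"
    and m: "m1 = 1 / (real k + 1)" "m2 = 2 / ((real k + 1) * (real k + 2))"
      "m3 = 6 / ((real k + 1) * (real k + 2) * (real k + 3))"
  shows "real k * \<eta>' * (2 * m1 + 3 * b * m2 + b\<^sup>2 * m3) \<le> 1 + 2 * b * m1 + b\<^sup>2 * m2"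
proof -
  have mert: mertens by (rule mertens_of_condA[OF A]) (use \<eta> in linarith)
  interpret pm: pair_moments B \<alpha>v \<beta>v "real k - 1" 1
    by unfold_locales (rule density_\<alpha>v density_\<beta>v mert)+
  define W where "W = real (\<Prod>Z)"
  have W: "0 < W" unfolding W_def using prod_Z_ge_1 by (simp del: of_nat_prod)
  define L where "L = Lev \<eta>'"
  define A1 where "A1 = (\<lambda>N. pm.avg (L N) (\<lambda>x. (1 + b * pm.vpart (L N) x)\<^sup>2))"
  define A2 where "A2 = (\<lambda>N. pm.avg (L N) (\<lambda>x. (1 + b * pm.vpart (L N) x) *
      ((pm.tpart (L N) x + pm.vpart (L N) x) + b * (pm.tpart (L N) x + pm.vpart (L N) x)\<^sup>2 / 2)))"
  have Llim: "filterlim L at_top sequentially"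
    unfolding L_def Lev_def
    by (rule filterlim_tendsto_pos_mult_at_top[OF tendsto_const _ filterlim_ln_nat]) (use \<eta> in simp)
  have kp: "real k + 1 \<noteq> 0" "real k + 2 \<noteq> 0" "real k + 3 \<noteq> 0" by linarith+
  have vm: "pm.vmom 1 = m1" "pm.vmom 2 = m2" "pm.vmom 3 = m3"
  proof -
    have e: "1 + (real k - 1 + 1) / real (Suc j) = (real k + real (Suc j)) / real (Suc j)" for j
      by (simp add: add_divide_distrib add.commute)
    have "pm.vmom (Suc 0) = m1" unfolding pm.vmom.simps e m using kp by (simp add: add.commute)
    then show v1: "pm.vmom 1 = m1" by simp
    have "pm.vmom (Suc 1) = m2" unfolding pm.vmom.simps(2) e v1 m using kp by (simp add: add.commute mult.commute)
    then show v2: "pm.vmom 2 = m2" by (simp add: numeral_2_eq_2)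
    have "pm.vmom (Suc 2) = m3" unfolding pm.vmom.simps(2) e v2 m using kp by (simp add: add.commute mult_ac)
    then show "pm.vmom 3 = m3" by (simp add: numeral_3_eq_3 numeral_2_eq_2)
  qed
  have A1lim: "A1 \<longlonglongrightarrow> 1 + 2 * b * m1 + b\<^sup>2 * m2"
    unfolding A1_def vm[symmetric] by (rule filterlim_compose[OF pm.avg_square_tendsto Llim])
  have A2lim: "A2 \<longlonglongrightarrow> 2 * m1 + 3 * b * m2 + b\<^sup>2 * m3"
    unfolding A2_def vm[symmetric] by (rule filterlim_compose[OF pm.avg_product_tendsto[OF refl] Llim])
  define e1 where "e1 = err_total b \<eta>' (\<lambda>_ _. 2)"
  define e2 where "e2 = err_total b \<eta>' (\<lambda>N Q. errB (3 * N) (modulus Q) + errB (3 * N) (modulus Q))"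
  define e3 where "e3 = (\<lambda>h. err_total b \<eta>' (\<lambda>N Q. errA (2 * N + h) (modulus Q) + errA (N + h) (modulus Q)))"
  have \<eta>1: "0 \<le> \<eta>'" "\<eta>' \<le> 1" "\<eta> \<le> 1" using \<eta> by auto
  have s: "eventually (\<lambda>N. N \<le> 3 * N \<and> 3 * N \<le> 4 * N) sequentially"
    "eventually (\<lambda>N. N \<le> 2 * N + h \<and> 2 * N + h \<le> 4 * N) sequentially"
    "eventually (\<lambda>N. N \<le> N + h \<and> N + h \<le> 4 * N) sequentially"
    "eventually (\<lambda>N. N \<le> N \<and> N \<le> 4 * N) sequentially" for h :: nat
    by (rule eventually_mono[OF eventually_ge_at_top[of h]]; simp)+
  have n1: "negligible_error B \<eta>' (\<lambda>N Q. (\<lambda>_ _. 2) N (modulus Q))"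
  proof (rule negligible_of_level[OF \<eta>(1,2) \<eta>1(3) level_bound_const[OF \<eta>(4)] _ _ s(4)])
    fix N q :: nat assume N: "3 \<le> N" "1 \<le> q" "q \<le> N"
    have "exp 1 \<le> real N" using exp_le N by linarith
    then have l: "1 \<le> ln (real N)" using N by (simp add: ln_ge_iff)
    have "real (totient q) * 1 \<le> real N * ln (real N)"
      using totient_le[of q] N l by (intro mult_mono) auto
    then have "1 \<le> real N * ln (real N) / real (totient q)" using N by (simp add: le_divide_eq)
    then show "(2::real) \<le> 3 * (real N * ln (real N) / real (totient q))" by linarith
  qed simp
  have e1lim: "(\<lambda>N. ln (real N) * e1 N / real N) \<longlonglongrightarrow> 0"
    unfolding e1_def by (rule err_total_tendsto[OF n1 \<eta>1(1,2) b])
  have e2lim: "(\<lambda>N. ln (real N) * e2 N / real N) \<longlonglongrightarrow> 0"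
    unfolding e2_def
    by (intro err_total_tendsto[OF _ \<eta>1(1,2) b] negligible_error_add
          negligible_of_level[OF \<eta>(1,2) \<eta>1(3) level_bound_errB[OF Bc \<eta>(3)] errB_nonneg errB_trivial s(1)])
  have e3lim: "(\<lambda>N. ln (real N) * e3 h N / real N) \<longlonglongrightarrow> 0" for h
    unfolding e3_def
    by (intro err_total_tendsto[OF _ \<eta>1(1,2) b] negligible_error_add
          negligible_of_level[OF \<eta>(1,2) \<eta>1(3) level_bound_errA[OF A \<eta>(3)] errA_nonneg errA_trivial s(2)]
          negligible_of_level[OF \<eta>(1,2) \<eta>1(3) level_bound_errA[OF A \<eta>(3)] errA_nonneg errA_trivial s(3)])
  \<comment> \<open>All sieve errors after normalisation; the factor \<open>W\<close> comes from
    dividing by \<open>c = N / W * M\<close>.\<close>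
  define \<delta> where "\<delta> = (\<lambda>N. W * (ln (real N) * e1 N / real N + ln (real N) * e2 N / real N
      + (\<Sum>h\<in>H. ln (real N) * e3 h N / real N)))"
  have \<delta>lim: "\<delta> \<longlonglongrightarrow> 0"
  proof -
    have "\<delta> \<longlonglongrightarrow> W * (0 + 0 + (\<Sum>h\<in>H. 0))"
      unfolding \<delta>_def by (intro tendsto_intros e1lim e2lim e3lim)
    then show ?thesis by simp
  qed
  have "eventually (\<lambda>N. real k * (\<eta>' / 2) * A2 N \<le> ln (real (3 * N)) / (2 * ln (real N)) * A1 N + \<delta> N) sequentially"
    using eventually_ge_at_top[of n0] eventually_ge_at_top[of B] eventually_ge_at_top[of "nat \<bar>r\<bar>"]
      eventually_ge_at_top[of 3]
  proof eventually_elim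
    case (elim N)
    define l where "l = ln (real N)"
    have "exp 1 \<le> real N" using exp_le elim by linarith
    then have l: "1 \<le> l" unfolding l_def using elim by (simp add: ln_ge_iff)
    have LN: "L N = \<eta>' / 2 * l" "0 < L N" unfolding L_def Lev_def using \<eta> l by (auto simp: l_def)
    have expL: "exp (2 * L N) \<le> real N"
    proof -
      have "\<eta>' * l \<le> 1 * l" using \<eta>1 l by (intro mult_right_mono) auto
      then have "exp (2 * L N) \<le> exp l" using LN by simp
      then show ?thesis unfolding l_def using elim by simp
    qed
    have rN: "\<bar>r\<bar> \<le> int N" using elim by linarith
    have N0: "0 < N" using elim by simp
    define w where "w = wsum (prime_sets B (L N)) (lam b (L N))"
    define I where "I = {n. n \<in> {N<..2 * N} \<and> good n}"
    define M where "M = pm.mass (L N)"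
    have M: "1 \<le> M" unfolding M_def using LN by (intro pm.mass_ge_1) simp
    define S1 S2 where "S1 = (\<Sum>n\<in>I. w n)" and "S2 = (\<Sum>n\<in>I. real_of_int (liouville (int n + r)) * w n)"
    define S3 where "S3 = (\<lambda>h. \<Sum>n\<in>I. vth (n + h) * w n)"
    note main = sieve_upper_lower[OF LN(2) b mert N0 expL rN]
    have b1: "\<bar>S1 - real N / W * (M * A1 N)\<bar> \<le> e1 N"
      using main(1) by (simp only: S1_def I_def w_def M_def A1_def W_def e1_def err_total_def L_def mult_1)
    have b2: "\<bar>S2\<bar> \<le> e2 N"
      using main(2) by (simp only: S2_def I_def w_def e2_def err_total_def L_def mult_2)
    have b3: "real N / W * (L N * (M * A2 N)) - e3 h N \<le> S3 h" if "h \<in> H" for h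
      using main(3)[OF that] by (simp only: S3_def I_def w_def M_def A2_def W_def e3_def err_total_def L_def)
    have e3pos: "0 \<le> e3 h N" for h
      unfolding e3_def err_total_def
    proof (intro mult_nonneg_nonneg sum_nonneg add_nonneg_nonneg errA_nonneg)
      fix Q assume "Q \<in> prime_sets B (2 * Lev \<eta>' N)"
      note D = prime_setsD[OF this]
      show "1 \<le> modulus Q" by (rule modulus_pos[OF D(1,2)])
      then show "1 \<le> modulus Q" .
    qed auto
    have key: "(\<Sum>h\<in>H. S3 h) \<le> ln (real (3 * N)) / 2 * (S1 + S2)"
    proof -
      have "(\<Sum>h\<in>H. S3 h) = (\<Sum>n\<in>I. (\<Sum>h\<in>H. vth (n + h)) * w n)"
        unfolding S3_def by (subst sum.swap) (simp add: sum_distrib_right)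
      also have "\<dots> \<le> (\<Sum>n\<in>I. ln (real (3 * N)) * ((1 + real_of_int (liouville (int n + r))) / 2) * w n)"
      proof (intro sum_mono mult_right_mono pointwise_inequality n0)
        fix n assume n: "n \<in> I"
        then show "n0 \<le> n" "n0 \<le> n" "n \<le> 2 * N" using elim by (auto simp: I_def)
        show "B \<le> N" using elim by simp
        show "0 \<le> w n" unfolding w_def by (rule wsum_nonneg)
      qed
      also have "\<dots> = ln (real (3 * N)) / 2 * (S1 + S2)"
        unfolding S1_def S2_def sum.distrib[symmetric] sum_distrib_left
        by (intro sum.cong refl) (simp add: field_simps)
      finally show ?thesis .
    qed
    have ln3: "0 \<le> ln (real (3 * N))" "ln (real (3 * N)) \<le> 2 * l"
    proof -
      show "0 \<le> ln (real (3 * N))" using elim by simp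
      have "ln (real (3 * N)) = ln 3 + l" unfolding l_def using elim by (simp add: ln_mult)
      moreover have "ln 3 \<le> l" unfolding l_def using elim by (intro ln_mono) auto
      ultimately show "ln (real (3 * N)) \<le> 2 * l" by simp
    qed
    define c where "c = real N / W * M"
    have c: "0 < c" unfolding c_def using N0 W M by simp
    have lower: "real k * (c * (L N * A2 N)) - (\<Sum>h\<in>H. e3 h N) \<le> (\<Sum>h\<in>H. S3 h)"
    proof -
      have "(\<Sum>h\<in>H. c * (L N * A2 N) - e3 h N) \<le> (\<Sum>h\<in>H. S3 h)"
        by (rule sum_mono) (use b3 in \<open>simp add: c_def mult_ac\<close>)
      then show ?thesis by (simp add: sum_subtractf H(2))
    qed
    have upper: "ln (real (3 * N)) / 2 * (S1 + S2) \<le> ln (real (3 * N)) / 2 * (c * A1 N) + l * (e1 N + e2 N)"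
    proof -
      have "S1 + S2 \<le> c * A1 N + (e1 N + e2 N)" using b1 b2 by (simp add: c_def mult_ac)
      then have "ln (real (3 * N)) / 2 * (S1 + S2) \<le> ln (real (3 * N)) / 2 * (c * A1 N + (e1 N + e2 N))"
        using ln3 by (intro mult_left_mono) auto
      also have "\<dots> = ln (real (3 * N)) / 2 * (c * A1 N) + ln (real (3 * N)) / 2 * (e1 N + e2 N)"
        by (rule distrib_left)
      also have "ln (real (3 * N)) / 2 * (e1 N + e2 N) \<le> l * (e1 N + e2 N)"
        using b1 b2 ln3 by (intro mult_right_mono) linarith+
      finally show ?thesis by simp
    qed
    define e where "e = e1 N + e2 N + (\<Sum>h\<in>H. e3 h N)"
    have e3s: "0 \<le> (\<Sum>h\<in>H. e3 h N)" by (intro sum_nonneg e3pos)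
    have e0: "0 \<le> e" unfolding e_def using b1 b2 e3s by linarith
    have "(\<Sum>h\<in>H. e3 h N) \<le> l * (\<Sum>h\<in>H. e3 h N)" using l e3s by (simp add: mult_right_mono[of 1 l, simplified])
    then have "real k * (c * (L N * A2 N)) \<le> ln (real (3 * N)) / 2 * (c * A1 N) + l * e"
      using lower key upper unfolding e_def by (simp add: distrib_left)
    then have "real k * (c * (L N * A2 N)) / (c * l) \<le> (ln (real (3 * N)) / 2 * (c * A1 N) + l * e) / (c * l)"
      using c l by (intro divide_right_mono) auto
    moreover have "real k * (c * (L N * A2 N)) / (c * l) = real k * (\<eta>' / 2) * A2 N"
      using c l by (simp add: LN(1))
    moreover have "(ln (real (3 * N)) / 2 * (c * A1 N) + l * e) / (c * l) = ln (real (3 * N)) / (2 * l) * A1 N + e / c"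
      using c l by (simp add: field_simps)
    \<comment> \<open>\<open>M \<ge> 1\<close> and \<open>l \<ge> 1\<close> suffice here, so the
      growth of the mass does not enter.\<close>
    moreover have "e / c \<le> W * (l * e / real N)"
    proof -
      have "e / c = W * e / real N * (1 / M)" unfolding c_def by simp
      also have "\<dots> \<le> W * e / real N * 1" using M W e0 by (intro mult_left_mono) auto
      also have "\<dots> \<le> W * (l * e / real N)"
        using W e0 l by (simp add: divide_right_mono mult_right_mono[of 1 l, simplified])
      finally show ?thesis .
    qed
    moreover have "W * (l * e / real N) = \<delta> N"
      unfolding \<delta>_def e_def l_def by (simp add: distrib_left add_divide_distrib sum_distrib_left sum_divide_distrib)
    ultimately show ?case unfolding l_def by linarith
  qed
  moreover have "(\<lambda>N::nat. ln (real (3 * N)) / (2 * ln (real N))) \<longlonglongrightarrow> 1 / 2" by real_asymp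
  then have "(\<lambda>N. ln (real (3 * N)) / (2 * ln (real N)) * A1 N + \<delta> N) \<longlonglongrightarrow> 1 / 2 * (1 + 2 * b * m1 + b\<^sup>2 * m2) + 0"
    by (intro tendsto_add tendsto_mult A1lim \<delta>lim)
  moreover have "(\<lambda>N. real k * (\<eta>' / 2) * A2 N) \<longlonglongrightarrow> real k * (\<eta>' / 2) * (2 * m1 + 3 * b * m2 + b\<^sup>2 * m3)"
    by (intro tendsto_mult tendsto_const A2lim)
  ultimately have "real k * (\<eta>' / 2) * (2 * m1 + 3 * b * m2 + b\<^sup>2 * m3) \<le> 1 / 2 * (1 + 2 * b * m1 + b\<^sup>2 * m2) + 0"
    using tendsto_le[OF sequentially_bot] by blast
  then show ?thesis by simp
qed

end

section \<open>Passage from integers to naturals and the four numerical cases\<close>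

theorem theorem5:
  fixes \<theta>0 \<theta> :: real and k :: nat and H :: "int set" and r :: int
  assumes pair: "(\<theta>0, k) \<in> {(0.729, 2), (0.616, 3), (0.554, 4), (0.515, 5)}"
    and theta: "\<theta> > \<theta>0" and A: "condA \<theta>" and B: "condB \<theta>"
    and adm: "admissible_tuple k H"
    and r: "r \<noteq> 0" "r \<notin> H"
  shows "infinite {n::int. 2 \<le> card {h\<in>H. prime (n + h)}
            \<or> (\<exists>h\<in>H. prime (n + h) \<and> liouville (n + r) = -1)}"
proof
  assume fin: "finite {n::int. 2 \<le> card {h\<in>H. prime (n + h)}
            \<or> (\<exists>h\<in>H. prime (n + h) \<and> liouville (n + r) = -1)}" (is "finite ?X")
  have H: "finite H" "card H = k" "\<And>h. h \<in> H \<Longrightarrow> 0 \<le> h"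
    and Hp: "\<And>p::int. prime p \<Longrightarrow> \<exists>c. \<forall>h\<in>H. \<not> [h = c] (mod p)"
    using adm unfolding admissible_tuple_def by auto
  define H' where "H' = nat ` H"
  have injH: "inj_on nat H" using H(3) by (simp add: inj_on_def eq_nat_nat_iff)
  have H': "finite H'" "card H' = k" using H injH by (auto simp: H'_def card_image)
  have intH': "int ` H' = H" unfolding H'_def using H(3) by (force simp: image_iff)
  \<comment> \<open>A simple quantity that is at least \<open>2 * k\<close> and at least every
    shift.\<close>
  define B' where "B' = 2 * k + (\<Sum>h\<in>H'. h)"
  have "\<exists>c. \<forall>h\<in>H'. \<not> p dvd c + h" if p: "prime p" for p :: nat
  proof -
    obtain c where c: "\<forall>h\<in>H. \<not> [h = c] (mod int p)" using Hp[of "int p"] p by auto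
    \<comment> \<open>If the tuple misses the class \<open>c\<close>, then \<open>n\<close> in the
      class of \<open>-c\<close> makes \<open>n + h\<close> congruent to \<open>h - c\<close>, which
      is nonzero modulo \<open>p\<close> for every \<open>h\<close>.\<close>
    define d where "d = nat ((- c) mod int p)"
    have d: "int d = (- c) mod int p" using p prime_gt_0_nat[of p] by (simp add: d_def)
    have "\<not> p dvd d + h" if h: "h \<in> H'" for h
    proof
      assume "p dvd d + h"
      then have "int p dvd int d + int h" by (metis int_dvd_int_iff of_nat_add)
      then have "[int d + int h = 0] (mod int p)" by (simp add: cong_0_iff)
      then have "((- c) mod int p + int h) mod int p = 0" by (simp add: cong_def d)
      then have "(- c + int h) mod int p = 0" by (simp only: mod_add_left_eq)
      then have "(int h - c) mod int p = 0" by simp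
      then have "[int h = c] (mod int p)" by (simp add: cong_iff_dvd_diff dvd_eq_mod_eq_0)
      moreover have "int h \<in> H" using h intH' by blast
      ultimately show False using c by blast
    qed
    then show ?thesis by blast
  qed
  then obtain cres :: "nat \<Rightarrow> nat" where cres: "\<And>p h. prime p \<Longrightarrow> h \<in> H' \<Longrightarrow> \<not> p dvd cres p + h"
    by metis
  have k2: "2 \<le> k" using pair by auto
  interpret tuple_sieve B' k H' cres
  proof
    show "h \<le> B'" if "h \<in> H'" for h
      unfolding B'_def using member_le_sum[of h H' "\<lambda>h. h"] H' that by simp
  qed (use H' k2 cres in \<open>auto simp: B'_def\<close>)
  obtain M where M: "\<And>n. n \<in> ?X \<Longrightarrow> n \<le> M"
    using bdd_above_finite[OF fin] unfolding bdd_above_def by blast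
  define n0 where "n0 = nat (M + 1)"
  have notX: "int n \<notin> ?X" if "n0 \<le> n" for n
  proof
    assume "int n \<in> ?X"
    then have "int n \<le> M" by (rule M)
    then show False using that unfolding n0_def by linarith
  qed
  have pr: "prime (int n + int h) \<longleftrightarrow> prime (n + h)" for n h :: nat
    by (metis of_nat_add prime_nat_int_transfer)
  have trans: "{h\<in>H. prime (int n + h)} = int ` {h\<in>H'. prime (n + h)}" for n
    unfolding intH'[symmetric] by (auto simp: pr)
  have small: "card {h\<in>H'. prime (n + h)} \<le> 1" if "n0 \<le> n" for n
  proof -
    have "card {h\<in>H'. prime (n + h)} = card {h\<in>H. prime (int n + h)}"
      unfolding trans by (simp add: card_image)
    then show ?thesis using notX[OF that] by simp
  qed
  have liou: "(\<exists>h\<in>H'. prime (n + h)) \<longrightarrow> liouville (int n + r) = 1" if "n0 \<le> n" for n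
  proof
    assume "\<exists>h\<in>H'. prime (n + h)"
    then obtain h where h: "h \<in> H'" "prime (n + h)" by blast
    then have "int h \<in> H" "prime (int n + int h)" using intH' pr by auto
    then have "liouville (int n + r) \<noteq> -1" using notX[OF that] by blast
    then show "liouville (int n + r) = 1"
      unfolding liouville_def by (cases "even (bigOmega (int n + r))") auto
  qed
  \<comment> \<open>Strictly between \<open>\<theta>0\<close> and both \<open>\<theta>\<close> and
    1, so that \<open>\<theta>0\<close> itself can serve as the smaller level \<open>\<eta>'\<close>
    of the sieve.\<close>
  define \<eta> where "\<eta> = (\<theta>0 + min \<theta> 1) / 2"
  have \<theta>0: "0 < \<theta>0" "\<theta>0 < 1" using pair by auto
  have \<eta>: "\<theta>0 < \<eta>" "\<eta> < \<theta>" "\<eta> < 1" using theta \<theta>0 by (auto simp: \<eta>_def)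
  have ineq: "real k * \<theta>0 * (2 * (1 / (real k + 1)) + 3 * b * (2 / ((real k + 1) * (real k + 2)))
        + b\<^sup>2 * (6 / ((real k + 1) * (real k + 2) * (real k + 3))))
      \<le> 1 + 2 * b * (1 / (real k + 1)) + b\<^sup>2 * (2 / ((real k + 1) * (real k + 2)))" if "0 \<le> b" for b
    by (rule sieve_inequality[OF A B \<theta>0(1) \<eta> that small liou refl refl refl])
  \<comment> \<open>The values of \<open>b\<close> are close to optimal for linear \<open>f\<close>.\<close>
  from pair consider "\<theta>0 = 0.729 \<and> k = 2" | "\<theta>0 = 0.616 \<and> k = 3" | "\<theta>0 = 0.554 \<and> k = 4" | "\<theta>0 = 0.515 \<and> k = 5"
    by auto
  \<comment> \<open>Left against right side of \<open>ineq\<close>: about 1.847 against 1.833, 3.419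
    against 3.400, 5.825 against 5.800, and 7.894 against 7.857.\<close>
  then show False
  proof cases
    case 1
    then show False using ineq[of 1] by simp
  next
    case 2
    then show False using ineq[of 3] by simp
  next
    case 3
    then show False using ineq[of 6] by simp
  next
    case 4
    then show False using ineq[of 9] by simp
  qed
qed

end
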